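(* Let $K$ be a compact Hausdorff space and let $\mathcal{S}\subset\mathcal{L}(C(K))$ be a right amenable semigroup of Markov operators. The following assertions are valid. (i) For each $\mu\in P_{\mathcal{S}}(K)$ the $\mathcal{S}$-ideal $I_\mu$ is a radical $\mathcal{S}$-ideal. (ii) If $K$ is metrizable, then for each radical $\mathcal{S}$-ideal $I$ there is $\mu\in P_{\mathcal{S}}(K)$ with $I=I_\mu$.
   Context: $C(K)$ is the Banach lattice of continuous complex-valued functions on $K$; its dual $C(K)'$ is identified with the complex regular Borel measures on $K$, with $\langle f,\mu\rangle=\int_K f\,d\mu$. $\mathcal{L}(C(K))$ denotes the bounded linear operators on $C(K)$; $T\in\mathcal{L}(C(K))$ is Markov if it is positive and $T\mathbf{1}=\mathbf{1}$. A semigroup $\mathcal{S}\subset\mathcal{L}(C(K))$ (under composition, with the strong operator topology) is right amenable if there is a positive $m\in C_b(\mathcal{S})'$ with $m(\mathbf{1})=1$ and $m(R_Sf)=m(f)$ for all $f\in C_b(\mathcal{S})$, $S\in\mathcal{S}$, where $(R_Sf)(T)=f(TS)$. An $\mathcal{S}$-ideal is a closed proper ideal $I\subset C(K)$ with $SI\subset I$ for all $S\in\mathcal{S}$. $P_{\mathcal{S}}(K)$ is the set of probability measures $\mu\in C(K)'$ with $S'\mu=\mu$ for all $S\in\mathcal{S}$. For $\mu\in P_{\mathcal{S}}(K)$, the absolute kernel $I_\mu=\{f\in C(K): \langle |f|,\mu\rangle=0\}$ is an $\mathcal{S}$-ideal, and every $S\in\mathcal{S}$ induces (uniquely, by continuous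 extension) a bounded operator $S_\mu$ on $L^1(K,\mu)$; $\mu$ is ergodic if the common fixed space of all $S_\mu$ ($S\in\mathcal{S}$) in $L^1(K,\mu)$ is one-dimensional. A primitive $\mathcal{S}$-ideal is an ideal of the form $I_\mu$ with $\mu\in P_{\mathcal{S}}(K)$ ergodic; $\mathrm{Prim}(\mathcal{S})$ is the set of primitive $\mathcal{S}$-ideals. For $I\subset C(K)$, the $\mathcal{S}$-radical is $\mathrm{rad}_{\mathcal{S}}(I)=\bigcap\{p\in\mathrm{Prim}(\mathcal{S}): I\subset p\}$. An $\mathcal{S}$-ideal $I$ is a radical $\mathcal{S}$-ideal if $I=\mathrm{rad}_{\mathcal{S}}(I)$. *)

theory Defs
  imports "HOL-Probability.Probability"
begin

text \<open>
  The compact Hausdorff space \<open>K\<close> is a type \<open>'a::t2_space\<close> with \<open>compact (UNIV :: 'a set)\<close>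
  (the compactness is an assumption of the theorem, not of the definitions).  Every continuous
  function on such a space is bounded, so \<open>C(K)\<close> is the library's Banach space
  \<open>'a \<Rightarrow>\<^sub>C complex\<close> with the supremum norm.  The library provides real vector space structure only;
  complex scalars act through \<open>cscale\<close> and complex linearity of operators is a separate condition.
\<close>

type_synonym 'a CK = "'a \<Rightarrow>\<^sub>C complex"

definition cscale :: "complex \<Rightarrow> ('a::topological_space) CK \<Rightarrow> 'a CK" where
  "cscale c f = Bcontfun (\<lambda>x. c * f x)"

definition cmult :: "('a::topological_space) CK \<Rightarrow> 'a CK \<Rightarrow> 'a CK" where
  "cmult f g = Bcontfun (\<lambda>x. f x * g x)"

lemma cmult_apply [simp]: "cmult f g x = f x * g x"
proof -
  have "cmod (f x * g x) \<le> norm f * norm g" for x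
    by (simp add: norm_mult mult_mono norm_bounded)
  then have "bounded (range (\<lambda>x. f x * g x))"
    unfolding bounded_iff by blast
  then have "(\<lambda>x. f x * g x) \<in> bcontfun"
    by (auto simp: bcontfun_def intro!: continuous_intros)
  then show ?thesis
    by (simp add: cmult_def Bcontfun_inverse)
qed

lemma cscale_apply [simp]: "cscale c f x = c * f x"
proof -
  have "cscale c f = cmult (const_bcontfun c) f"
    by (simp add: cscale_def cmult_def const_bcontfun.rep_eq)
  then show ?thesis
    by (simp add: const_bcontfun.rep_eq)
qed

definition pos_fun :: "('a::topological_space) CK \<Rightarrow> bool" where
  "pos_fun f \<longleftrightarrow> (\<forall>x. f x \<in> \<real>\<^sub>\<ge>\<^sub>0)"


subsection \<open>Markov operators and right amenable semigroups\<close>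

type_synonym 'a CK_op = "'a CK \<Rightarrow>\<^sub>L 'a CK"

definition clinear_op :: "('a::topological_space) CK_op \<Rightarrow> bool" where
  "clinear_op T \<longleftrightarrow> (\<forall>c f. T (cscale c f) = cscale c (T f))"

definition markov_op :: "('a::topological_space) CK_op \<Rightarrow> bool" where
  "markov_op T \<longleftrightarrow>
     clinear_op T \<and> (\<forall>f. pos_fun f \<longrightarrow> pos_fun (T f)) \<and> T (const_bcontfun 1) = const_bcontfun 1"

definition op_semigroup :: "('a::topological_space) CK_op set \<Rightarrow> bool" where
  "op_semigroup \<S> \<longleftrightarrow> (\<forall>S\<in>\<S>. \<forall>T\<in>\<S>. S o\<^sub>L T \<in> \<S>)"

text \<open>
  \<open>C\<^sub>b(\<S>)\<close> for the strong operator topology on \<open>\<S>\<close>.  Its elements are represented by functions on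
  the whole operator space of which only the restriction to \<open>\<S>\<close> matters.
\<close>

definition Cb :: "('a::topological_space) CK_op set \<Rightarrow> ('a CK_op \<Rightarrow> complex) set" where
  "Cb \<S> = {f. continuous_map (subtopology strong_operator_topology \<S>) euclidean f \<and> bounded (f ` \<S>)}"

text \<open>
  A bounded linear functional on \<open>C\<^sub>b(\<S>)\<close>.  The first clause says that it is well defined on
  restrictions to \<open>\<S>\<close>; in the last one, the numbers \<open>B\<close> are the upper bounds of the
  supremum norm of \<open>f\<close>.
\<close>

definition Cb_dual :: "('a::topological_space) CK_op set \<Rightarrow> (('a CK_op \<Rightarrow> complex) \<Rightarrow> complex) \<Rightarrow> bool"
  where
  "Cb_dual \<S> m \<longleftrightarrow>
     (\<forall>f\<in>Cb \<S>. \<forall>g\<in>Cb \<S>. (\<forall>T\<in>\<S>. f T = g T) \<longrightarrow> m f = m g) \<and>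
     (\<forall>f\<in>Cb \<S>. \<forall>g\<in>Cb \<S>. m (\<lambda>T. f T + g T) = m f + m g) \<and>
     (\<forall>c. \<forall>f\<in>Cb \<S>. m (\<lambda>T. c * f T) = c * m f) \<and>
     (\<exists>C. \<forall>f\<in>Cb \<S>. \<forall>B\<ge>0. (\<forall>T\<in>\<S>. cmod (f T) \<le> B) \<longrightarrow> cmod (m f) \<le> C * B)"

definition right_amenable :: "('a::topological_space) CK_op set \<Rightarrow> bool" where
  "right_amenable \<S> \<longleftrightarrow>
     (\<exists>m. Cb_dual \<S> m \<and>
          (\<forall>f\<in>Cb \<S>. (\<forall>T\<in>\<S>. f T \<in> \<real>\<^sub>\<ge>\<^sub>0) \<longrightarrow> m f \<in> \<real>\<^sub>\<ge>\<^sub>0) \<and>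
          m (\<lambda>T. 1) = 1 \<and>
          (\<forall>f\<in>Cb \<S>. \<forall>S\<in>\<S>. m (\<lambda>T. f (T o\<^sub>L S)) = m f))"


subsection \<open>Ideals\<close>

text \<open>
  Ideals of the Banach lattice \<open>C(K)\<close>: solid linear subspaces.  For closed sets these are the
  same as the ideals of the algebra \<open>C(K)\<close>; see \<open>closed_lattice_ideal_iff_algebra_ideal\<close> below.
\<close>

definition lattice_ideal :: "('a::topological_space) CK set \<Rightarrow> bool" where
  "lattice_ideal I \<longleftrightarrow>
     0 \<in> I \<and> (\<forall>f\<in>I. \<forall>g\<in>I. f + g \<in> I) \<and> (\<forall>c. \<forall>f\<in>I. cscale c f \<in> I) \<and>
     (\<forall>g\<in>I. \<forall>f. (\<forall>x. cmod (apply_bcontfun f x) \<le> cmod (apply_bcontfun g x)) \<longrightarrow> f \<in> I)"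

definition algebra_ideal :: "('a::topological_space) CK set \<Rightarrow> bool" where
  "algebra_ideal I \<longleftrightarrow>
     0 \<in> I \<and> (\<forall>f\<in>I. \<forall>g\<in>I. f + g \<in> I) \<and> (\<forall>h. \<forall>f\<in>I. cmult h f \<in> I)"

lemma closed_lattice_ideal_iff_algebra_ideal:
  fixes I :: "('a::topological_space) CK set"
  assumes "closed I"
  shows "lattice_ideal I \<longleftrightarrow> algebra_ideal I"
proof
  assume L: "lattice_ideal I"
  have "cmult h f \<in> I" if "f \<in> I" for h f
  proof -
    have "cmod (cmult h f x) \<le> cmod (cscale (of_real (norm h)) f x)" for x
      by (simp add: norm_mult mult_right_mono norm_bounded)
    then show ?thesis
      using L that unfolding lattice_ideal_def by blast
  qed
  then show "algebra_ideal I"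
    using L unfolding lattice_ideal_def algebra_ideal_def by blast
next
  assume A: "algebra_ideal I"
  have scale: "cscale c f \<in> I" if "f \<in> I" for c f
  proof -
    have "cscale c f = cmult (const_bcontfun c) f"
      by (rule bcontfun_eqI) (simp add: const_bcontfun.rep_eq)
    then show ?thesis
      using A that unfolding algebra_ideal_def by auto
  qed
  have solid: "f \<in> I" if g: "g \<in> I" and le: "\<And>x. cmod (apply_bcontfun f x) \<le> cmod (apply_bcontfun g x)" for f g
  proof (rule closed_approachable[THEN iffD1, OF assms, rule_format])
    fix e :: real assume e: "e > 0"
    define d where "d = (e/2)\<^sup>2"
    have d: "d > 0" using e by (simp add: d_def)
    define q where "q = (\<lambda>x. f x * cnj (g x) / of_real ((cmod (g x))\<^sup>2 + d))"
    have den: "(cmod (g x))\<^sup>2 + d > 0" for x using d by (simp add: add_nonneg_pos)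
    have den': "complex_of_real ((cmod (g x))\<^sup>2 + d) \<noteq> 0" for x
      using den[of x] by (metis less_irrefl of_real_eq_0_iff)
    have cont: "continuous_on UNIV q"
      unfolding q_def by (intro continuous_intros continuous_on_apply_bcontfun ballI den')
    have "cmod (q x) \<le> 1" for x
    proof -
      have "cmod (q x) = cmod (f x) * cmod (g x) / ((cmod (g x))\<^sup>2 + d)"
        using den[of x] unfolding q_def
        by (simp only: norm_divide norm_mult complex_mod_cnj norm_of_real abs_of_pos)
      also have "\<dots> \<le> 1"
        using den[of x] mult_right_mono[OF le[of x], of "cmod (g x)"] d
        by (simp add: power2_eq_square)
      finally show ?thesis .
    qed
    then have bq: "q \<in> bcontfun"
      using cont unfolding bcontfun_def by (auto simp: bounded_iff)
    define h where "h = Bcontfun q"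
    have h: "apply_bcontfun h = q"
      unfolding h_def using bq by (rule Bcontfun_inverse)
    have "cmult h g \<in> I"
      using A g unfolding algebra_ideal_def by blast
    moreover have "dist (cmult h g) f \<le> e/2"
    proof (rule dist_bound)
      fix x
      let ?a = "cmod (g x)"
      have "q x * g x - f x = - (f x * of_real d / of_real (?a\<^sup>2 + d))"
      proof -
        have "q x * g x = f x * of_real (?a\<^sup>2) / of_real (?a\<^sup>2 + d)"
          unfolding q_def using complex_norm_square[of "g x"] by (simp add: mult.commute mult.left_commute)
        moreover have "f x = f x * of_real (?a\<^sup>2 + d) / of_real (?a\<^sup>2 + d)"
          using den'[of x] by (metis nonzero_mult_div_cancel_right)
        ultimately have "q x * g x - f x = (f x * of_real (?a\<^sup>2) - f x * of_real (?a\<^sup>2 + d)) / of_real (?a\<^sup>2 + d)"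
          by (metis diff_divide_distrib)
        then show ?thesis by (simp add: algebra_simps)
      qed
      then have "dist (cmult h g x) (f x) = cmod (f x) * d / (?a\<^sup>2 + d)"
        using den[of x] d unfolding cmult_apply h dist_norm
        by (simp only: norm_minus_cancel norm_divide norm_mult norm_of_real abs_of_pos)
      also have "\<dots> \<le> ?a * d / (?a\<^sup>2 + d)"
        using den[of x] d le[of x] by (intro divide_right_mono mult_right_mono) auto
      also have "\<dots> \<le> e/2"
      proof -
        have "2 * ?a * (e/2) \<le> ?a\<^sup>2 + d"
          using sum_squares_bound[of ?a "e/2"] by (simp add: d_def)
        moreover have "0 \<le> ?a * (e/2)"
          using e by simp
        ultimately have "?a * (e/2) \<le> ?a\<^sup>2 + d"
          by linarith
        then have "(e/2) * (?a * (e/2)) \<le> (e/2) * (?a\<^sup>2 + d)"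
          by (rule mult_left_mono) (use e in simp)
        then have "?a * d \<le> e/2 * (?a\<^sup>2 + d)"
          by (simp add: d_def power2_eq_square algebra_simps)
        then show ?thesis using den[of x] by (simp add: divide_le_eq)
      qed
      finally show "dist (cmult h g x) (f x) \<le> e/2" .
    qed
    ultimately show "\<exists>y\<in>I. dist y f < e"
      using e by (intro bexI[of _ "cmult h g"]) auto
  qed
  show "lattice_ideal I"
    using A scale solid unfolding lattice_ideal_def algebra_ideal_def by blast
qed

definition S_ideal :: "('a::topological_space) CK_op set \<Rightarrow> 'a CK set \<Rightarrow> bool" where
  "S_ideal \<S> I \<longleftrightarrow> lattice_ideal I \<and> closed I \<and> I \<noteq> UNIV \<and> (\<forall>S\<in>\<S>. blinfun_apply S ` I \<subseteq> I)"


subsection \<open>Invariant probability measures\<close>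

text \<open>
  The Borel sigma-algebra of a non-metrizable \<open>K\<close> carries non-regular measures, which do not
  correspond to elements of \<open>C(K)'\<close>; hence the explicit regularity.
\<close>

definition regular_prob :: "('a::topological_space) measure \<Rightarrow> bool" where
  "regular_prob M \<longleftrightarrow>
     prob_space M \<and> sets M = sets borel \<and>
     (\<forall>A\<in>sets borel.
        emeasure M A = (SUP C\<in>{C. compact C \<and> C \<in> sets borel \<and> C \<subseteq> A}. emeasure M C) \<and>
        emeasure M A = (INF U\<in>{U. open U \<and> A \<subseteq> U}. emeasure M U))"

definition pairing :: "('a::topological_space) CK \<Rightarrow> 'a measure \<Rightarrow> complex" where
  "pairing f M = (\<integral>x. apply_bcontfun f x \<partial>M)"

text \<open>\<open>S'\<mu> = \<mu>\<close> in \<open>C(K)'\<close> means \<open>\<langle>S f, \<mu>\<rangle> = \<langle>f, \<mu>\<rangle>\<close> for all \<open>f \<in> C(K)\<close>.\<close>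

definition inv_prob :: "('a::topological_space) CK_op set \<Rightarrow> 'a measure set" where
  "inv_prob \<S> = {M. regular_prob M \<and> (\<forall>S\<in>\<S>. \<forall>f. pairing (S f) M = pairing f M)}"

definition abs_kernel :: "('a::topological_space) measure \<Rightarrow> 'a CK set" where
  "abs_kernel M = {f. (\<integral>x. cmod (apply_bcontfun f x) \<partial>M) = 0}"


subsection \<open>Ergodicity\<close>

text \<open>
  Elements of \<open>L\<^sup>1(K,\<mu>)\<close> are represented by complex-valued integrable functions, with equality
  almost everywhere.  \<open>L1_extension M S T\<close> says that \<open>T\<close> represents a bounded linear operator on
  \<open>L\<^sup>1(K,\<mu>)\<close> that extends \<open>S\<close>.  For invariant \<open>\<mu>\<close> such an operator exists and is unique up to
  equality almost everywhere, and \<open>L1_op M S\<close> is then the operator \<open>S\<^sub>\<mu>\<close>.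
\<close>

definition L1_extension ::
  "('a::topological_space) measure \<Rightarrow> 'a CK_op \<Rightarrow> (('a \<Rightarrow> complex) \<Rightarrow> 'a \<Rightarrow> complex) \<Rightarrow> bool" where
  "L1_extension M S T \<longleftrightarrow>
     (\<forall>f. integrable M f \<longrightarrow> integrable M (T f)) \<and>
     (\<forall>f g. integrable M f \<longrightarrow> integrable M g \<longrightarrow> (AE x in M. f x = g x) \<longrightarrow>
        (AE x in M. T f x = T g x)) \<and>
     (\<forall>f g. integrable M f \<longrightarrow> integrable M g \<longrightarrow>
        (AE x in M. T (\<lambda>y. f y + g y) x = T f x + T g x)) \<and>
     (\<forall>c f. integrable M f \<longrightarrow> (AE x in M. T (\<lambda>y. c * f y) x = c * T f x)) \<and>
     (\<exists>C. \<forall>f. integrable M f \<longrightarrow> (\<integral>x. cmod (T f x) \<partial>M) \<le> C * (\<integral>x. cmod (f x) \<partial>M)) \<and>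
     (\<forall>h :: 'a CK. AE x in M. T (apply_bcontfun h) x = S h x)"

definition L1_op :: "('a::topological_space) measure \<Rightarrow> 'a CK_op \<Rightarrow> ('a \<Rightarrow> complex) \<Rightarrow> 'a \<Rightarrow> complex"
  where "L1_op M S = (SOME T. L1_extension M S T)"

definition L1_fix :: "('a::topological_space) CK_op set \<Rightarrow> 'a measure \<Rightarrow> ('a \<Rightarrow> complex) set" where
  "L1_fix \<S> M = {f. integrable M f \<and> (\<forall>S\<in>\<S>. AE x in M. L1_op M S f x = f x)}"

text \<open>The common fixed space is spanned by a single nonzero element of \<open>L\<^sup>1(K,\<mu>)\<close>.\<close>

definition ergodic_measure :: "('a::topological_space) CK_op set \<Rightarrow> 'a measure \<Rightarrow> bool" where
  "ergodic_measure \<S> M \<longleftrightarrow>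
     (\<exists>e\<in>L1_fix \<S> M. \<not> (AE x in M. e x = 0) \<and>
        (\<forall>f\<in>L1_fix \<S> M. \<exists>c. AE x in M. f x = c * e x))"


subsection \<open>Primitive and radical ideals\<close>

definition Prim :: "('a::topological_space) CK_op set \<Rightarrow> 'a CK set set" where
  "Prim \<S> = {abs_kernel M | M. M \<in> inv_prob \<S> \<and> ergodic_measure \<S> M}"

text \<open>An empty intersection is all of \<open>C(K)\<close>.\<close>

definition S_radical :: "('a::topological_space) CK_op set \<Rightarrow> 'a CK set \<Rightarrow> 'a CK set" where
  "S_radical \<S> I = \<Inter>{p \<in> Prim \<S>. I \<subseteq> p}"

definition radical_ideal :: "('a::topological_space) CK_op set \<Rightarrow> 'a CK set \<Rightarrow> bool" where
  "radical_ideal \<S> I \<longleftrightarrow> S_ideal \<S> I \<and> I = S_radical \<S> I"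

end

theory Submission
  imports Defs
begin

text \<open>
  For an invariant measure \<open>\<mu>\<close> and \<open>f\<close> outside \<open>I\<^sub>\<mu>\<close>, the invariant states of \<open>C(K)\<close> that vanish on
  \<open>I\<^sub>\<mu>\<close> form a weak* compact convex set. An extreme point of it that maximizes \<open>\<bar>f\<bar>\<close> is given, by the
  Riesz representation theorem, by an invariant measure \<open>\<nu>\<close> with \<open>I\<^sub>\<mu> \<subseteq> I\<^sub>\<nu>\<close> and \<open>f \<notin> I\<^sub>\<nu>\<close>.  The common
  fixed space of the \<open>S\<^sub>\<nu>\<close> is a sublattice of \<open>L\<^sup>1(K,\<nu>)\<close> that contains the constants, so a nonconstant
  fixed function yields a fixed indicator, which splits \<open>\<nu>\<close> into two invariant parts and contradicts
  extremality; hence \<open>\<nu>\<close> is ergodic.  If \<open>K\<close> is metrizable, the ergodic measures \<open>\<nu>\<close> with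
  \<open>I \<subseteq> I\<^sub>\<nu>\<close> can be replaced by countably many, one for every set of a countable basis, and a
  weighted sum of these has absolute kernel \<open>I\<close>.
\<close>

section \<open>The Riesz representation theorem\<close>

text \<open>Extremality concerns functionals on \<open>C(K)\<close>, ergodicity concerns operators
  on \<open>L\<^sup>1(K,\<nu>)\<close>. A fixed indicator of a set A joins the two: squeezing
  between multiples of the indicators of A and of -A shows that \<open>S\<^sub>\<nu>\<close> does
  not mix A with its complement, so integration over A is again an invariant functional on
  \<open>C(K)\<close>. The fixed space is a sublattice because |f| = |S f| <= S |f| almost
  everywhere while both ends have the same integral. Vanishing on \<open>I\<^sub>\<mu>\<close>
  belongs to the convex set from the start: it is a closed condition, \<mu> satisfies it, and the
  two parts of \<nu> inherit it because they have densities with respect to \<nu>. As \<mu> also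
  competes for the maximum of |f|, that maximum is positive. Functionals are points of a product of
  real lines, whose topology restricts to the weak* one, so compactness is Tychonoff's theorem, and
  an extreme point is a minimal closed face. In the metrizable case countably many measures suffice
  because {f \<noteq> 0} is open: a measure that charges it charges a basic open subset, and so does
  the measure chosen for that subset.\<close>

lemma Urysohn_compact_T2:
  fixes C D :: "'a::t2_space set"
  assumes "compact (UNIV :: 'a set)" "closed C" "closed D" "C \<inter> D = {}"
  shows "\<exists>u :: 'a \<Rightarrow> real. continuous_on UNIV u \<and> (\<forall>x. 0 \<le> u x \<and> u x \<le> 1) \<and>
    (\<forall>x\<in>C. u x = 1) \<and> (\<forall>x\<in>D. u x = 0)"
proof -
  have "compact_space (euclidean :: 'a topology)"
    using assms(1) by (simp add: compact_space_def)
  moreover have "Hausdorff_space (euclidean :: 'a topology)"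
    unfolding Hausdorff_space_def disjnt_def using hausdorff by (metis open_openin)
  ultimately have "normal_space (euclidean :: 'a topology)"
    using compact_Hausdorff_or_regular_imp_normal_space by blast
  then obtain u :: "'a \<Rightarrow> real" where u: "continuous_map euclidean (top_of_set {0..1}) u"
     "u ` D \<subseteq> {0}" "u ` C \<subseteq> {1}"
    using Urysohn_lemma[of euclidean D C 0 1] assms by (force simp: disjnt_def)
  have "continuous_on UNIV u"
    using u(1) by (simp add: continuous_map_in_subtopology)
  moreover have "\<forall>x. 0 \<le> u x \<and> u x \<le> 1"
    using u(1) by (auto simp: continuous_map_in_subtopology Pi_iff image_subset_iff)
  ultimately show ?thesis using u(2,3) by (intro exI[of _ u]) auto
qed

text \<open>Every law is guarded by continuity because the type of \<open>L\<close> admits all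
  functions. Real functionals suffice, as complex functions are split into real and imaginary
  parts.\<close>

locale compact_state =
  fixes L :: "('a::t2_space \<Rightarrow> real) \<Rightarrow> real"
  assumes compact_UNIV: "compact (UNIV :: 'a set)"
    and add: "\<And>f g. continuous_on UNIV f \<Longrightarrow> continuous_on UNIV g \<Longrightarrow> L (\<lambda>x. f x + g x) = L f + L g"
    and scale: "\<And>c f. continuous_on UNIV f \<Longrightarrow> L (\<lambda>x. c * f x) = c * L f"
    and nonneg: "\<And>f. continuous_on UNIV f \<Longrightarrow> (\<And>x. 0 \<le> f x) \<Longrightarrow> 0 \<le> L f"
    and one: "L (\<lambda>_. 1) = 1"
begin

section \<open>Positive functionals and the content of open sets\<close>

lemma const: "L (\<lambda>_. c) = c"
  using scale[of "\<lambda>_. 1" c] one by simp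

lemma diff:
  assumes "continuous_on UNIV f" "continuous_on UNIV g"
  shows "L (\<lambda>x. f x - g x) = L f - L g"
proof -
  have "L (\<lambda>x. f x + (- 1) * g x) = L f + L (\<lambda>x. (- 1) * g x)"
    by (intro add assms continuous_intros)
  then show ?thesis
    unfolding scale[OF assms(2)] by simp
qed

lemma mono:
  assumes "continuous_on UNIV f" "continuous_on UNIV g" "\<And>x. f x \<le> g x"
  shows "L f \<le> L g"
proof -
  have "0 \<le> L (\<lambda>x. g x - f x)"
    by (intro nonneg continuous_on_diff) (use assms in auto)
  then show ?thesis
    unfolding diff[OF assms(2,1)] by simp
qed

text \<open>The functions need only vanish off \<open>U\<close>. Compact support inside
  \<open>U\<close> is obtained from \<open>truncate_below\<close> at the cost of an arbitrarily
  small error in \<open>L\<close>.\<close>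

definition below :: "'a set \<Rightarrow> ('a \<Rightarrow> real) set" where
  "below U = {f. continuous_on UNIV f \<and> (\<forall>x. 0 \<le> f x \<and> f x \<le> 1) \<and> (\<forall>x. x \<notin> U \<longrightarrow> f x = 0)}"

definition content :: "'a set \<Rightarrow> real" where
  "content U = (SUP f\<in>below U. L f)"

definition outer :: "'a set \<Rightarrow> ennreal" where
  "outer A = (INF U\<in>{U. open U \<and> A \<subseteq> U}. ennreal (content U))"

lemma below_zero: "(\<lambda>_. 0) \<in> below U"
  by (simp add: below_def)

lemma below_bounds:
  assumes "f \<in> below U"
  shows "0 \<le> L f" "L f \<le> 1"
proof -
  have f: "continuous_on UNIV f" "\<And>x. 0 \<le> f x" "\<And>x. f x \<le> 1"
    using assms by (auto simp: below_def)
  show "0 \<le> L f" by (rule nonneg[OF f(1,2)])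
  show "L f \<le> 1" using mono[OF f(1) continuous_on_const f(3)] one by simp
qed

lemma content_ge: "f \<in> below U \<Longrightarrow> L f \<le> content U"
  unfolding content_def by (rule cSUP_upper) (auto intro!: bdd_aboveI[of _ 1] below_bounds)

lemma content_le: "(\<And>f. f \<in> below U \<Longrightarrow> L f \<le> b) \<Longrightarrow> content U \<le> b"
  unfolding content_def by (rule cSUP_least) (auto intro: below_zero)

lemma content_nonneg: "0 \<le> content U"
  using content_ge[OF below_zero[of U]] const[of 0] by simp

lemma content_le_1: "content U \<le> 1"
  by (rule content_le) (rule below_bounds)

lemma content_approx:
  assumes "e > 0"
  obtains f where "f \<in> below U" "content U < L f + e"
proof -
  have "\<not> (\<forall>f\<in>below U. L f \<le> content U - e)"
    using content_le[of U "content U - e"] assms by auto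
  then show thesis using that by fastforce
qed

lemma content_mono: "U \<subseteq> V \<Longrightarrow> content U \<le> content V"
  by (rule content_le, rule content_ge) (auto simp: below_def)

lemma content_empty: "content {} = 0"
proof (rule antisym[OF content_le content_nonneg])
  fix f assume "f \<in> below {}"
  then have "f = (\<lambda>_. 0)" by (auto simp: below_def)
  then show "L f \<le> 0" using const[of 0] by simp
qed

lemma content_UNIV: "content UNIV = 1"
  using content_ge[of "\<lambda>_. 1" UNIV] content_le_1[of UNIV] one by (simp add: below_def)

text \<open>Truncating \<open>f\<close> to \<open>max (f - e) 0\<close> changes \<open>L f\<close> by at most \<open>e\<close> and makes the support compact.\<close>

lemma truncate_below:
  assumes "f \<in> below U" "e > 0"
  shows "(\<lambda>x. max (f x - e) 0) \<in> below {x. e \<le> f x}" "L f \<le> L (\<lambda>x. max (f x - e) 0) + e"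
    "closed {x. e \<le> f x}" "{x. e \<le> f x} \<subseteq> U"
proof -
  have c: "continuous_on UNIV f" and b: "\<And>x. 0 \<le> f x \<and> f x \<le> 1"
    using assms by (auto simp: below_def)
  have c': "continuous_on UNIV (\<lambda>x. max (f x - e) 0)"
    by (intro continuous_intros c)
  show "(\<lambda>x. max (f x - e) 0) \<in> below {x. e \<le> f x}"
    using c' b assms(2) unfolding below_def by (auto simp: max_def) (smt (verit) b)
  have "L f \<le> L (\<lambda>x. max (f x - e) 0 + e)"
    by (intro mono c continuous_intros) auto
  then show "L f \<le> L (\<lambda>x. max (f x - e) 0) + e"
    using add[OF c', of "\<lambda>_. e"] const[of e] by simp
  show "closed {x. e \<le> f x}"
    by (intro closed_Collect_le continuous_intros c)
  show "{x. e \<le> f x} \<subseteq> U"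
    using assms by (force simp: below_def)
qed

text \<open>A Urysohn function \<open>u\<close> divides f into f u, which lives on \<open>U\<close>,
  and f (1 - u), which up to an error \<open>e\<close> lives on \<open>V\<close>.\<close>

lemma content_Un:
  assumes "open U" "open V"
  shows "content (U \<union> V) \<le> content U + content V"
proof (rule content_le, rule field_le_epsilon)
  fix f and e :: real assume f: "f \<in> below (U \<union> V)" and e: "0 < e"
  have cf: "continuous_on UNIV f" and bf: "\<And>x. 0 \<le> f x \<and> f x \<le> 1"
    using f by (auto simp: below_def)
  let ?C = "{x. e \<le> f x}"
  have C: "closed ?C" "?C \<subseteq> U \<union> V"
    using truncate_below[OF f e] by auto
  have "closed (?C - V)" "closed (- U)" "(?C - V) \<inter> - U = {}"
    using C assms by (auto intro: closed_Diff)
  from Urysohn_compact_T2[OF compact_UNIV this]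
  obtain u :: "'a \<Rightarrow> real" where u: "continuous_on UNIV u" "\<And>x. 0 \<le> u x \<and> u x \<le> 1"
    "\<And>x. x \<in> ?C - V \<Longrightarrow> u x = 1" "\<And>x. x \<in> - U \<Longrightarrow> u x = 0"
    by blast
  define g where "g x = f x * u x" for x
  \<comment> \<open>Off \<open>V\<close>, either \<open>f >= e\<close> and then
    \<open>u = 1\<close>, or \<open>f < e\<close>; subtracting \<open>e\<close> removes what is left
    in the second case.\<close>
  define h where "h x = max (f x * (1 - u x) - e) 0" for x
  have cg: "continuous_on UNIV g" and ch: "continuous_on UNIV h"
    unfolding g_def h_def by (intro continuous_intros cf u)+
  have le1: "f x * u x \<le> 1" "f x * (1 - u x) \<le> f x" for x
    using bf[of x] u(2)[of x] by (auto simp: mult_le_one mult_left_le)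
  have g: "g \<in> below U"
    using cg bf u(2,4) le1 by (auto simp: below_def g_def)
  have "h x = 0" if "x \<notin> V" for x
    using le1(2)[of x] u(3)[of x] that e unfolding h_def by (cases "x \<in> ?C") auto
  moreover have "h x \<le> 1" for x
    using le1(2)[of x] bf[of x] e unfolding h_def by (smt (verit))
  ultimately have h: "h \<in> below V"
    using ch by (auto simp: below_def h_def)
  have "L f \<le> L (\<lambda>x. (g x + h x) + e)"
  proof (intro mono cf continuous_intros cg ch)
    fix x
    have "f x = f x * u x + f x * (1 - u x)" by (simp add: algebra_simps)
    then show "f x \<le> g x + h x + e"
      unfolding g_def h_def by linarith
  qed
  also have "\<dots> = L g + L h + e"
    using add[of "\<lambda>x. g x + h x" "\<lambda>_. e"] add[OF cg ch] const[of e] cg ch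
    by (simp add: continuous_on_add)
  finally show "L f \<le> content U + content V + e"
    using content_ge[OF g] content_ge[OF h] by linarith
qed

lemma content_UN_lessThan:
  fixes N :: nat
  assumes "\<And>n. open (U n)"
  shows "content (\<Union>n<N. U n) \<le> (\<Sum>n<N. content (U n))"
proof (induction N)
  case (Suc N)
  have "content (\<Union>n<Suc N. U n) = content ((\<Union>n<N. U n) \<union> U N)"
    by (simp add: lessThan_Suc Un_commute)
  also have "\<dots> \<le> content (\<Union>n<N. U n) + content (U N)"
    using assms by (intro content_Un) auto
  finally show ?case using Suc by simp
qed (simp add: content_empty)

text \<open>Countable subadditivity reduces to the finite case: {e/2 <= f} is compact, so finitely
  many \<open>U n\<close> contain the set where the truncated function is positive.\<close>

lemma content_UN:
  assumes U: "\<And>n::nat. open (U n)"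
  shows "ennreal (content (\<Union>n. U n)) \<le> (\<Sum>n. ennreal (content (U n)))"
proof (rule ennreal_le_epsilon)
  fix e :: real assume e: "0 < e"
  obtain f where f: "f \<in> below (\<Union>n. U n)" "content (\<Union>n. U n) < L f + e/2"
    using content_approx[of "e/2"] e by auto
  note t = truncate_below[OF f(1), of "e/2"]
  have "compact {x. e/2 \<le> f x}"
    using t(3) e compact_UNIV compact_Int_closed[of UNIV] by auto
  then obtain N where N: "{x. e/2 \<le> f x} \<subseteq> (\<Union>n<N. U n)"
  proof -
    have "compact {x. e/2 \<le> f x} \<Longrightarrow> \<exists>T\<subseteq>UNIV. finite T \<and> {x. e/2 \<le> f x} \<subseteq> (\<Union>n\<in>T. U n)"
      using compactE_image[of "{x. e/2 \<le> f x}" UNIV U] U t(4) e by (metis half_gt_zero)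
    with \<open>compact _\<close> obtain T where T: "finite T" "{x. e/2 \<le> f x} \<subseteq> (\<Union>n\<in>T. U n)" by auto
    obtain N where "T \<subseteq> {..<N}" using finite_nat_iff_bounded T(1) by auto
    then show ?thesis using T(2) that[of N] by blast
  qed
  have "max (f x - e/2) 0 = 0" if "x \<notin> (\<Union>n<N. U n)" for x
  proof -
    have "\<not> e/2 \<le> f x" using N that by blast
    then show ?thesis by simp
  qed
  then have "(\<lambda>x. max (f x - e/2) 0) \<in> below (\<Union>n<N. U n)"
    using t(1) e unfolding below_def by simp
  from content_ge[OF this] have "content (\<Union>n. U n) \<le> content (\<Union>n<N. U n) + e"
    using t(2) f(2) e by simp
  also have "\<dots> \<le> (\<Sum>n<N. content (U n)) + e"
    using content_UN_lessThan[OF U] by simp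
  finally have "ennreal (content (\<Union>n. U n)) \<le> ennreal (\<Sum>n<N. content (U n)) + ennreal e"
    using e by (simp add: ennreal_leI sum_nonneg content_nonneg flip: ennreal_plus)
  also have "ennreal (\<Sum>n<N. content (U n)) = (\<Sum>n<N. ennreal (content (U n)))"
    by (simp add: sum_ennreal content_nonneg)
  also have "\<dots> \<le> (\<Sum>n. ennreal (content (U n)))"
    by (intro sum_le_suminf) auto
  finally show "ennreal (content (\<Union>n. U n)) \<le> (\<Sum>n. ennreal (content (U n))) + ennreal e"
    by (simp add: add_right_mono)
qed

section \<open>Caratheodory extension of the content\<close>

lemma outer_mono: "A \<subseteq> B \<Longrightarrow> outer A \<le> outer B"
  unfolding outer_def by (rule INF_superset_mono) auto

lemma outer_open: "open U \<Longrightarrow> outer U = ennreal (content U)"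
  unfolding outer_def
  by (rule antisym) (auto intro!: INF_lower INF_greatest ennreal_leI content_mono)

lemma outer_empty: "outer {} = 0"
  using outer_open[of "{}"] content_empty by simp

lemma outer_measure_space_outer: "outer_measure_space UNIV outer"
  unfolding outer_measure_space_def
proof (intro conjI)
  show "positive UNIV outer"
    by (simp add: positive_def outer_empty)
  show "increasing UNIV outer"
    by (simp add: increasing_def outer_mono)
  show "countably_subadditive UNIV outer"
    unfolding countably_subadditive_def
  proof (intro allI impI)
    fix A :: "nat \<Rightarrow> 'a set"
    show "outer (\<Union>i. A i) \<le> (\<Sum>i. outer (A i))"
    proof (rule ennreal_le_epsilon)
      fix e :: real assume e: "0 < e" and fin: "(\<Sum>i. outer (A i)) < top"
      then have "outer (A n) < outer (A n) + e * (1/2)^Suc n" for n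
        by (auto simp add: less_top dest!: ennreal_suminf_lessD)
      then have "(INF U\<in>{U. open U \<and> A n \<subseteq> U}. ennreal (content U)) < outer (A n) + e * (1/2)^Suc n" for n
        by (simp only: outer_def[symmetric])
      then have "\<exists>U. open U \<and> A n \<subseteq> U \<and> ennreal (content U) < outer (A n) + e * (1/2)^Suc n" for n
        unfolding INF_less_iff by blast
      then obtain U where U: "\<And>n. open (U n)" "\<And>n. A n \<subseteq> U n"
        "\<And>n. ennreal (content (U n)) < outer (A n) + e * (1/2)^Suc n"
        by metis
      have "outer (\<Union>i. A i) \<le> outer (\<Union>i. U i)"
        using U(2) by (intro outer_mono) blast
      also have "\<dots> \<le> (\<Sum>n. ennreal (content (U n)))"
        using content_UN[OF U(1)] outer_open[of "\<Union>i. U i"] U(1) by (simp add: open_UN)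
      also have "\<dots> \<le> (\<Sum>n. outer (A n) + e * (1/2) ^ Suc n)"
        using U(3) by (intro suminf_le) (auto intro: less_imp_le)
      also have "\<dots> = (\<Sum>n. outer (A n)) + (\<Sum>n. ennreal e * ennreal ((1/2) ^ Suc n))"
        using e by (subst suminf_add[symmetric])
          (auto simp del: ennreal_suminf_cmult simp add: ennreal_mult[symmetric])
      also have "\<dots> = (\<Sum>n. outer (A n)) + e"
        unfolding ennreal_suminf_cmult
        by (subst suminf_ennreal_eq[OF zero_le_power power_half_series]) auto
      finally show "outer (\<Union>i. A i) \<le> (\<Sum>i. outer (A i)) + ennreal e" .
    qed
  qed
qed

text \<open>\<open>V - U\<close> need not be open, but it lies in the open set
  \<open>V - ?C\<close>, where \<open>?C\<close> is the closed subset of \<open>V \<inter> U\<close>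
  that carries a nearly optimal function for \<open>V \<inter> U\<close>. A nearly optimal function
  for \<open>V - ?C\<close> vanishes on \<open>?C\<close>, so the sum of both still lies between 0
  and 1.\<close>

lemma content_split:
  assumes U: "open U" and V: "open V"
  shows "outer (V \<inter> U) + outer (V - U) \<le> ennreal (content V)"
proof (rule ennreal_le_epsilon)
  fix e :: real assume e: "0 < e"
  \<comment> \<open>Three errors of \<open>e/3\<close> occur: the choice of \<open>f\<close>, its
    truncation, and the choice of \<open>g\<close>.\<close>
  obtain f where f: "f \<in> below (V \<inter> U)" "content (V \<inter> U) < L f + e/3"
    using content_approx[of "e/3"] e by auto
  have e3: "e/3 > 0" using e by simp
  note t = truncate_below[OF f(1) e3]
  let ?C = "{x. e/3 \<le> f x}" and ?f = "\<lambda>x. max (f x - e/3) 0"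
  have opn: "open (V - ?C)" using V t(3) by (rule open_Diff)
  obtain g where g: "g \<in> below (V - ?C)" "content (V - ?C) < L g + e/3"
    using content_approx[of "e/3"] e by auto
  have sum: "(\<lambda>x. ?f x + g x) \<in> below V"
  proof -
    have "?f x = 0 \<or> g x = 0" for x
      using g(1) by (cases "x \<in> ?C") (auto simp: below_def)
    moreover have "0 \<le> ?f x \<and> ?f x \<le> 1" "0 \<le> g x \<and> g x \<le> 1" for x
      using t(1) g(1) by (auto simp: below_def)
    ultimately have "0 \<le> ?f x + g x \<and> ?f x + g x \<le> 1" for x
      by (metis add_0 add.right_neutral)
    moreover have "?f x + g x = 0" if "x \<notin> V" for x
    proof -
      have "x \<notin> ?C" using t(4) that by blast
      then show ?thesis using t(1) g(1) that by (auto simp: below_def)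
    qed
    moreover have "continuous_on UNIV (\<lambda>x. ?f x + g x)"
      using t(1) g(1) by (auto simp: below_def intro: continuous_on_add)
    ultimately show ?thesis unfolding below_def by blast
  qed
  have "outer (V \<inter> U) + outer (V - U) \<le> outer (V \<inter> U) + outer (V - ?C)"
    using t(4) by (intro add_left_mono outer_mono) blast
  also have "\<dots> = ennreal (content (V \<inter> U) + content (V - ?C))"
    using U V opn by (simp add: outer_open open_Int content_nonneg)
  also have "\<dots> \<le> ennreal (content V + e)"
  proof (rule ennreal_leI)
    have "L ?f + L g = L (\<lambda>x. ?f x + g x)"
      using t(1) g(1) by (intro add[symmetric]) (auto simp: below_def)
    also have "\<dots> \<le> content V" by (rule content_ge[OF sum])
    finally show "content (V \<inter> U) + content (V - ?C) \<le> content V + e"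
      using f(2) g(2) t(2) by simp
  qed
  finally show "outer (V \<inter> U) + outer (V - U) \<le> ennreal (content V) + ennreal e"
    using e content_nonneg by simp
qed

text \<open>As \<open>outer A\<close> is an infimum over open supersets of \<open>A\<close>,
  Caratheodory's criterion has to be tested on open sets only, and there it is
  \<open>content_split\<close>.\<close>

lemma open_lambda_system:
  assumes "open U"
  shows "U \<in> lambda_system UNIV UNIV outer"
proof -
  have "outer (U \<inter> A) + outer (A - U) = outer A" for A
  proof (rule antisym)
    show "outer (U \<inter> A) + outer (A - U) \<le> outer A"
      unfolding outer_def[of A]
    proof (rule INF_greatest)
      fix V assume V: "V \<in> {V. open V \<and> A \<subseteq> V}"
      have "outer (U \<inter> A) + outer (A - U) \<le> outer (V \<inter> U) + outer (V - U)"
        using V by (intro add_mono outer_mono) auto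
      also have "\<dots> \<le> ennreal (content V)"
        using content_split[OF assms] V by blast
      finally show "outer (U \<inter> A) + outer (A - U) \<le> ennreal (content V)" .
    qed
    have "subadditive UNIV outer"
      using outer_measure_space_outer ring_of_sets.countably_subadditive_subadditive[of UNIV UNIV outer]
      unfolding outer_measure_space_def by (simp add: ring_of_sets_iff)
    then have "outer ((U \<inter> A) \<union> (A - U)) \<le> outer (U \<inter> A) + outer (A - U)"
      by (rule subadditiveD) auto
    moreover have "(U \<inter> A) \<union> (A - U) = A" by blast
    ultimately show "outer A \<le> outer (U \<inter> A) + outer (A - U)" by simp
  qed
  then show ?thesis
    by (simp add: lambda_system_def Int_commute Diff_eq)
qed

section \<open>The representing measure and the integral formula\<close>

definition riesz_measure :: "'a measure" where
  "riesz_measure = measure_of UNIV (sets borel) outer"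

lemma sets_riesz [simp]: "sets riesz_measure = sets borel"
  unfolding riesz_measure_def using sets.sets_measure_of_eq[of "borel :: 'a measure"]
  by simp

lemma space_riesz [simp]: "space riesz_measure = UNIV"
  using sets_eq_imp_space_eq[OF sets_riesz] by simp

lemma emeasure_riesz:
  assumes "A \<in> sets borel"
  shows "emeasure riesz_measure A = outer A"
proof -
  have "measure_space UNIV (lambda_system UNIV UNIV outer) outer"
    using sigma_algebra.caratheodory_lemma[OF sigma_algebra_Pow[of UNIV]] outer_measure_space_outer
    by simp
  moreover have "sets (borel :: 'a measure) \<subseteq> lambda_system UNIV UNIV outer"
    using sigma_algebra.sigma_sets_subset[of UNIV "lambda_system UNIV UNIV outer" "Collect open"]
      \<open>measure_space _ _ _\<close> open_lambda_system
    by (auto simp: sets_borel measure_space_def)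
  ultimately have "measure_space UNIV (sets (borel :: 'a measure)) outer"
    using measure_down sets.sigma_algebra_axioms[of borel] by fastforce
  then show ?thesis
    using assms unfolding riesz_measure_def
    by (intro emeasure_measure_of_sigma) (auto simp: measure_space_def)
qed

lemma emeasure_riesz_open: "open U \<Longrightarrow> emeasure riesz_measure U = ennreal (content U)"
  by (simp add: emeasure_riesz outer_open)

lemma prob_space_riesz: "prob_space riesz_measure"
  by (rule prob_spaceI) (simp add: emeasure_riesz_open content_UNIV)

text \<open>Outer regularity is built into \<open>outer\<close>. Inner regularity is outer
  regularity of the complement, since complements of open sets are compact here.\<close>

lemma regular_prob_riesz: "regular_prob riesz_measure"
proof -
  interpret prob_space riesz_measure by (rule prob_space_riesz)
  have out: "emeasure riesz_measure A = (INF U\<in>{U. open U \<and> A \<subseteq> U}. emeasure riesz_measure U)"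
    if "A \<in> sets borel" for A
    unfolding emeasure_riesz[OF that] outer_def
    by (intro INF_cong refl) (simp add: emeasure_riesz_open)
  have inn: "emeasure riesz_measure A =
      (SUP C\<in>{C. compact C \<and> C \<in> sets borel \<and> C \<subseteq> A}. emeasure riesz_measure C)"
    if A: "A \<in> sets borel" for A
  proof (rule antisym)
    show "emeasure riesz_measure A \<le>
      (SUP C\<in>{C. compact C \<and> C \<in> sets borel \<and> C \<subseteq> A}. emeasure riesz_measure C)" (is "_ \<le> ?s")
    proof (rule ennreal_le_epsilon)
      fix e :: real assume e: "0 < e"
      have "emeasure riesz_measure (- A) < emeasure riesz_measure (- A) + e"
        using e emeasure_finite by (simp add: less_top)
      then obtain U where U: "open U" "- A \<subseteq> U" "emeasure riesz_measure U < emeasure riesz_measure (- A) + e"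
      proof -
        have "- A \<in> sets borel" using A by simp
        from out[OF this] have "(INF U\<in>{U. open U \<and> - A \<subseteq> U}. emeasure riesz_measure U)
            < emeasure riesz_measure (- A) + e"
          using \<open>emeasure riesz_measure (- A) < _\<close> by simp
        then show ?thesis using that unfolding INF_less_iff by blast
      qed
      have mU: "measure riesz_measure U < measure riesz_measure (- A) + e"
        using U(3) e unfolding emeasure_eq_measure
        by (simp add: measure_nonneg ennreal_less_iff flip: ennreal_plus)
      have "compact (- U)"
        using U(1) compact_UNIV compact_Int_closed[of UNIV "- U"] by auto
      moreover have "- U \<subseteq> A" "- U \<in> sets borel" using U by auto
      ultimately have "emeasure riesz_measure (- U) \<le> ?s"
        by (intro SUP_upper) auto
      moreover have "measure riesz_measure A \<le> measure riesz_measure (- U) + e"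
        using mU prob_compl[of A] prob_compl[of U] A U(1) by (simp add: Compl_eq_Diff_UNIV)
      then have "emeasure riesz_measure A \<le> emeasure riesz_measure (- U) + e"
        unfolding emeasure_eq_measure using e by (simp add: measure_nonneg ennreal_leI flip: ennreal_plus)
      ultimately show "emeasure riesz_measure A \<le> ?s + ennreal e"
        by (meson add_right_mono order_trans)
    qed
  qed (auto intro!: SUP_least emeasure_mono A)
  show ?thesis
    unfolding regular_prob_def
    by (intro conjI ballI prob_space_riesz sets_riesz inn out)
qed

lemma continuous_integrable_riesz:
  assumes "continuous_on UNIV f"
  shows "integrable riesz_measure (f :: 'a \<Rightarrow> real)"
proof -
  interpret prob_space riesz_measure by (rule prob_space_riesz)
  have "bounded (range f)"
    using compact_continuous_image[OF assms compact_UNIV] compact_imp_bounded by blast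
  then obtain B where "\<And>x. norm (f x) \<le> B" by (auto simp: bounded_iff)
  moreover have "f \<in> borel_measurable riesz_measure"
    using borel_measurable_continuous_onI[OF assms] by (simp cong: measurable_cong_sets)
  ultimately show ?thesis
    by (intro integrable_const_bound[of _ B]) auto
qed

text \<open>Writing \<open>n f\<close> as the sum of the layers \<open>F k = min (max (n f - k) 0) 1\<close>, the bound follows
  from \<open>L (F (k+1)) \<le> content {F (k+1) > 0} \<le> \<integral>F k\<close>.\<close>

lemma riesz_le:
  assumes f: "continuous_on UNIV f" and b: "\<And>x. 0 \<le> f x \<and> f x \<le> 1"
  shows "L f \<le> (\<integral>x. f x \<partial>riesz_measure)"
proof (rule field_le_epsilon)
  interpret prob_space riesz_measure by (rule prob_space_riesz)
  fix e :: real assume e: "0 < e"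
  obtain n :: nat where n: "n > 0" "1 / real n < e"
    using e nat_approx_posE[OF e] by (metis inverse_eq_divide lessI zero_less_Suc)
  define F where "F k x = min (max (real n * f x - real k) 0) 1" for k :: nat and x
  have cF: "continuous_on UNIV (F k)" for k
    unfolding F_def by (intro continuous_intros f)
  have bF: "0 \<le> F k x \<and> F k x \<le> 1" for k x
    by (auto simp: F_def)
  have sumF: "(\<Sum>k<m. F k x) = min (real n * f x) (real m)" for m x
  proof (induction m)
    case 0 then show ?case using b[of x] by simp
  next
    case (Suc m)
    have "F m x = min (max (real n * f x - real m) 0) 1" by (simp add: F_def)
    then show ?case unfolding sum.lessThan_Suc Suc by (simp add: min_def max_def)
  qed
  have F_eq: "(\<Sum>k<n. F k x) = real n * f x" for x
    using sumF[of x n] b[of x] by (simp add: mult_left_le)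
  have L_sum: "L (\<lambda>x. \<Sum>k<m. F k x) = (\<Sum>k<m. L (F k))" for m
  proof (induction m)
    case (Suc m)
    then show ?case
      using add[of "\<lambda>x. \<Sum>k<m. F k x" "F m"] cF by (simp add: continuous_on_sum)
  qed (simp add: const)
  have step: "L (F (Suc k)) \<le> (\<integral>x. F k x \<partial>riesz_measure)" for k
  proof -
    let ?U = "{x. F (Suc k) x > 0}"
    have U: "open ?U" by (intro open_Collect_less continuous_intros cF)
    have "L (F (Suc k)) \<le> content ?U"
      using cF bF by (intro content_ge) (auto simp: below_def order.antisym not_less)
    also have "\<dots> = measure riesz_measure ?U"
      using emeasure_riesz_open[OF U] content_nonneg unfolding emeasure_eq_measure by simp
    also have "\<dots> = (\<integral>x. indicator ?U x \<partial>riesz_measure)"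
      using U by simp
    also have "\<dots> \<le> (\<integral>x. F k x \<partial>riesz_measure)"
    proof (rule integral_mono)
      show "integrable riesz_measure (indicator ?U :: _ \<Rightarrow> real)"
        using U by (simp add: emeasure_eq_measure)
      show "indicator ?U x \<le> F k x" for x
        by (auto simp: indicator_def F_def)
    qed (rule continuous_integrable_riesz[OF cF])
    finally show ?thesis .
  qed
  obtain n' where n': "n = Suc n'" using n(1) gr0_conv_Suc by blast
  have "real n * L f = (\<Sum>k<Suc n'. L (F k))"
    using scale[OF f, of "real n"] L_sum[of n] F_eq n' by simp
  \<comment> \<open>Each layer is bounded by the integral of the preceding one. The layer
    \<open>F 0\<close> has none before it; it contributes at most 1, which is \<open>1 / n\<close>
    after the division by \<open>n\<close>.\<close>
  also have "\<dots> = L (F 0) + (\<Sum>k<n'. L (F (Suc k)))"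
    by (rule sum.lessThan_Suc_shift)
  also have "\<dots> \<le> 1 + (\<Sum>k<n'. (\<integral>x. F k x \<partial>riesz_measure))"
    using mono[OF cF, of "\<lambda>_. 1" 0] bF one by (intro add_mono sum_mono step) auto
  also have "(\<Sum>k<n'. (\<integral>x. F k x \<partial>riesz_measure)) = (\<integral>x. (\<Sum>k<n'. F k x) \<partial>riesz_measure)"
    using continuous_integrable_riesz[OF cF] by simp
  also have "\<dots> \<le> (\<integral>x. real n * f x \<partial>riesz_measure)"
    unfolding sumF
    by (intro integral_mono continuous_integrable_riesz continuous_intros f) auto
  finally have "real n * L f \<le> 1 + real n * (\<integral>x. f x \<partial>riesz_measure)"
    by simp
  then have "L f \<le> 1 / real n + (\<integral>x. f x \<partial>riesz_measure)"
    using n(1) by (simp add: field_simps)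
  then show "L f \<le> (\<integral>x. f x \<partial>riesz_measure) + e"
    using n(2) by linarith
qed

text \<open>The missing inequality is \<open>riesz_le\<close> applied to 1 - f.\<close>

lemma riesz_eq_unit:
  assumes f: "continuous_on UNIV f" and b: "\<And>x. 0 \<le> f x \<and> f x \<le> 1"
  shows "L f = (\<integral>x. f x \<partial>riesz_measure)"
proof (rule antisym[OF riesz_le[OF assms]])
  interpret prob_space riesz_measure by (rule prob_space_riesz)
  have "L (\<lambda>x. 1 - f x) \<le> (\<integral>x. 1 - f x \<partial>riesz_measure)"
    using b by (intro riesz_le continuous_intros f) auto
  then show "(\<integral>x. f x \<partial>riesz_measure) \<le> L f"
    using continuous_integrable_riesz[OF f] diff[of "\<lambda>_. 1" f] f one prob_space by simp
qed

theorem riesz_representation: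
  assumes f: "continuous_on UNIV f"
  shows "L f = (\<integral>x. f x \<partial>riesz_measure)"
proof -
  interpret prob_space riesz_measure by (rule prob_space_riesz)
  have "bounded (range f)"
    using compact_continuous_image[OF f compact_UNIV] compact_imp_bounded by blast
  then obtain B where B: "B > 0" "\<And>x. \<bar>f x\<bar> \<le> B"
    by (auto simp: bounded_pos)
  \<comment> \<open>This affine map carries [-B, B] onto [0, 1].\<close>
  define g where "g x = (1 / (2*B)) * (f x + B)" for x
  have cg: "continuous_on UNIV g" unfolding g_def by (intro continuous_intros f)
  have "0 \<le> g x \<and> g x \<le> 1" for x
    using B(1) B(2)[of x] by (auto simp: g_def field_simps)
  then have "L g = (\<integral>x. g x \<partial>riesz_measure)"
    using riesz_eq_unit cg by blast
  moreover have "L g = (1 / (2*B)) * (L f + B)"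
    using scale[of "\<lambda>x. f x + B" "1/(2*B)"] add[OF f, of "\<lambda>_. B"] f const[of B]
    by (simp add: g_def[abs_def] continuous_on_add)
  moreover have "(\<integral>x. g x \<partial>riesz_measure) = (1 / (2*B)) * ((\<integral>x. f x \<partial>riesz_measure) + B)"
    unfolding g_def using continuous_integrable_riesz[OF f] prob_space by simp
  ultimately show ?thesis using B(1) by simp
qed

end

section \<open>Extreme points of compact sets of functionals\<close>

text \<open>An extreme subset in the sense of Krein and Milman, with convex combinations formed
  coordinate by coordinate. A face with a single element is an extreme point.\<close>

definition face_of_set :: "('b \<Rightarrow> real) set \<Rightarrow> ('b \<Rightarrow> real) set \<Rightarrow> bool" where
  "face_of_set F X \<longleftrightarrow> F \<subseteq> X \<and> closed F \<and> F \<noteq> {} \<and>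
     (\<forall>y\<in>X. \<forall>z\<in>X. \<forall>t. 0 < t \<longrightarrow> t < 1 \<longrightarrow> (\<lambda>j. (1 - t) * y j + t * z j) \<in> F \<longrightarrow> y \<in> F \<and> z \<in> F)"

definition max_coord :: "'b \<Rightarrow> ('b \<Rightarrow> real) set \<Rightarrow> ('b \<Rightarrow> real) set" where
  "max_coord i F = {x \<in> F. \<forall>y\<in>F. y i \<le> x i}"

text \<open>Compactness makes the maximum attained. If a proper convex combination reaches the
  maximum of a coordinate, both of its ends do.\<close>

lemma face_of_set_max_coord:
  assumes X: "compact X" and F: "face_of_set F X"
  shows "face_of_set (max_coord i F) X"
proof -
  have FX: "F \<subseteq> X" and cl: "closed F" and ne: "F \<noteq> {}"
    and ext: "\<And>y z t. \<lbrakk>y \<in> X; z \<in> X; 0 < t; t < 1; (\<lambda>j. (1 - t) * y j + t * z j) \<in> F\<rbrakk> \<Longrightarrow> y \<in> F \<and> z \<in> F"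
    using F unfolding face_of_set_def by blast+
  have cont: "continuous_on A (\<lambda>x. x i)" for A :: "('a \<Rightarrow> real) set"
    by (rule continuous_on_subset[OF continuous_on_product_coordinates]) simp
  have "compact F"
    using compact_Int_closed[OF X cl] FX by (simp add: Int_absorb1)
  then obtain x where x: "x \<in> F" "\<And>y. y \<in> F \<Longrightarrow> y i \<le> x i"
    using continuous_attains_sup[OF _ ne cont] by blast
  have eq: "max_coord i F = F \<inter> {y. x i \<le> y i}"
    using x unfolding max_coord_def by (auto intro: order_trans)
  have "y \<in> max_coord i F \<and> z \<in> max_coord i F"
    if "y \<in> X" "z \<in> X" "0 < t" "t < 1" and m: "(\<lambda>j. (1 - t) * y j + t * z j) \<in> max_coord i F" for y z t
  proof -
    have yz: "y \<in> F" "z \<in> F"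
      using ext that m unfolding eq by auto
    have le: "x i \<le> (1 - t) * y i + t * z i" using m unfolding eq by simp
    have "(1 - t) * (x i - y i) + t * (x i - z i) \<le> 0"
      using le by (simp add: algebra_simps)
    moreover have "0 \<le> (1 - t) * (x i - y i)" "0 \<le> t * (x i - z i)"
      using x(2) yz that by auto
    ultimately have "(1 - t) * (x i - y i) = 0" "t * (x i - z i) = 0"
      by linarith+
    then show ?thesis using that yz unfolding eq by auto
  qed
  moreover have "closed (max_coord i F)"
    unfolding eq by (intro closed_Int cl closed_Collect_le continuous_intros cont)
  moreover have "max_coord i F \<noteq> {}" using x unfolding max_coord_def by auto
  moreover have "max_coord i F \<subseteq> X" using FX unfolding max_coord_def by auto
  ultimately show ?thesis unfolding face_of_set_def by blast
qed

text \<open>A finite nonempty subfamily of a chain has a least member, so the finite intersection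
  property holds and compactness keeps the intersection nonempty.\<close>

lemma face_of_set_Inter_chain:
  assumes X: "compact X" and ne: "\<C> \<noteq> {}" and face: "\<And>F. F \<in> \<C> \<Longrightarrow> face_of_set F X"
    and chain: "\<And>F G. F \<in> \<C> \<Longrightarrow> G \<in> \<C> \<Longrightarrow> F \<subseteq> G \<or> G \<subseteq> F"
  shows "face_of_set (\<Inter>\<C>) X"
proof -
  have "X \<inter> \<Inter>\<C> \<noteq> {}"
  proof (rule compact_imp_fip[OF X])
    show "closed T" if "T \<in> \<C>" for T
      using face[OF that] by (simp add: face_of_set_def)
    fix \<D> assume D: "finite \<D>" "\<D> \<subseteq> \<C>"
    show "X \<inter> \<Inter>\<D> \<noteq> {}"
    proof (cases "\<D> = {}")
      case True
      then show ?thesis using ne face unfolding face_of_set_def by blast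
    next
      case False
      have "\<exists>F\<in>\<D>. \<forall>G\<in>\<D>. F \<subseteq> G"
        using D(1) False D(2)
      proof (induction rule: finite_ne_induct)
        case (insert F \<D>)
        then obtain G where "G \<in> \<D>" "\<forall>G'\<in>\<D>. G \<subseteq> G'" by auto
        have "F \<in> \<C>" "G \<in> \<C>" using insert.prems \<open>G \<in> \<D>\<close> by blast+
        then consider "F \<subseteq> G" | "G \<subseteq> F" using chain by metis
        then show ?case
        proof cases
          case 1
          then have "\<forall>G'\<in>insert F \<D>. F \<subseteq> G'" using \<open>\<forall>G'\<in>\<D>. G \<subseteq> G'\<close> by blast
          then show ?thesis by blast
        next
          case 2
          then show ?thesis using \<open>\<forall>G'\<in>\<D>. G \<subseteq> G'\<close> \<open>G \<in> \<D>\<close> by blast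
        qed
      qed simp
      then obtain F where "F \<in> \<C>" "\<forall>G\<in>\<D>. F \<subseteq> G" using D(2) by auto
      moreover have "F \<subseteq> X" "F \<noteq> {}" using face[OF \<open>F \<in> \<C>\<close>] unfolding face_of_set_def by blast+
      ultimately show ?thesis by blast
    qed
  qed
  moreover have "closed (\<Inter>\<C>)"
    using face by (intro closed_Inter) (auto simp: face_of_set_def)
  moreover have "\<Inter>\<C> \<subseteq> X"
    using ne face unfolding face_of_set_def by (meson Inf_less_eq)
  moreover have "y \<in> \<Inter>\<C> \<and> z \<in> \<Inter>\<C>"
    if "y \<in> X" "z \<in> X" "0 < t" "t < 1" and m: "(\<lambda>j. (1 - t) * y j + t * z j) \<in> \<Inter>\<C>" for y z t
  proof -
    have "y \<in> F \<and> z \<in> F" if "F \<in> \<C>" for F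
      using face[OF that] m that \<open>y \<in> X\<close> \<open>z \<in> X\<close> \<open>0 < t\<close> \<open>t < 1\<close> unfolding face_of_set_def by simp
    then show ?thesis by blast
  qed
  ultimately show ?thesis
    unfolding face_of_set_def by (metis Int_empty_right)
qed

text \<open>A minimal face equals its own \<open>max_coord j\<close> for every coordinate j, so all
  coordinates are constant on it and it is a point. Searching for it inside
  \<open>max_coord i X\<close> makes this point a maximizer of coordinate \<open>i\<close>.\<close>

theorem extreme_maximizer_exists:
  fixes X :: "('b \<Rightarrow> real) set"
  assumes X: "compact X" and cl: "closed X" and ne: "X \<noteq> {}"
  obtains x where "x \<in> X" "\<And>y. y \<in> X \<Longrightarrow> y i \<le> x i"
    "\<And>y z t. \<lbrakk>y \<in> X; z \<in> X; 0 < t; t < 1; x = (\<lambda>j. (1 - t) * y j + t * z j)\<rbrakk> \<Longrightarrow> y = x \<and> z = x"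
proof -
  define G where "G = max_coord i X"
  have "face_of_set X X" using cl ne unfolding face_of_set_def by auto
  then have G: "face_of_set G X" unfolding G_def by (rule face_of_set_max_coord[OF X])
  \<comment> \<open>Reversed inclusion turns the maximal element of Zorn's lemma into a minimal
    face.\<close>
  let ?A = "{F. face_of_set F X \<and> F \<subseteq> G}" and ?P = "\<lambda>F F'. F' \<subseteq> F"
  have "\<exists>m\<in>?A. \<forall>a\<in>?A. a \<subseteq> m \<longrightarrow> a = m"
  proof (rule predicate_Zorn)
    show "partial_order_on ?A (relation_of ?P ?A)"
      by (rule partial_order_on_relation_ofI) auto
    fix C assume C: "C \<in> Chains (relation_of ?P ?A)"
    then have CA: "F \<in> ?A" and chain: "F \<subseteq> F' \<or> F' \<subseteq> F" if "F \<in> C" "F' \<in> C" for F F'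
      using that unfolding Chains_def relation_of_def by blast+
    show "\<exists>u\<in>?A. \<forall>a\<in>C. u \<subseteq> a"
    proof (cases "C = {}")
      case True
      then show ?thesis using G by auto
    next
      case False
      have "face_of_set (\<Inter>C) X"
        by (rule face_of_set_Inter_chain[OF X False]) (use CA chain in auto)
      then show ?thesis using False CA by (intro bexI[of _ "\<Inter>C"]) blast+
    qed
  qed
  then obtain F where F: "face_of_set F X" "F \<subseteq> G"
    and m: "\<forall>F'\<in>?A. F' \<subseteq> F \<longrightarrow> F' = F"
    by auto
  have min: "F' = F" if "face_of_set F' X" "F' \<subseteq> F" for F'
    using m that F(2) by simp
  have single: "y = z" if "y \<in> F" "z \<in> F" for y z
  proof
    fix j
    have "max_coord j F = F"
      by (rule min[OF face_of_set_max_coord[OF X F(1)]]) (auto simp: max_coord_def)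
    then show "y j = z j" using that unfolding max_coord_def by (auto intro: antisym)
  qed
  obtain x where x: "x \<in> F" using F(1) unfolding face_of_set_def by blast
  show thesis
  proof (rule that[of x])
    show "x \<in> X" using x F(1) unfolding face_of_set_def by blast
    show "y i \<le> x i" if "y \<in> X" for y
      using x F(2) that unfolding G_def max_coord_def by blast
    show "y = x \<and> z = x" if yz: "y \<in> X" "z \<in> X" "0 < t" "t < 1" "x = (\<lambda>j. (1 - t) * y j + t * z j)" for y z t
    proof -
      have "(\<lambda>j. (1 - t) * y j + t * z j) \<in> F" using x yz(5) by simp
      then have "y \<in> F \<and> z \<in> F"
        using F(1) yz(1-4) unfolding face_of_set_def by simp
      then show ?thesis using single[OF _ x] by simp
    qed
  qed
qed

section \<open>Weak* compactness of the set of states\<close>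

lemma compact_coordinate_box:
  "compact {x :: 'b \<Rightarrow> real. \<forall>j. \<bar>x j\<bar> \<le> B j}"
proof -
  have "compactin (product_topology (\<lambda>_. euclideanreal) UNIV) (PiE UNIV (\<lambda>j. {- B j..B j}))"
    by (simp add: compactin_PiE)
  moreover have "PiE UNIV (\<lambda>j. {- B j..B j}) = {x. \<forall>j. \<bar>x j\<bar> \<le> B j}"
    by (auto simp: abs_le_iff minus_le_iff)
  ultimately show ?thesis
    by (simp add: euclidean_product_topology)
qed

text \<open>States are defined on all functions.  The value 0 at discontinuous functions keeps \<open>states\<close>
  inside a compact box.\<close>

definition states :: "(('a::t2_space \<Rightarrow> real) \<Rightarrow> real) set" where
  "states = {L. (\<forall>f g. continuous_on UNIV f \<longrightarrow> continuous_on UNIV g \<longrightarrow> L (\<lambda>x. f x + g x) = L f + L g) \<and>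
     (\<forall>c f. continuous_on UNIV f \<longrightarrow> L (\<lambda>x. c * f x) = c * L f) \<and>
     (\<forall>f. continuous_on UNIV f \<longrightarrow> (\<forall>x. 0 \<le> f x) \<longrightarrow> 0 \<le> L f) \<and>
     L (\<lambda>_. 1) = 1 \<and> (\<forall>f. \<not> continuous_on UNIV f \<longrightarrow> L f = 0)}"

lemma compact_state_of_states:
  assumes "compact (UNIV :: 'a::t2_space set)" "L \<in> states"
  shows "compact_state (L :: ('a \<Rightarrow> real) \<Rightarrow> real)"
proof
  show "L (\<lambda>x. f x + g x) = L f + L g" if "continuous_on UNIV f" "continuous_on UNIV g" for f g
    using assms(2) that unfolding states_def mem_Collect_eq by (elim conjE) metis
  show "L (\<lambda>x. c * f x) = c * L f" if "continuous_on UNIV f" for c f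
    using assms(2) that unfolding states_def mem_Collect_eq by (elim conjE) metis
  show "0 \<le> L f" if "continuous_on UNIV f" "\<And>x. 0 \<le> f x" for f
    using assms(2) that unfolding states_def mem_Collect_eq by (elim conjE) metis
  show "L (\<lambda>_. 1) = 1"
    using assms(2) unfolding states_def mem_Collect_eq by (elim conjE)
qed (rule assms(1))

lemma continuous_on_eval: "continuous_on UNIV (\<lambda>L :: 'b \<Rightarrow> real. L f)"
  by (rule continuous_on_product_coordinates)

text \<open>Each defining condition relates finitely many values of \<open>L\<close>, and evaluation
  is continuous in the product topology.\<close>

lemma closed_states: "closed (states :: (('a::t2_space \<Rightarrow> real) \<Rightarrow> real) set)"
  unfolding states_def
  by (intro closed_Collect_conj closed_Collect_all closed_Collect_imp open_Collect_const
      closed_Collect_eq closed_Collect_le continuous_intros continuous_on_eval)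

text \<open>Banach-Alaoglu in coordinates: monotonicity and the value 1 at the constant 1 confine
  \<open>L f\<close> to the bounds of \<open>f\<close>, hence \<open>states\<close> to a
  box.\<close>

lemma compact_states:
  assumes K: "compact (UNIV :: 'a::t2_space set)"
  shows "compact (states :: (('a \<Rightarrow> real) \<Rightarrow> real) set)"
proof -
  have "\<exists>b. continuous_on UNIV f \<longrightarrow> (\<forall>x. \<bar>f x\<bar> \<le> b)" for f :: "'a \<Rightarrow> real"
    using compact_imp_bounded[OF compact_continuous_image[OF _ K, of f]]
    by (auto simp: bounded_iff)
  then obtain b :: "('a \<Rightarrow> real) \<Rightarrow> real" where b: "\<And>f x. continuous_on UNIV f \<Longrightarrow> \<bar>f x\<bar> \<le> b f"
    by metis
  \<comment> \<open>The absolute value around \<open>b f\<close> is for discontinuous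
    \<open>f\<close>, where \<open>b f\<close> is arbitrary and \<open>L f = 0\<close>.\<close>
  have sub: "states \<subseteq> {L. \<forall>f. \<bar>L f\<bar> \<le> \<bar>b f\<bar>}"
  proof (intro subsetI CollectI allI)
    fix L :: "('a \<Rightarrow> real) \<Rightarrow> real" and f :: "'a \<Rightarrow> real" assume L: "L \<in> states"
    interpret compact_state L using compact_state_of_states[OF K L] .
    show "\<bar>L f\<bar> \<le> \<bar>b f\<bar>"
    proof (cases "continuous_on UNIV f")
      case True
      have le: "- b f \<le> f x" "f x \<le> b f" for x using b[OF True, of x] by auto
      show ?thesis
        using mono[OF True continuous_on_const le(2)] mono[OF continuous_on_const True le(1)] const
        by (simp add: abs_le_iff)
    next
      case False
      then show ?thesis using L by (simp add: states_def)
    qed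
  qed
  show ?thesis
    using compact_Int_closed[OF compact_coordinate_box closed_states, of "\<lambda>f. \<bar>b f\<bar>"] sub
    by (simp add: Int_absorb1)
qed

section \<open>Markov operators on continuous functions\<close>

definition emb :: "('a::topological_space \<Rightarrow> real) \<Rightarrow> 'a CK" where
  "emb f = Bcontfun (\<lambda>x. complex_of_real (f x))"

text \<open>For a Markov operator and continuous \<open>f\<close> the discarded imaginary part is 0,
  see \<open>S_emb\<close>.\<close>

definition real_op :: "('a::topological_space) CK_op \<Rightarrow> ('a \<Rightarrow> real) \<Rightarrow> 'a \<Rightarrow> real" where
  "real_op S f x = Re (S (emb f) x)"

lemma apply_Bcontfun_compact:
  fixes f :: "'a::topological_space \<Rightarrow> 'b::real_normed_vector"
  assumes "compact (UNIV :: 'a set)" "continuous_on UNIV f"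
  shows "apply_bcontfun (Bcontfun f) = f"
proof (rule Bcontfun_inverse)
  show "f \<in> bcontfun"
    using compact_imp_bounded[OF compact_continuous_image[OF assms(2,1)]] assms(2)
    unfolding bcontfun_def by blast
qed

lemma emb_apply:
  assumes "compact (UNIV :: 'a::topological_space set)" "continuous_on UNIV f"
  shows "emb f (x :: 'a) = complex_of_real (f x)"
  unfolding emb_def by (subst apply_Bcontfun_compact) (auto intro!: continuous_intros assms)

lemma continuous_on_real_op: "continuous_on A (real_op S f)"
  unfolding real_op_def[abs_def] by (intro continuous_intros continuous_on_apply_bcontfun)

locale markov_operator =
  fixes S :: "('a::t2_space) CK_op"
  assumes compact_UNIV: "compact (UNIV :: 'a set)" and markov: "markov_op S"
begin

lemmas emb_app = emb_apply[OF compact_UNIV]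

lemma S_cscale: "S (cscale c f) = cscale c (S f)"
  using markov by (simp add: markov_op_def clinear_op_def)

lemma S_emb_nonneg:
  assumes "continuous_on UNIV f" "\<And>x. 0 \<le> f x"
  shows "S (emb f) x \<in> \<real>\<^sub>\<ge>\<^sub>0"
proof -
  have "pos_fun (emb f)" using assms by (simp add: pos_fun_def emb_app)
  then show ?thesis using markov by (simp add: markov_op_def pos_fun_def)
qed

text \<open>Positivity yields reality: f is the difference of its positive and negative parts, and
  both have nonnegative images.\<close>

lemma S_emb:
  assumes f: "continuous_on UNIV f"
  shows "S (emb f) x = complex_of_real (real_op S f x)"
proof -
  have c: "continuous_on UNIV (\<lambda>x. max (f x) 0)" "continuous_on UNIV (\<lambda>x. max (- f x) 0)"
    by (intro continuous_intros f)+
  have "emb f = emb (\<lambda>x. max (f x) 0) - emb (\<lambda>x. max (- f x) 0)"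
  proof (rule bcontfun_eqI)
    fix x
    have "f x = max (f x) 0 - max (- f x) 0" by (simp add: max_def)
    then show "emb f x = (emb (\<lambda>x. max (f x) 0) - emb (\<lambda>x. max (- f x) 0)) x"
      by (simp add: emb_app[OF f] emb_app[OF c(1)] emb_app[OF c(2)] del: of_real_diff flip: of_real_diff)
  qed
  then have "S (emb f) x = S (emb (\<lambda>x. max (f x) 0)) x - S (emb (\<lambda>x. max (- f x) 0)) x"
    by (simp add: blinfun.diff_right)
  moreover have "S (emb (\<lambda>x. max (f x) 0)) x \<in> \<real>" "S (emb (\<lambda>x. max (- f x) 0)) x \<in> \<real>"
    using S_emb_nonneg[OF c(1), of x] S_emb_nonneg[OF c(2), of x] nonneg_Reals_subset_Reals by auto
  ultimately have "S (emb f) x \<in> \<real>" by simp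
  then show ?thesis by (simp add: real_op_def)
qed

lemma real_op_nonneg:
  assumes "continuous_on UNIV f" "\<And>x. 0 \<le> f x"
  shows "0 \<le> real_op S f x"
  using S_emb_nonneg[OF assms, of x] unfolding real_op_def complex_nonneg_Reals_iff by simp

lemma real_op_add:
  assumes "continuous_on UNIV f" "continuous_on UNIV g"
  shows "real_op S (\<lambda>x. f x + g x) = (\<lambda>x. real_op S f x + real_op S g x)"
proof -
  have "emb (\<lambda>x. f x + g x) = emb f + emb g"
    by (rule bcontfun_eqI) (simp add: emb_app assms continuous_on_add)
  then show ?thesis by (simp add: real_op_def fun_eq_iff blinfun.add_right)
qed

lemma real_op_scale:
  assumes "continuous_on UNIV f"
  shows "real_op S (\<lambda>x. c * f x) = (\<lambda>x. c * real_op S f x)"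
proof -
  have "continuous_on UNIV (\<lambda>x. c * f x)" by (intro continuous_intros assms)
  then have "emb (\<lambda>x. c * f x) = c *\<^sub>R emb f"
    by (intro bcontfun_eqI) (simp add: emb_app assms scaleR_conv_of_real)
  then show ?thesis by (simp add: real_op_def fun_eq_iff blinfun.scaleR_right)
qed

lemma real_op_one: "real_op S (\<lambda>_. 1) = (\<lambda>_. 1)"
proof -
  have "emb (\<lambda>_ :: 'a. 1) = const_bcontfun 1"
    by (rule bcontfun_eqI) (simp add: emb_app const_bcontfun.rep_eq)
  then show ?thesis
    using markov by (simp add: real_op_def fun_eq_iff markov_op_def const_bcontfun.rep_eq)
qed

lemma real_op_mono:
  assumes "continuous_on UNIV f" "continuous_on UNIV g" "\<And>x. f x \<le> g x"
  shows "real_op S f x \<le> real_op S g x"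
proof -
  have "continuous_on UNIV (\<lambda>x. g x + (- 1) * f x)" "continuous_on UNIV (\<lambda>x. (- 1) * f x)"
    by (intro continuous_intros assms)+
  moreover have "real_op S (\<lambda>x. g x + (- 1) * f x) = (\<lambda>x. real_op S g x + (- 1) * real_op S f x)"
    using real_op_add[OF assms(2)] real_op_scale[OF assms(1)] calculation(2) by metis
  ultimately show ?thesis
    using real_op_nonneg[of "\<lambda>x. g x + (- 1) * f x" x] assms(3) by simp
qed

lemma S_decomp:
  "S g x = complex_of_real (real_op S (\<lambda>x. Re (g x)) x) + \<i> * complex_of_real (real_op S (\<lambda>x. Im (g x)) x)"
proof -
  have c: "continuous_on UNIV (\<lambda>x. Re (g x))" "continuous_on UNIV (\<lambda>x. Im (g x))"
    by (intro continuous_intros continuous_on_apply_bcontfun)+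
  have "g = emb (\<lambda>x. Re (g x)) + cscale \<i> (emb (\<lambda>x. Im (g x)))"
    by (rule bcontfun_eqI) (simp add: emb_app c flip: complex_eq)
  then have "S g x = S (emb (\<lambda>x. Re (g x))) x + \<i> * S (emb (\<lambda>x. Im (g x))) x"
    by (metis blinfun.add_right S_cscale cscale_apply plus_bcontfun.rep_eq)
  then show ?thesis by (simp add: S_emb c)
qed

text \<open>Rotating \<open>g\<close> so that \<open>S g x\<close> becomes real and nonnegative reduces the bound to \<open>Re g \<le> \<bar>g\<bar>\<close>.\<close>

lemma cmod_S_le: "cmod (S g x) \<le> real_op S (\<lambda>x. cmod (g x)) x"
proof -
  \<comment> \<open>If \<open>S g x = 0\<close> then \<open>u = 0\<close>; hence only
    \<open>cmod u <= 1\<close> is claimed, not equality.\<close>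
  define u where "u = cnj (sgn (S g x))"
  have u: "cmod u \<le> 1" by (simp add: u_def norm_sgn)
  have c: "continuous_on UNIV (\<lambda>y. Re (u * g y))" "continuous_on UNIV (\<lambda>y. cmod (g y))"
    by (intro continuous_intros continuous_on_apply_bcontfun)+
  have "cmod (S g x) = Re (u * S g x)"
    unfolding u_def
    by (cases "S g x = 0")
      (auto simp: sgn_div_norm scaleR_conv_of_real cmod_power2 field_simps complex_norm_square[symmetric]
        simp del: of_real_power simp flip: power2_eq_square)
  also have "\<dots> = Re (S (cscale u g) x)" by (simp add: S_cscale)
  also have "\<dots> = real_op S (\<lambda>y. Re (u * g y)) x"
    by (subst S_decomp) simp
  also have "\<dots> \<le> real_op S (\<lambda>x. cmod (g x)) x"
  proof (rule real_op_mono[OF c])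
    fix y
    have "Re (u * g y) \<le> cmod u * cmod (g y)" by (metis complex_Re_le_cmod norm_mult)
    also have "\<dots> \<le> cmod (g y)" using u by (simp add: mult_left_le_one_le)
    finally show "Re (u * g y) \<le> cmod (g y)" .
  qed
  finally show ?thesis .
qed

end

section \<open>Density of continuous functions and completeness\<close>

lemma regular_prob_measurable:
  assumes "regular_prob (M :: 'a::topological_space measure)"
    and "continuous_on UNIV (f :: 'a \<Rightarrow> 'b::topological_space)"
  shows "f \<in> borel_measurable M"
proof -
  have "sets M = sets borel" using assms(1) by (simp add: regular_prob_def)
  then show ?thesis
    using borel_measurable_continuous_onI[OF assms(2)] measurable_cong_sets[OF _ refl] by blast
qed

lemma regular_prob_integrable:
  fixes f :: "'a::topological_space \<Rightarrow> 'b::{banach, second_countable_topology}"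
  assumes K: "compact (UNIV :: 'a set)" and M: "regular_prob M" and f: "continuous_on UNIV f"
  shows "integrable M f"
proof -
  interpret prob_space M using M by (simp add: regular_prob_def)
  obtain B where "\<And>x. norm (f x) \<le> B"
    using compact_imp_bounded[OF compact_continuous_image[OF f K]] by (auto simp: bounded_iff)
  then show ?thesis
    by (intro integrable_const_bound[of _ B] regular_prob_measurable[OF M f]) auto
qed

text \<open>Regularity gives C \<subseteq> A \<subseteq> U with C compact, U open and U - C of
  measure below e. A Urysohn function for C and -U differs from the indicator of A only on U - C,
  and there by at most 1.\<close>

lemma L1_approx_indicator:
  fixes M :: "'a::t2_space measure"
  assumes K: "compact (UNIV :: 'a set)" and M: "regular_prob M" and A: "A \<in> sets M" and e: "e > 0"
  obtains u :: "'a \<Rightarrow> real" where "continuous_on UNIV u" "(\<integral>x. \<bar>indicator A x - u x\<bar> \<partial>M) < e"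
proof -
  interpret prob_space M using M by (simp add: regular_prob_def)
  have setsM: "sets M = sets borel" using M by (simp add: regular_prob_def)
  have in_reg: "emeasure M A = (SUP C\<in>{C. compact C \<and> C \<in> sets borel \<and> C \<subseteq> A}. emeasure M C)"
    and out_reg: "emeasure M A = (INF U\<in>{U. open U \<and> A \<subseteq> U}. emeasure M U)"
    using M A unfolding regular_prob_def by blast+
  have "\<exists>C. compact C \<and> C \<in> sets borel \<and> C \<subseteq> A \<and> measure M A < measure M C + e/2"
  proof (rule ccontr)
    assume "\<not> ?thesis"
    then have "measure M C \<le> measure M A - e/2" if "compact C" "C \<in> sets borel" "C \<subseteq> A" for C
      using that by (metis le_diff_eq not_le)
    then have "emeasure M A \<le> ennreal (measure M A - e/2)"
      unfolding in_reg by (intro SUP_least) (auto simp: emeasure_eq_measure intro!: ennreal_leI)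
    \<comment> \<open>The instance \<open>{}\<close> yields \<open>e/2 <= measure M A\<close>; a
      negative bound would be truncated to 0 by \<open>ennreal\<close>.\<close>
    then show False using e measure_nonneg[of M A]
      \<open>\<And>C. compact C \<Longrightarrow> C \<in> sets borel \<Longrightarrow> C \<subseteq> A \<Longrightarrow> _\<close>[of "{}"]
      by (simp add: emeasure_eq_measure)
  qed
  then obtain C where C: "compact C" "C \<subseteq> A" "measure M A < measure M C + e/2" by blast
  have "\<exists>U. open U \<and> A \<subseteq> U \<and> measure M U < measure M A + e/2"
  proof (rule ccontr)
    assume "\<not> ?thesis"
    then have "measure M A + e/2 \<le> measure M U" if "open U" "A \<subseteq> U" for U
      using that by (metis not_le)
    then have "ennreal (measure M A + e/2) \<le> emeasure M A"
      unfolding out_reg by (intro INF_greatest) (auto simp: emeasure_eq_measure intro!: ennreal_leI)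
    then show False using e
      by (simp add: emeasure_eq_measure)
  qed
  then obtain U where U: "open U" "A \<subseteq> U" "measure M U < measure M A + e/2" by blast
  have "closed C" using C(1) by (rule compact_imp_closed)
  moreover have "closed (- U)" "C \<inter> - U = {}" using U C by auto
  ultimately obtain u :: "'a \<Rightarrow> real" where u: "continuous_on UNIV u" "\<And>x. 0 \<le> u x \<and> u x \<le> 1"
    "\<And>x. x \<in> C \<Longrightarrow> u x = 1" "\<And>x. x \<in> - U \<Longrightarrow> u x = 0"
    using Urysohn_compact_T2[OF K, of C "- U"] by blast
  have [measurable]: "U \<in> sets M" "C \<in> sets M" "A \<in> sets M"
    using U C \<open>closed C\<close> A setsM by auto
  have um: "u \<in> borel_measurable M" by (rule regular_prob_measurable[OF M u(1)])
  have "(\<integral>x. \<bar>indicator A x - u x\<bar> \<partial>M) \<le> (\<integral>x. indicator (U - C) x \<partial>M)"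
  proof (rule integral_mono)
    show "integrable M (\<lambda>x. \<bar>indicator A x - u x\<bar>)"
      using regular_prob_integrable[OF K M u(1)] by (intro integrable_abs Bochner_Integration.integrable_diff) (auto simp: emeasure_eq_measure)
    show "integrable M (indicator (U - C) :: 'a \<Rightarrow> real)" by (simp add: emeasure_eq_measure)
    show "\<bar>indicator A x - u x\<bar> \<le> indicator (U - C) x" for x
      using u(2)[of x] u(3)[of x] u(4)[of x] C(2) U(2) by (auto simp: indicator_def abs_le_iff)
  qed
  also have "\<dots> = measure M (U - C)" by simp
  also have "\<dots> = measure M U - measure M C"
    using C(2) U(2) by (intro finite_measure_Diff) auto
  also have "\<dots> < e" using C(3) U(3) by simp
  finally show thesis using that u(1) by blast
qed

lemma L1_approx_CK:
  fixes M :: "'a::t2_space measure"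
  assumes K: "compact (UNIV :: 'a set)" and M: "regular_prob M" and f: "integrable M f" and e: "e > 0"
  obtains h :: "'a CK" where "(\<integral>x. cmod (f x - h x) \<partial>M) < e"
proof -
  interpret prob_space M using M by (simp add: regular_prob_def)
  have inth: "integrable M (apply_bcontfun h)" for h :: "'a CK"
    by (rule regular_prob_integrable[OF K M continuous_on_apply_bcontfun])
  have "\<forall>e>0. \<exists>h :: 'a CK. (\<integral>x. cmod (f x - h x) \<partial>M) < e"
    using f
  proof (induction rule: integrable_induct)
    case (base A c)
    show ?case
    proof (intro allI impI)
      fix e :: real assume e: "e > 0"
      \<comment> \<open>The summand 1 covers the case \<open>c = 0\<close>.\<close>
      have "e / (cmod c + 1) > 0" using e by (simp add: add_nonneg_pos)
      then obtain u :: "'a \<Rightarrow> real" where u: "continuous_on UNIV u"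
        "(\<integral>x. \<bar>indicator A x - u x\<bar> \<partial>M) < e / (cmod c + 1)"
        using L1_approx_indicator[OF K M base(1)] by metis
      have "cmod (indicator A x *\<^sub>R c - cscale c (emb u) x) = cmod c * \<bar>indicator A x - u x\<bar>" for x
      proof -
        have "indicator A x *\<^sub>R c - cscale c (emb u) x = c * complex_of_real (indicator A x - u x)"
          by (simp add: emb_apply[OF K u(1)] scaleR_conv_of_real algebra_simps)
        then show ?thesis by (simp add: norm_mult del: of_real_diff)
      qed
      then have "(\<integral>x. cmod (indicator A x *\<^sub>R c - cscale c (emb u) x) \<partial>M)
          = cmod c * (\<integral>x. \<bar>indicator A x - u x\<bar> \<partial>M)" by simp
      also have "\<dots> \<le> cmod c * (e / (cmod c + 1))"
        using u(2) by (intro mult_left_mono) auto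
      also have "\<dots> < e"
      proof -
        have "cmod c * e < (cmod c + 1) * e" using e by simp
        then show ?thesis by (simp add: divide_less_eq mult.commute add_nonneg_pos)
      qed
      finally show "\<exists>h :: 'a CK. (\<integral>x. cmod (indicator A x *\<^sub>R c - h x) \<partial>M) < e" by blast
    qed
  next
    case (add f g)
    show ?case
    proof (intro allI impI)
      fix e :: real assume e: "e > 0"
      obtain h k :: "'a CK" where h: "(\<integral>x. cmod (f x - h x) \<partial>M) < e/2"
        and k: "(\<integral>x. cmod (g x - k x) \<partial>M) < e/2"
        using add.IH(1)[rule_format, of "e/2"] add.IH(2)[rule_format, of "e/2"] e by auto
      have "(\<integral>x. cmod (f x + g x - (h + k) x) \<partial>M) \<le> (\<integral>x. cmod (f x - h x) + cmod (g x - k x) \<partial>M)"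
      proof (intro integral_mono integrable_norm Bochner_Integration.integrable_add Bochner_Integration.integrable_diff add inth)
        show "cmod (f x + g x - (h + k) x) \<le> cmod (f x - h x) + cmod (g x - k x)" for x
          using norm_triangle_ineq[of "f x - h x" "g x - k x"] by (simp add: algebra_simps)
      qed
      also have "\<dots> < e"
        using h k add inth by simp
      finally show "\<exists>h :: 'a CK. (\<integral>x. cmod (f x + g x - h x) \<partial>M) < e" by blast
    qed
  next
    case (lim f s)
    show ?case
    proof (intro allI impI)
      fix e :: real assume e: "e > 0"
      have "(\<lambda>i. \<integral>x. cmod (f x - s i x) \<partial>M) \<longlonglongrightarrow> (\<integral>x. 0 \<partial>M)"
      \<comment> \<open>The induction rule provides \<open>cmod (s i x) <= 2 * cmod (f x)\<close>,
        whence the factor 3.\<close>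
      proof (rule integral_dominated_convergence[where w = "\<lambda>x. 3 * cmod (f x)"])
        show "AE x in M. (\<lambda>i. cmod (f x - s i x)) \<longlonglongrightarrow> 0"
        proof (rule AE_I2)
          fix x assume "x \<in> space M"
          then have "(\<lambda>i. f x - s i x) \<longlonglongrightarrow> f x - f x" by (intro tendsto_intros lim)
          then show "(\<lambda>i. cmod (f x - s i x)) \<longlonglongrightarrow> 0" by (simp add: tendsto_norm_zero)
        qed
        show "AE x in M. norm (cmod (f x - s i x)) \<le> 3 * cmod (f x)" for i
        proof (rule AE_I2)
          fix x assume "x \<in> space M"
          then show "norm (cmod (f x - s i x)) \<le> 3 * cmod (f x)"
            using norm_triangle_ineq4[of "f x" "s i x"] lim.hyps(3)[of x i] by simp
        qed
      qed (use lim in auto)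
      then have "(\<lambda>i. \<integral>x. cmod (f x - s i x) \<partial>M) \<longlonglongrightarrow> 0" by simp
      then have "\<forall>\<^sub>F i in sequentially. (\<integral>x. cmod (f x - s i x) \<partial>M) < e/2"
        by (rule order_tendstoD) (use e in simp)
      then obtain i where i: "(\<integral>x. cmod (f x - s i x) \<partial>M) < e/2"
        by (auto simp: eventually_sequentially)
      obtain h :: "'a CK" where h: "(\<integral>x. cmod (s i x - h x) \<partial>M) < e/2"
        using lim.IH[rule_format, of "e/2" i] e by auto
      have "(\<integral>x. cmod (f x - h x) \<partial>M) \<le> (\<integral>x. cmod (f x - s i x) + cmod (s i x - h x) \<partial>M)"
      proof (intro integral_mono integrable_norm Bochner_Integration.integrable_add Bochner_Integration.integrable_diff lim inth)
        show "cmod (f x - h x) \<le> cmod (f x - s i x) + cmod (s i x - h x)" for x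
          using norm_triangle_ineq[of "f x - s i x" "s i x - h x"] by simp
      qed
      also have "\<dots> < e"
        using h i lim inth by simp
      finally show "\<exists>h :: 'a CK. (\<integral>x. cmod (f x - h x) \<partial>M) < e" by blast
    qed
  qed
  then show thesis using e that by blast
qed

text \<open>Riesz-Fischer: a subsequence converges almost everywhere, and Fatou's lemma carries the
  Cauchy estimate over to its limit.\<close>

lemma L1_complete:
  fixes s :: "nat \<Rightarrow> 'a \<Rightarrow> 'b::{banach, second_countable_topology}"
  assumes s: "\<And>n. integrable M (s n)"
    and cauchy: "\<And>e. e > 0 \<Longrightarrow> \<exists>N. \<forall>i\<ge>N. \<forall>j\<ge>N. (\<integral>x. norm (s i x - s j x) \<partial>M) < e"
  obtains g where "integrable M g" "\<And>e. e > 0 \<Longrightarrow> \<exists>N. \<forall>n\<ge>N. (\<integral>x. norm (s n x - g x) \<partial>M) \<le> e"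
proof -
  obtain r where r: "strict_mono r" "AE x in M. Cauchy (\<lambda>i. s (r i) x)"
    using cauchy_L1_AE_cauchy_subseq[OF s cauchy] by blast
  \<comment> \<open>Where the subsequence diverges, \<open>lim\<close> is a default value; this
    concerns a null set only.\<close>
  define g where "g x = lim (\<lambda>i. s (r i) x)" for x
  have sm [measurable]: "s n \<in> borel_measurable M" for n using s by auto
  have gm [measurable]: "g \<in> borel_measurable M"
    unfolding g_def[abs_def] by (rule borel_measurable_lim_metric) simp
  have conv: "AE x in M. (\<lambda>i. s (r i) x) \<longlonglongrightarrow> g x"
    using r(2) by eventually_elim (simp add: g_def Cauchy_convergent_iff convergent_LIMSEQ_iff)
  have key: "integrable M (\<lambda>x. s n x - g x) \<and> (\<integral>x. norm (s n x - g x) \<partial>M) \<le> e"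
    if e: "e > 0" and N: "\<forall>i\<ge>N. \<forall>j\<ge>N. (\<integral>x. norm (s i x - s j x) \<partial>M) < e" and n: "n \<ge> N" for e N n
  proof -
    have "(\<integral>\<^sup>+x. ennreal (norm (s n x - g x)) \<partial>M) = (\<integral>\<^sup>+x. liminf (\<lambda>i. ennreal (norm (s n x - s (r i) x))) \<partial>M)"
    proof (rule nn_integral_cong_AE)
      show "AE x in M. ennreal (norm (s n x - g x)) = liminf (\<lambda>i. ennreal (norm (s n x - s (r i) x)))"
        using conv
      proof eventually_elim
        case (elim x)
        then have "(\<lambda>i. ennreal (norm (s n x - s (r i) x))) \<longlonglongrightarrow> ennreal (norm (s n x - g x))"
          by (intro tendsto_intros)
        then show ?case by (metis lim_imp_Liminf sequentially_bot)
      qed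
    qed
    also have "\<dots> \<le> liminf (\<lambda>i. \<integral>\<^sup>+x. ennreal (norm (s n x - s (r i) x)) \<partial>M)"
      by (rule nn_integral_liminf) simp
    also have "\<dots> \<le> ennreal e"
    proof (rule Liminf_le)
      have "(\<integral>\<^sup>+x. ennreal (norm (s n x - s (r i) x)) \<partial>M) \<le> ennreal e" if "i \<ge> N" for i
      proof -
        have "r i \<ge> N" using seq_suble[OF r(1), of i] that by simp
        then have "(\<integral>x. norm (s n x - s (r i) x) \<partial>M) \<le> e" using N n by (simp add: less_imp_le)
        then show ?thesis
          using s by (subst nn_integral_eq_integral) (auto intro!: ennreal_leI)
      qed
      then show "\<forall>\<^sub>F i in sequentially. (\<integral>\<^sup>+x. ennreal (norm (s n x - s (r i) x)) \<partial>M) \<le> ennreal e"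
        by (auto simp: eventually_sequentially)
    qed simp
    finally have le: "(\<integral>\<^sup>+x. ennreal (norm (s n x - g x)) \<partial>M) \<le> ennreal e" .
    have int: "integrable M (\<lambda>x. s n x - g x)"
      by (rule integrableI_bounded) (use le in \<open>auto intro: le_less_trans\<close>)
    have "ennreal (\<integral>x. norm (s n x - g x) \<partial>M) \<le> ennreal e"
      using le int by (subst (asm) nn_integral_eq_integral) auto
    then show ?thesis using int e by (simp add: ennreal_le_iff)
  qed
  obtain N where "\<forall>i\<ge>N. \<forall>j\<ge>N. (\<integral>x. norm (s i x - s j x) \<partial>M) < 1"
    using cauchy[of 1] by auto
  then have "integrable M (\<lambda>x. s N x - g x)" using key[of 1 N N] by simp
  from Bochner_Integration.integrable_diff[OF s[of N] this] have "integrable M (\<lambda>x. s N x - (s N x - g x))" .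
  then have "integrable M g" by simp
  moreover have "\<exists>N. \<forall>n\<ge>N. (\<integral>x. norm (s n x - g x) \<partial>M) \<le> e" if "e > 0" for e
    using cauchy[OF that] key[OF that] by blast
  ultimately show thesis using that by blast
qed

section \<open>Extension to the space of integrable functions\<close>

text \<open>On functions this is a pseudometric: distance 0 between integrable functions means
  equality almost everywhere. A Bochner integral that does not exist has value 0, so the estimates
  carry integrability premises.\<close>

definition l1dist :: "'a measure \<Rightarrow> ('a \<Rightarrow> 'b::{banach, second_countable_topology}) \<Rightarrow> ('a \<Rightarrow> 'b) \<Rightarrow> real" where
  "l1dist M f g = (\<integral>x. norm (f x - g x) \<partial>M)"

lemma l1dist_commute: "l1dist M f g = l1dist M g f"
  by (simp add: l1dist_def norm_minus_commute)

lemma l1dist_nonneg: "0 \<le> l1dist M f g"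
  by (simp add: l1dist_def)

lemma l1dist_triangle:
  assumes "integrable M f" "integrable M g" "integrable M h"
  shows "l1dist M f h \<le> l1dist M f g + l1dist M g h"
proof -
  have "l1dist M f h \<le> (\<integral>x. norm (f x - g x) + norm (g x - h x) \<partial>M)"
    unfolding l1dist_def
  proof (intro integral_mono integrable_norm Bochner_Integration.integrable_add
      Bochner_Integration.integrable_diff assms)
    show "norm (f x - h x) \<le> norm (f x - g x) + norm (g x - h x)" for x
      using norm_triangle_ineq[of "f x - g x" "g x - h x"] by simp
  qed
  also have "\<dots> = l1dist M f g + l1dist M g h"
    unfolding l1dist_def using assms by simp
  finally show ?thesis .
qed

lemma l1dist_cong_AE:
  assumes "integrable M f" "integrable M f'" "integrable M g" "integrable M g'"
    and "AE x in M. f x = f' x" "AE x in M. g x = g' x"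
  shows "l1dist M f g = l1dist M f' g'"
proof -
  have [measurable]: "f \<in> borel_measurable M" "f' \<in> borel_measurable M"
    "g \<in> borel_measurable M" "g' \<in> borel_measurable M"
    using assms by auto
  have "AE x in M. norm (f x - g x) = norm (f' x - g' x)"
    using assms(5,6) by eventually_elim simp
  then show ?thesis
    unfolding l1dist_def by (intro integral_cong_AE) measurable
qed

lemma AE_eq_of_l1dist:
  assumes f: "integrable M f" and g: "integrable M g" and "\<And>e. e > 0 \<Longrightarrow> l1dist M f g \<le> e"
  shows "AE x in M. f x = g x"
proof -
  have "l1dist M f g \<le> 0"
    by (rule field_le_epsilon) (use assms(3) in simp)
  then have "l1dist M f g = 0"
    using l1dist_nonneg[of M f g] by (rule antisym)
  then have "(\<integral>x. norm (f x - g x) \<partial>M) = 0"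
    unfolding l1dist_def .
  then have "AE x in M. norm (f x - g x) = 0"
    using f g by (subst (asm) integral_nonneg_eq_0_iff_AE) auto
  then show ?thesis by auto
qed

lemma l1dist_add_le:
  assumes "integrable M f" "integrable M g" "integrable M h" "integrable M k"
  shows "l1dist M (\<lambda>x. f x + g x) (\<lambda>x. h x + k x) \<le> l1dist M f h + l1dist M g k"
proof -
  have "l1dist M (\<lambda>x. f x + g x) (\<lambda>x. h x + k x) \<le> (\<integral>x. norm (f x - h x) + norm (g x - k x) \<partial>M)"
    unfolding l1dist_def
  proof (intro integral_mono integrable_norm Bochner_Integration.integrable_add
      Bochner_Integration.integrable_diff assms)
    show "norm (f x + g x - (h x + k x)) \<le> norm (f x - h x) + norm (g x - k x)" for x
      using norm_triangle_ineq[of "f x - h x" "g x - k x"] by (simp add: algebra_simps)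
  qed
  also have "\<dots> = l1dist M f h + l1dist M g k"
    unfolding l1dist_def using assms by simp
  finally show ?thesis .
qed

lemma integral_dist_le_l1dist:
  assumes "integrable M f" "integrable M g"
  shows "norm ((\<integral>x. f x \<partial>M) - (\<integral>x. g x \<partial>M)) \<le> l1dist M f g"
proof -
  have "(\<integral>x. f x \<partial>M) - (\<integral>x. g x \<partial>M) = (\<integral>x. f x - g x \<partial>M)" using assms by simp
  then show ?thesis unfolding l1dist_def by (simp add: integral_norm_bound)
qed

section \<open>The L1 contraction property and the construction of an extension\<close>

locale invariant_markov_operator = markov_operator S for S :: "('a::t2_space) CK_op" +
  fixes M :: "'a measure"
  assumes reg: "regular_prob M" and inv: "\<And>f. pairing (S f) M = pairing f M"
begin

sublocale prob_space M
  using reg by (simp add: regular_prob_def)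

lemmas cont_integrable = regular_prob_integrable[OF compact_UNIV reg]

lemma CK_integrable [simp]: "integrable M (apply_bcontfun h)" for h :: "'a CK"
  by (rule cont_integrable[OF continuous_on_apply_bcontfun])

lemma approx:
  assumes "integrable M f" "e > 0"
  obtains h :: "'a CK" where "l1dist M f (apply_bcontfun h) < e"
  using L1_approx_CK[OF compact_UNIV reg assms] unfolding l1dist_def by blast

lemma integral_real_op:
  assumes f: "continuous_on UNIV f"
  shows "(\<integral>x. real_op S f x \<partial>M) = (\<integral>x. f x \<partial>M)"
proof -
  have "complex_of_real (\<integral>x. real_op S f x \<partial>M) = pairing (S (emb f)) M"
  proof -
    have "apply_bcontfun (S (emb f)) = (\<lambda>x. complex_of_real (real_op S f x))"
      by (rule ext) (rule S_emb[OF f])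
    then show ?thesis unfolding pairing_def by simp
  qed
  also have "\<dots> = complex_of_real (\<integral>x. f x \<partial>M)"
  proof -
    have "apply_bcontfun (emb f) = (\<lambda>x. complex_of_real (f x))"
      by (rule ext) (rule emb_app[OF f])
    then show ?thesis unfolding inv unfolding pairing_def by simp
  qed
  finally show ?thesis by simp
qed

text \<open>Invariance of \<open>M\<close> turns |S h| <= S |h| into a contraction for the L1
  seminorm, which is what lets \<open>S\<close> extend to integrable functions.\<close>

lemma integral_cmod_S: "(\<integral>x. cmod (S h x) \<partial>M) \<le> (\<integral>x. cmod (h x) \<partial>M)"
proof -
  have c: "continuous_on UNIV (\<lambda>x. cmod (h x))" for h :: "'a CK"
    by (intro continuous_intros continuous_on_apply_bcontfun)
  have "(\<integral>x. cmod (S h x) \<partial>M) \<le> (\<integral>x. real_op S (\<lambda>x. cmod (h x)) x \<partial>M)"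
    by (intro integral_mono cont_integrable c continuous_on_real_op cmod_S_le)
  then show ?thesis using integral_real_op[OF c] by simp
qed

lemma l1dist_S: "l1dist M (S h) (S k) \<le> l1dist M h k"
  using integral_cmod_S[of "h - k"] by (simp add: l1dist_def blinfun.diff_right)

text \<open>The inequality for all \<open>h\<close> characterizes the value of the extension at
  \<open>f\<close> up to null sets, and every law of the extension can be derived from it without
  returning to the approximating sequence.\<close>

lemma L1_limit_exists:
  assumes f: "integrable M f"
  shows "\<exists>g. integrable M g \<and> (\<forall>h. l1dist M g (S h) \<le> l1dist M f (apply_bcontfun h))"
proof -
  have "\<forall>n. \<exists>h :: 'a CK. l1dist M f (apply_bcontfun h) < 1 / real (Suc n)"
    using approx[OF f] by (metis of_nat_0_less_iff zero_less_Suc zero_less_divide_1_iff)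
  then obtain H :: "nat \<Rightarrow> 'a CK" where H: "\<And>n. l1dist M f (H n) < 1 / real (Suc n)"
    by metis
  have H': "\<exists>N. \<forall>n\<ge>N. l1dist M f (H n) < e" if e: "e > 0" for e
  proof -
    obtain N where N: "1 / real (Suc N) < e" using nat_approx_posE[OF e] by blast
    have "l1dist M f (H n) < e" if "n \<ge> N" for n
    proof -
      have "1 / real (Suc n) \<le> 1 / real (Suc N)" using that by (simp add: frac_le)
      then show ?thesis using H[of n] N by linarith
    qed
    then show ?thesis by blast
  qed
  have SH: "l1dist M (S (H n)) (S h) \<le> l1dist M f (H n) + l1dist M f h" for n h
    using l1dist_S[of "H n" h] l1dist_triangle[OF CK_integrable[of "H n"] f CK_integrable[of h]]
    by (simp add: l1dist_commute)
  have "\<exists>N. \<forall>i\<ge>N. \<forall>j\<ge>N. (\<integral>x. norm (S (H i) x - S (H j) x) \<partial>M) < e" if "e > 0" for e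
  proof -
    obtain N where N: "\<forall>n\<ge>N. l1dist M f (H n) < e/2" using H'[of "e/2"] \<open>e > 0\<close> by auto
    have "(\<integral>x. norm (S (H i) x - S (H j) x) \<partial>M) < e" if "i \<ge> N" "j \<ge> N" for i j
      using SH[of i "H j"] N[rule_format, OF that(1)] N[rule_format, OF that(2)]
      unfolding l1dist_def[of M "apply_bcontfun (S (H i))"] by simp
    then show ?thesis by blast
  qed
  from L1_complete[OF CK_integrable this]
  obtain g where g: "integrable M g"
    and lim: "\<And>e. e > 0 \<Longrightarrow> \<exists>N. \<forall>n\<ge>N. (\<integral>x. norm (S (H n) x - g x) \<partial>M) \<le> e"
    by blast
  have "l1dist M g (S h) \<le> l1dist M f h" for h
  proof (rule field_le_epsilon)
    fix e :: real assume e: "e > 0"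
    obtain N1 where N1: "\<forall>n\<ge>N1. l1dist M f (H n) < e/2" using H'[of "e/2"] e by auto
    obtain N2 where N2: "\<forall>n\<ge>N2. l1dist M (S (H n)) g \<le> e/2"
      using lim[of "e/2"] e unfolding l1dist_def by auto
    define n where "n = max N1 N2"
    have "l1dist M g (S h) \<le> l1dist M g (S (H n)) + l1dist M (S (H n)) (S h)"
      by (intro l1dist_triangle g CK_integrable)
    also have "\<dots> \<le> e/2 + (e/2 + l1dist M f h)"
      using N1[rule_format, of n] N2[rule_format, of n] SH[of n h]
      by (simp add: n_def l1dist_commute)
    finally show "l1dist M g (S h) \<le> l1dist M f h + e" by simp
  qed
  then show ?thesis using g by blast
qed

text \<open>\<open>T\<close> is chosen separately for each function, so at first it is neither
  linear nor compatible with equality almost everywhere. Each law follows because both of its sides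
  are arbitrarily close to the same continuous function in the range of \<open>S\<close>.\<close>

lemma L1_extension_exists: "\<exists>T. L1_extension M S T"
proof -
  obtain T where T: "\<And>f. integrable M f \<Longrightarrow> integrable M (T f)"
    and near: "\<And>f h. integrable M f \<Longrightarrow> l1dist M (T f) (S h) \<le> l1dist M f (apply_bcontfun h)"
    using L1_limit_exists by metis
  have cong: "AE x in M. T f x = T g x"
    if f: "integrable M f" and g: "integrable M g" and eq: "AE x in M. f x = g x" for f g
  proof (rule AE_eq_of_l1dist[OF T[OF f] T[OF g]])
    fix e :: real assume "e > 0"
    then obtain h :: "'a CK" where h: "l1dist M f h < e/2" using approx[OF f, of "e/2"] by auto
    have gh: "l1dist M g h = l1dist M f h"
      using f g eq by (intro l1dist_cong_AE) auto
    have "l1dist M (T f) (T g) \<le> l1dist M (T f) (S h) + l1dist M (S h) (T g)"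
      by (intro l1dist_triangle T f g CK_integrable)
    then show "l1dist M (T f) (T g) \<le> e"
      using near[OF f, of h] near[OF g, of h] gh h by (simp add: l1dist_commute)
  qed
  have add: "AE x in M. T (\<lambda>y. f y + g y) x = T f x + T g x"
    if f: "integrable M f" and g: "integrable M g" for f g
  proof -
    have fg: "integrable M (\<lambda>y. f y + g y)" using f g by simp
    show ?thesis
    proof (rule AE_eq_of_l1dist[OF T[OF fg] Bochner_Integration.integrable_add[OF T[OF f] T[OF g]]])
      fix e :: real assume e: "e > 0"
      \<comment> \<open>The errors for \<open>f\<close> and \<open>g\<close> each enter twice, once
        on either side of the identity.\<close>
      obtain h :: "'a CK" where h: "l1dist M f h < e/4" using approx[OF f, of "e/4"] e by auto
      obtain k :: "'a CK" where k: "l1dist M g k < e/4" using approx[OF g, of "e/4"] e by auto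
      have "l1dist M (T (\<lambda>y. f y + g y)) (\<lambda>x. T f x + T g x)
          \<le> l1dist M (T (\<lambda>y. f y + g y)) (S (h + k)) + l1dist M (S (h + k)) (\<lambda>x. T f x + T g x)"
        by (intro l1dist_triangle T fg Bochner_Integration.integrable_add f g CK_integrable)
      also have "\<dots> \<le> l1dist M (\<lambda>y. f y + g y) (h + k) + (l1dist M (S h) (T f) + l1dist M (S k) (T g))"
        using l1dist_add_le[OF CK_integrable CK_integrable T[OF f] T[OF g], of "S h" "S k"]
        by (intro add_mono near[OF fg]) (simp add: blinfun.add_right[of S h k] plus_bcontfun.rep_eq[abs_def])
      also have "\<dots> \<le> (l1dist M f h + l1dist M g k) + (l1dist M f h + l1dist M g k)"
        using l1dist_add_le[OF f g CK_integrable CK_integrable, of h k] near[OF f, of h] near[OF g, of k]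
        by (simp add: plus_bcontfun.rep_eq[abs_def] l1dist_commute)
      finally show "l1dist M (T (\<lambda>y. f y + g y)) (\<lambda>x. T f x + T g x) \<le> e" using h k by simp
    qed
  qed
  have scale: "AE x in M. T (\<lambda>y. c * f y) x = c * T f x" if f: "integrable M f" for c f
  proof -
    have cf: "integrable M (\<lambda>y. c * f y)" using f by simp
    have sc: "l1dist M (\<lambda>x. c * p x) (\<lambda>x. c * q x) = cmod c * l1dist M p q" for p q :: "'a \<Rightarrow> complex"
      unfolding l1dist_def right_diff_distrib[symmetric] norm_mult by simp
    show ?thesis
    proof (rule AE_eq_of_l1dist[OF T[OF cf] integrable_mult_right[OF T[OF f]]])
      fix e :: real assume e: "e > 0"
      \<comment> \<open>The total error is \<open>2 * cmod c\<close> times the distance of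
        \<open>f\<close> from \<open>h\<close>; the summand 1 covers \<open>c = 0\<close>.\<close>
      have pos: "2 * cmod c + 1 > 0" by (simp add: add_nonneg_pos)
      then have "e / (2 * cmod c + 1) > 0" using e by simp
      then obtain h :: "'a CK" where h: "l1dist M f h < e / (2 * cmod c + 1)" using approx[OF f] by blast
      have cs: "apply_bcontfun (cscale c p) = (\<lambda>x. c * p x)" for p :: "'a CK" by (simp add: fun_eq_iff)
      have "l1dist M (T (\<lambda>y. c * f y)) (\<lambda>x. c * T f x)
          \<le> l1dist M (T (\<lambda>y. c * f y)) (S (cscale c h)) + l1dist M (S (cscale c h)) (\<lambda>x. c * T f x)"
        by (intro l1dist_triangle T cf integrable_mult_right f CK_integrable)
      also have "\<dots> \<le> cmod c * l1dist M f h + cmod c * l1dist M f h"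
        using near[OF cf, of "cscale c h"] near[OF f, of h]
        by (intro add_mono) (simp_all add: S_cscale cs sc l1dist_commute mult_left_mono)
      also have "\<dots> \<le> (2 * cmod c + 1) * l1dist M f h"
        using l1dist_nonneg[of M f h] by (simp add: algebra_simps)
      also have "\<dots> \<le> (2 * cmod c + 1) * (e / (2 * cmod c + 1))"
        using h pos by (intro mult_left_mono) auto
      also have "\<dots> = e" using pos by simp
      finally show "l1dist M (T (\<lambda>y. c * f y)) (\<lambda>x. c * T f x) \<le> e" .
    qed
  qed
  have ext: "AE x in M. T h x = S h x" for h :: "'a CK"
  proof (rule AE_eq_of_l1dist[OF T[OF CK_integrable] CK_integrable])
    fix e :: real assume "e > 0"
    then show "l1dist M (T h) (S h) \<le> e"
      using near[OF CK_integrable, of h h] by (simp add: l1dist_def)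
  qed
  have bound: "(\<integral>x. cmod (T f x) \<partial>M) \<le> 1 * (\<integral>x. cmod (f x) \<partial>M)" if f: "integrable M f" for f
    using near[OF f, of 0] by (simp add: l1dist_def blinfun.zero_right)
  show ?thesis
    unfolding L1_extension_def
    by (intro exI[of _ T] conjI allI impI exI[of _ 1] T cong add scale ext bound) assumption+
qed

section \<open>Properties of the operator chosen by \<open>L1_op\<close>\<close>

abbreviation "S_L1 \<equiv> L1_op M S"

text \<open>\<open>L1_op\<close> is a \<open>SOME\<close> choice and need not be the operator just
  constructed. Positivity and preservation of the integral therefore have to be derived from the
  clauses of \<open>L1_extension\<close>, by density of \<open>C(K)\<close>.\<close>

lemma L1_op_extension: "L1_extension M S S_L1"
  unfolding L1_op_def using L1_extension_exists by (rule someI_ex)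

lemma S_L1_int: "integrable M f \<Longrightarrow> integrable M (S_L1 f)"
  by (rule L1_op_extension[unfolded L1_extension_def, THEN conjunct1, rule_format])

lemma S_L1_cong: "integrable M f \<Longrightarrow> integrable M g \<Longrightarrow> (AE x in M. f x = g x) \<Longrightarrow> (AE x in M. S_L1 f x = S_L1 g x)"
  by (rule L1_op_extension[unfolded L1_extension_def, THEN conjunct2, THEN conjunct1, rule_format])

lemma S_L1_add: "integrable M f \<Longrightarrow> integrable M g \<Longrightarrow> (AE x in M. S_L1 (\<lambda>y. f y + g y) x = S_L1 f x + S_L1 g x)"
  by (rule L1_op_extension[unfolded L1_extension_def, THEN conjunct2, THEN conjunct2, THEN conjunct1, rule_format])

lemma S_L1_scale: "integrable M f \<Longrightarrow> (AE x in M. S_L1 (\<lambda>y. c * f y) x = c * S_L1 f x)"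
  by (rule L1_op_extension[unfolded L1_extension_def, THEN conjunct2, THEN conjunct2, THEN conjunct2, THEN conjunct1, rule_format])

lemma S_L1_CK: "AE x in M. S_L1 (apply_bcontfun h) x = S h x"
  by (rule L1_op_extension[unfolded L1_extension_def, THEN conjunct2, THEN conjunct2, THEN conjunct2, THEN conjunct2, THEN conjunct2, rule_format])

text \<open>Additivity and boundedness applied to f = (f - h) + h. This is the form in which the
  density arguments below use the unspecified bound of the extension.\<close>

lemma S_L1_near:
  "\<exists>C>0. \<forall>f h. integrable M f \<longrightarrow> l1dist M (S_L1 f) (S h) \<le> C * l1dist M f (apply_bcontfun h)"
proof -
  obtain C where C: "\<And>f. integrable M f \<Longrightarrow> (\<integral>x. cmod (S_L1 f x) \<partial>M) \<le> C * (\<integral>x. cmod (f x) \<partial>M)"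
    using L1_op_extension[unfolded L1_extension_def, THEN conjunct2, THEN conjunct2, THEN conjunct2, THEN conjunct2, THEN conjunct1] by blast
  \<comment> \<open>\<open>C\<close> itself might be 0 or negative; the factor is made positive so
    that later estimates may divide by it.\<close>
  have "l1dist M (S_L1 f) (S h) \<le> (\<bar>C\<bar> + 1) * l1dist M f (apply_bcontfun h)" if f: "integrable M f" for f h
  proof -
    have d: "integrable M (\<lambda>x. f x - h x)" using f by simp
    have "AE x in M. S_L1 (\<lambda>y. f y - h y + h y) x = S_L1 (\<lambda>y. f y - h y) x + S_L1 h x"
      by (rule S_L1_add[OF d CK_integrable])
    then have "AE x in M. S_L1 f x - S h x = S_L1 (\<lambda>y. f y - h y) x"
      using S_L1_CK[of h] by eventually_elim simp
    then have "AE x in M. cmod (S_L1 f x - S h x) = cmod (S_L1 (\<lambda>y. f y - h y) x)"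
      by eventually_elim simp
    then have "l1dist M (S_L1 f) (S h) = (\<integral>x. cmod (S_L1 (\<lambda>y. f y - h y) x) \<partial>M)"
      unfolding l1dist_def
      by (intro integral_cong_AE borel_measurable_integrable integrable_norm
          Bochner_Integration.integrable_diff S_L1_int f d CK_integrable)
    also have "\<dots> \<le> C * l1dist M f h"
      using C[OF d] by (simp add: l1dist_def)
    also have "\<dots> \<le> (\<bar>C\<bar> + 1) * l1dist M f h"
      by (intro mult_right_mono l1dist_nonneg) auto
    finally show ?thesis .
  qed
  then show ?thesis by (intro exI[of _ "\<bar>C\<bar> + 1"] conjI allI impI) auto
qed

lemma S_L1_integral:
  assumes f: "integrable M f"
  shows "(\<integral>x. S_L1 f x \<partial>M) = (\<integral>x. f x \<partial>M)"
proof -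
  obtain C where C: "C > 0"
    "\<forall>f h. integrable M f \<longrightarrow> l1dist M (S_L1 f) (S h) \<le> C * l1dist M f (apply_bcontfun h)"
    using S_L1_near by (elim exE conjE) (rule that)
  have "cmod ((\<integral>x. S_L1 f x \<partial>M) - (\<integral>x. f x \<partial>M)) \<le> 0"
  proof (rule field_le_epsilon)
    fix e :: real assume e: "e > 0"
    \<comment> \<open>\<open>C\<close> accounts for the distance of \<open>S_L1 f\<close> from
      \<open>S h\<close>, and 1 for that of \<open>h\<close> from \<open>f\<close>.\<close>
    have "e / (C + 1) > 0" using e C by simp
    then obtain h :: "'a CK" where h: "l1dist M f h < e / (C + 1)" using approx[OF f] by blast
    have "(\<integral>x. S h x \<partial>M) = (\<integral>x. h x \<partial>M)" using inv[of h] by (simp add: pairing_def)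
    then have "cmod ((\<integral>x. S_L1 f x \<partial>M) - (\<integral>x. f x \<partial>M))
        \<le> cmod ((\<integral>x. S_L1 f x \<partial>M) - (\<integral>x. S h x \<partial>M)) + cmod ((\<integral>x. h x \<partial>M) - (\<integral>x. f x \<partial>M))"
      using norm_triangle_ineq[of "(\<integral>x. S_L1 f x \<partial>M) - (\<integral>x. S h x \<partial>M)" "(\<integral>x. h x \<partial>M) - (\<integral>x. f x \<partial>M)"]
      by simp
    also have "\<dots> \<le> l1dist M (S_L1 f) (S h) + l1dist M h f"
      by (intro add_mono integral_dist_le_l1dist S_L1_int f CK_integrable)
    also have "\<dots> \<le> (C + 1) * l1dist M f h"
      using C(2)[rule_format, OF f, of h] by (simp add: algebra_simps l1dist_commute)
    also have "\<dots> \<le> (C + 1) * (e / (C + 1))" using h C(1) by (intro mult_left_mono) auto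
    finally show "cmod ((\<integral>x. S_L1 f x \<partial>M) - (\<integral>x. f x \<partial>M)) \<le> 0 + e" using C(1) by simp
  qed
  then show ?thesis by simp
qed

text \<open>Nonnegativity of a complex number z is written z = |z|. Since f is nonnegative, |h|
  approximates it at least as well as h, the image S |h| is nonnegative, and z = |z| passes to the
  limit because the modulus is 1-Lipschitz.\<close>

lemma S_L1_nonneg:
  fixes f :: "'a \<Rightarrow> real"
  assumes f: "integrable M f" and pos: "\<And>x. 0 \<le> f x"
  shows "AE x in M. S_L1 (\<lambda>y. complex_of_real (f y)) x = complex_of_real (cmod (S_L1 (\<lambda>y. complex_of_real (f y)) x))"
proof -
  obtain C where C: "C > 0"
    "\<forall>f h. integrable M f \<longrightarrow> l1dist M (S_L1 f) (S h) \<le> C * l1dist M f (apply_bcontfun h)"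
    using S_L1_near by (elim exE conjE) (rule that)
  define F where "F y = complex_of_real (f y)" for y
  have F: "integrable M F" unfolding F_def[abs_def] using f by simp
  have "AE x in M. S_L1 F x = complex_of_real (cmod (S_L1 F x))"
  proof (rule AE_eq_of_l1dist[OF S_L1_int[OF F]])
    show "integrable M (\<lambda>x. complex_of_real (cmod (S_L1 F x)))" using S_L1_int[OF F] by simp
    fix e :: real assume e: "e > 0"
    have "e / (2 * C) > 0" using e C by simp
    then obtain h :: "'a CK" where h: "l1dist M F h < e / (2 * C)" using approx[OF F] by blast
    have c: "continuous_on UNIV (\<lambda>x. cmod (h x))"
      by (intro continuous_intros continuous_on_apply_bcontfun)
    define k where "k = emb (\<lambda>x. cmod (h x))"
    have "l1dist M F k \<le> l1dist M F h"
      unfolding l1dist_def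
    proof (intro integral_mono integrable_norm Bochner_Integration.integrable_diff F CK_integrable)
      fix x
      have "cmod (F x - k x) = \<bar>cmod (F x) - cmod (h x)\<bar>"
        using pos[of x] by (simp add: F_def k_def emb_app[OF c] flip: of_real_diff)
      then show "cmod (F x - k x) \<le> cmod (F x - h x)" by (simp add: norm_triangle_ineq3)
    qed
    then have k: "l1dist M (S_L1 F) (S k) \<le> C * l1dist M F h"
      using order_trans[OF C(2)[rule_format, OF F, of k] mult_left_mono[OF _ less_imp_le[OF C(1)]]] by simp
    have Sk: "S k x = complex_of_real (cmod (S k x))" for x
    proof -
      have "S k x \<in> \<real>\<^sub>\<ge>\<^sub>0" unfolding k_def by (rule S_emb_nonneg[OF c]) simp
      then show ?thesis by (simp add: complex_nonneg_Reals_iff complex_eq_iff cmod_def)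
    qed
    have "l1dist M (S_L1 F) (\<lambda>x. complex_of_real (cmod (S_L1 F x)))
        \<le> l1dist M (S_L1 F) (S k) + l1dist M (S k) (\<lambda>x. complex_of_real (cmod (S_L1 F x)))"
      using S_L1_int[OF F] by (intro l1dist_triangle CK_integrable) auto
    also have "l1dist M (S k) (\<lambda>x. complex_of_real (cmod (S_L1 F x))) \<le> l1dist M (S k) (S_L1 F)"
      unfolding l1dist_def
    proof (intro integral_mono integrable_norm Bochner_Integration.integrable_diff CK_integrable S_L1_int F)
      show "integrable M (\<lambda>x. complex_of_real (cmod (S_L1 F x)))" using S_L1_int[OF F] by simp
      fix x
      have "cmod (complex_of_real (cmod (S k x)) - complex_of_real (cmod (S_L1 F x))) = \<bar>cmod (S k x) - cmod (S_L1 F x)\<bar>"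
        unfolding of_real_diff[symmetric] norm_of_real ..
      then show "cmod (S k x - complex_of_real (cmod (S_L1 F x))) \<le> cmod (S k x - S_L1 F x)"
        unfolding Sk[symmetric] by (simp add: norm_triangle_ineq3)
    qed
    also have "l1dist M (S_L1 F) (S k) + l1dist M (S k) (S_L1 F) \<le> (2 * C) * l1dist M F h"
      using k by (simp add: l1dist_commute)
    also have "\<dots> \<le> (2 * C) * (e / (2 * C))" using h C(1) by (intro mult_left_mono) auto
    finally show "l1dist M (S_L1 F) (\<lambda>x. complex_of_real (cmod (S_L1 F x))) \<le> e" using C(1) by simp
  qed
  then show ?thesis unfolding F_def[abs_def] .
qed

end

section \<open>Invariant sets of Markov operators on real integrable functions\<close>

context prob_space
begin

text \<open>This upgrades an inequality f <= R f to equality when \<open>R\<close> preserves the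
  integral.\<close>

lemma AE_eq_of_le_integral:
  assumes f: "integrable M f" and g: "integrable M (g :: 'a \<Rightarrow> real)"
    and le: "AE x in M. f x \<le> g x" and eq: "(\<integral>x. f x \<partial>M) = (\<integral>x. g x \<partial>M)"
  shows "AE x in M. g x = f x"
proof -
  have "(\<integral>x. g x - f x \<partial>M) = 0" using f g eq by simp
  moreover have "AE x in M. 0 \<le> g x - f x" using le by eventually_elim simp
  ultimately have "AE x in M. g x - f x = 0"
    using f g by (subst (asm) integral_nonneg_eq_0_iff_AE) auto
  then show ?thesis by eventually_elim simp
qed

text \<open>It is enough to look at the level of the mean: f cannot exceed its mean almost
  everywhere, and if it stays below its mean almost everywhere, equality of the integrals forces f
  to be equal to it.\<close>

lemma AE_const_of_trivial:
  fixes f :: "'a \<Rightarrow> real"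
  assumes f: "integrable M f" and triv: "measure M {x \<in> space M. (\<integral>x. f x \<partial>M) < f x} \<in> {0, 1}"
  shows "AE x in M. f x = (\<integral>x. f x \<partial>M)"
proof -
  define m where "m = (\<integral>x. f x \<partial>M)"
  have [measurable]: "f \<in> borel_measurable M" using f by simp
  have int_m: "(\<integral>x. m \<partial>M) = m" by (simp add: prob_space)
  have im: "integrable M (\<lambda>_. m)" by simp
  have S: "{x \<in> space M. m < f x} \<in> sets M" by measurable
  have not1: "measure M {x \<in> space M. m < f x} \<noteq> 1"
  proof
    assume "measure M {x \<in> space M. m < f x} = 1"
    then have lt: "AE x in M. m < f x"
      using prob_Collect_eq_1[OF S] by simp
    then have "AE x in M. m \<le> f x" by eventually_elim simp
    from AE_eq_of_le_integral[OF im f this] have "AE x in M. f x = m"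
      using int_m unfolding m_def by simp
    with lt have "AE x in M. False" by eventually_elim simp
    then show False by simp
  qed
  then have "measure M {x \<in> space M. m < f x} = 0" using triv m_def by auto
  then have "AE x in M. \<not> m < f x"
    using prob_Collect_eq_0[OF S] by simp
  then have "AE x in M. f x \<le> m" by eventually_elim simp
  from AE_eq_of_le_integral[OF f im this] have "AE x in M. m = f x"
    using int_m unfolding m_def by simp
  then have "AE x in M. f x = m" by eventually_elim simp
  then show ?thesis unfolding m_def .
qed

end

text \<open>The order argument is isolated here for real functions. The laws hold almost everywhere
  only, since \<open>R\<close> acts on representatives of L1 classes.\<close>

locale markov_L1 = prob_space M for M :: "'a measure" +
  fixes R :: "('a \<Rightarrow> real) \<Rightarrow> 'a \<Rightarrow> real"
  assumes R_int: "integrable M f \<Longrightarrow> integrable M (R f)"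
    and R_cong: "integrable M f \<Longrightarrow> integrable M g \<Longrightarrow> AE x in M. f x = g x \<Longrightarrow> AE x in M. R f x = R g x"
    and R_add: "integrable M f \<Longrightarrow> integrable M g \<Longrightarrow> AE x in M. R (\<lambda>y. f y + g y) x = R f x + R g x"
    and R_scale: "integrable M f \<Longrightarrow> AE x in M. R (\<lambda>y. c * f y) x = c * R f x"
    and R_nonneg: "integrable M f \<Longrightarrow> (\<And>x. 0 \<le> f x) \<Longrightarrow> AE x in M. 0 \<le> R f x"
    and R_integral: "integrable M f \<Longrightarrow> (\<integral>x. R f x \<partial>M) = (\<integral>x. f x \<partial>M)"
    and R_one: "AE x in M. R (\<lambda>_. 1) x = 1"
begin

definition fixed :: "('a \<Rightarrow> real) \<Rightarrow> bool" where
  "fixed f \<longleftrightarrow> integrable M f \<and> (AE x in M. R f x = f x)"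

lemma R_diff:
  assumes "integrable M f" "integrable M g"
  shows "AE x in M. R (\<lambda>y. f y - g y) x = R f x - R g x"
proof -
  have "integrable M (\<lambda>y. (- 1) * g y)" using assms(2) by simp
  from R_add[OF assms(1) this] R_scale[OF assms(2), of "- 1"] show ?thesis
    by eventually_elim simp
qed

lemma R_mono:
  assumes "integrable M f" "integrable M g" "\<And>x. f x \<le> g x"
  shows "AE x in M. R f x \<le> R g x"
proof -
  have "AE x in M. 0 \<le> R (\<lambda>y. g y - f y) x"
    using assms by (intro R_nonneg) auto
  with R_diff[OF assms(2,1)] show ?thesis by eventually_elim simp
qed

lemma fixed_int: "fixed f \<Longrightarrow> integrable M f"
  by (simp add: fixed_def)

lemma fixed_AE: "fixed f \<Longrightarrow> AE x in M. R f x = f x"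
  by (simp add: fixed_def)

lemma fixed_add:
  assumes "fixed f" "fixed g" shows "fixed (\<lambda>x. f x + g x)"
proof -
  have "AE x in M. R (\<lambda>x. f x + g x) x = f x + g x"
    using R_add[OF assms[THEN fixed_int]] fixed_AE[OF assms(1)] fixed_AE[OF assms(2)]
    by eventually_elim simp
  then show ?thesis
    using assms[THEN fixed_int] by (simp add: fixed_def)
qed

lemma fixed_scale:
  assumes "fixed f" shows "fixed (\<lambda>x. c * f x)"
proof -
  have "AE x in M. R (\<lambda>x. c * f x) x = c * f x"
    using R_scale[OF fixed_int[OF assms], of c] fixed_AE[OF assms] by eventually_elim simp
  then show ?thesis using fixed_int[OF assms] by (simp add: fixed_def)
qed

lemma fixed_const: "fixed (\<lambda>_. c)"
proof -
  have "fixed (\<lambda>_. 1)" using R_one by (simp add: fixed_def)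
  from fixed_scale[OF this, of c] show ?thesis by simp
qed

text \<open>Positivity gives |f| = |R f| <= R |f| almost everywhere, and both ends have the same
  integral.\<close>

lemma fixed_abs:
  assumes f: "fixed f"
  shows "fixed (\<lambda>x. \<bar>f x\<bar>)"
proof -
  have fi: "integrable M f" and fe: "AE x in M. R f x = f x" using f by (auto simp: fixed_def)
  have ai: "integrable M (\<lambda>x. \<bar>f x\<bar>)" and ni: "integrable M (\<lambda>x. (- 1) * f x)" using fi by auto
  have "AE x in M. R f x \<le> R (\<lambda>x. \<bar>f x\<bar>) x"
    by (rule R_mono[OF fi ai]) simp
  moreover have "AE x in M. R (\<lambda>x. (- 1) * f x) x \<le> R (\<lambda>x. \<bar>f x\<bar>) x"
    by (rule R_mono[OF ni ai]) simp
  ultimately have "AE x in M. \<bar>f x\<bar> \<le> R (\<lambda>x. \<bar>f x\<bar>) x"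
    using fe R_scale[OF fi, of "- 1"] by eventually_elim auto
  from AE_eq_of_le_integral[OF ai R_int[OF ai] this R_integral[OF ai, symmetric]]
  show ?thesis using ai by (simp add: fixed_def)
qed

lemma fixed_pos_part:
  assumes "fixed f"
  shows "fixed (\<lambda>x. max (f x - c) 0)"
proof -
  have "fixed (\<lambda>x. f x + (- c))" by (rule fixed_add[OF assms fixed_const])
  from fixed_scale[OF fixed_add[OF this fixed_abs[OF this]], of "1/2"]
  have "fixed (\<lambda>x. 1/2 * (f x + - c + \<bar>f x + - c\<bar>))" .
  moreover have "(\<lambda>x. 1/2 * (f x + - c + \<bar>f x + - c\<bar>)) = (\<lambda>x. max (f x - c) 0)"
    by (auto simp: fun_eq_iff max_def)
  ultimately show ?thesis by simp
qed

lemma fixed_min_one: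
  assumes "fixed f"
  shows "fixed (\<lambda>x. min (f x) 1)"
proof -
  have "fixed (\<lambda>x. f x + (- 1) * max (f x - 1) 0)"
    by (intro fixed_add fixed_scale fixed_pos_part assms)
  moreover have "(\<lambda>x. f x + (- 1) * max (f x - 1) 0) = (\<lambda>x. min (f x) 1)"
    by (auto simp: fun_eq_iff max_def min_def)
  ultimately show ?thesis by simp
qed

text \<open>The indicator of \<open>{f > c}\<close> is the increasing limit of the fixed functions
  \<open>min (n (f - c)\<^sup>+) 1\<close>.\<close>

lemma fixed_superlevel:
  assumes f: "fixed f" and A: "A = {x \<in> space M. c < f x}"
  shows "A \<in> sets M" "fixed (\<lambda>x. indicator A x)"
proof -
  have fm [measurable]: "f \<in> borel_measurable M" using fixed_int[OF f] by simp
  show As [measurable]: "A \<in> sets M" unfolding A by measurable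
  \<comment> \<open>\<open>b\<close> is the indicator of \<open>A\<close> without the restriction to
    \<open>space M\<close>, so that \<open>u n x <= b x\<close> holds at every point, as
    \<open>R_mono\<close> requires.\<close>
  define b where "b x = (if c < f x then 1 else 0 :: real)" for x
  have b_eq: "x \<in> space M \<Longrightarrow> b x = indicator A x" for x by (simp add: A b_def indicator_def)
  have ii: "integrable M (indicator A :: 'a \<Rightarrow> real)" by (simp add: emeasure_eq_measure)
  have bi: "integrable M b"
    using ii Bochner_Integration.integrable_cong[of M M b "indicator A", OF refl b_eq] by simp
  define u where "u n x = min (real n * max (f x - c) 0) 1" for n :: nat and x
  have u: "fixed (u n)" for n
    unfolding u_def[abs_def] by (intro fixed_min_one fixed_scale fixed_pos_part f)
  have ule: "u n x \<le> b x" for n x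
    by (simp add: u_def b_def)
  have ulim: "(\<lambda>n. u n x) \<longlonglongrightarrow> b x" for x
  proof (cases "c < f x")
    case True
    obtain N :: nat where "1 < real N * (f x - c)"
      using reals_Archimedean3[of "f x - c"] True by auto
    moreover have "real N * (f x - c) \<le> real n * (f x - c)" if "n \<ge> N" for n
      using that True by (intro mult_right_mono) auto
    ultimately have "1 \<le> real n * (f x - c)" if "n \<ge> N" for n
      using that less_le_trans less_imp_le by metis
    then have "u n x = b x" if "n \<ge> N" for n
      using True that by (simp add: u_def b_def)
    then have "\<forall>\<^sub>F n in sequentially. u n x = b x"
      unfolding eventually_sequentially by metis
    then show ?thesis by (rule tendsto_eventually)
  next
    case False
    then show ?thesis by (simp add: u_def b_def)
  qed
  have "AE x in M. u n x \<le> R b x" for n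
    using R_mono[OF fixed_int[OF u] bi ule, of n] fixed_AE[OF u, of n] by eventually_elim simp
  then have "AE x in M. \<forall>n. u n x \<le> R b x" by (simp add: AE_all_countable)
  then have "AE x in M. b x \<le> R b x"
  proof eventually_elim
    case (elim x)
    have "\<exists>N. \<forall>n\<ge>N. u n x \<le> R b x" using elim by simp
    then show ?case by (rule LIMSEQ_le_const2[OF ulim])
  qed
  from AE_eq_of_le_integral[OF bi R_int[OF bi] this R_integral[OF bi, symmetric]]
  have "AE x in M. R b x = b x" .
  moreover have "AE x in M. b x = indicator A x" by (rule AE_I2) (rule b_eq)
  moreover from R_cong[OF bi ii this] have "AE x in M. R b x = R (indicator A) x" .
  ultimately have "AE x in M. R (indicator A) x = indicator A x"
    by eventually_elim simp
  then show "fixed (\<lambda>x. indicator A x)"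
    using ii by (simp add: fixed_def)
qed

text \<open>A fixed indicator reduces the operator: \<open>R (1\<^sub>A h)\<close> vanishes off \<open>A\<close> and
  \<open>R (1\<^bsub>-A\<^esub> h)\<close> vanishes on \<open>A\<close>.\<close>

lemma integral_fixed_indicator_nonneg:
  assumes A: "A \<in> sets M" and fA: "fixed (\<lambda>x. indicator A x)"
    and h: "integrable M h" and hb: "\<And>x. 0 \<le> h x \<and> h x \<le> B"
  shows "(\<integral>x. indicator A x * R h x \<partial>M) = (\<integral>x. indicator A x * h x \<partial>M)"
proof -
  define p where "p x = indicator A x * h x" for x
  define q where "q x = (1 - indicator A x) * h x" for x
  have B: "0 \<le> B" using hb order_trans by blast
  have pi: "integrable M p"
    unfolding p_def using integrable_real_mult_indicator[OF A h] by (simp add: mult.commute)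
  have "q = (\<lambda>x. h x - p x)" by (auto simp: q_def p_def algebra_simps)
  then have qi: "integrable M q" using h pi by simp
  have fA': "fixed (\<lambda>x. B * indicator A x)" by (rule fixed_scale[OF fA])
  have "fixed (\<lambda>x. B + (- B) * indicator A x)"
    by (rule fixed_add[OF fixed_const fixed_scale[OF fA]])
  moreover have "(\<lambda>x. B + (- B) * indicator A x) = (\<lambda>x. B * (1 - indicator A x))"
    by (simp add: fun_eq_iff algebra_simps)
  ultimately have fC: "fixed (\<lambda>x. B * (1 - indicator A x))" by simp
  \<comment> \<open>The dominating functions \<open>B * 1_A\<close> and \<open>B * (1 - 1_A)\<close>
    are fixed, so they bound the images by functions that vanish off \<open>A\<close> and on
    \<open>A\<close>, respectively.\<close>
  have 1: "AE x in M. R p x \<le> R (\<lambda>x. B * indicator A x) x"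
    by (rule R_mono[OF pi fixed_int[OF fA']]) (use hb in \<open>auto simp: p_def indicator_def\<close>)
  have 2: "AE x in M. R q x \<le> R (\<lambda>x. B * (1 - indicator A x)) x"
    by (rule R_mono[OF qi fixed_int[OF fC]]) (use hb in \<open>auto simp: q_def indicator_def\<close>)
  have 3: "AE x in M. 0 \<le> R p x"
    by (rule R_nonneg[OF pi]) (use hb in \<open>auto simp: p_def indicator_def\<close>)
  have 4: "AE x in M. 0 \<le> R q x"
    by (rule R_nonneg[OF qi]) (use hb in \<open>auto simp: q_def indicator_def\<close>)
  have pq: "(\<lambda>x. p x + q x) = h" by (auto simp: p_def q_def algebra_simps)
  have 5: "AE x in M. R h x = R p x + R q x"
    using R_add[OF pi qi] unfolding pq .
  have eA: "AE x in M. R (\<lambda>x. B * indicator A x) x = B * indicator A x"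
    and eC: "AE x in M. R (\<lambda>x. B * (1 - indicator A x)) x = B * (1 - indicator A x)"
    using fA' fC by (auto simp: fixed_def)
  have "AE x in M. indicator A x * R h x = R p x"
    using 1 2 3 4 5 eA eC
  proof eventually_elim
    case (elim x)
    then show ?case by (cases "x \<in> A") auto
  qed
  moreover have "integrable M (\<lambda>x. indicator A x * R h x)"
    using integrable_real_mult_indicator[OF A R_int[OF h]] by (simp add: mult.commute)
  ultimately have "(\<integral>x. indicator A x * R h x \<partial>M) = (\<integral>x. R p x \<partial>M)"
    using R_int[OF pi] by (intro integral_cong_AE) auto
  then show ?thesis using R_integral[OF pi] by (simp add: p_def[abs_def])
qed

text \<open>Adding the constant \<open>B\<close>, which is fixed, reduces this to nonnegative
  functions with bound \<open>2 * B\<close>.\<close>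

lemma integral_fixed_indicator:
  assumes A: "A \<in> sets M" and fA: "fixed (\<lambda>x. indicator A x)"
    and h: "integrable M h" and hb: "\<And>x. \<bar>h x\<bar> \<le> B"
  shows "(\<integral>x. indicator A x * R h x \<partial>M) = (\<integral>x. indicator A x * h x \<partial>M)"
proof -
  have hB: "integrable M (\<lambda>x. h x + B)" using h by simp
  have "0 \<le> h x + B \<and> h x + B \<le> 2 * B" for x using hb[of x] by (simp add: abs_le_iff)
  from integral_fixed_indicator_nonneg[OF A fA hB this]
  have eq: "(\<integral>x. indicator A x * R (\<lambda>x. h x + B) x \<partial>M) = (\<integral>x. indicator A x * (h x + B) \<partial>M)" .
  have iA: "integrable M (\<lambda>x. indicator A x * g x)" if "integrable M g" for g :: "'a \<Rightarrow> real"
    using integrable_real_mult_indicator[OF A that] by (simp add: mult.commute)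
  have "AE x in M. R (\<lambda>x. h x + B) x = R h x + R (\<lambda>_. B) x"
    by (rule R_add[OF h]) simp
  moreover have "AE x in M. R (\<lambda>_. B) x = B"
    using fixed_const by (simp add: fixed_def)
  ultimately have "AE x in M. indicator A x * R (\<lambda>x. h x + B) x = indicator A x * R h x + indicator A x * B"
    by eventually_elim (simp add: algebra_simps)
  then have "(\<integral>x. indicator A x * R (\<lambda>x. h x + B) x \<partial>M) = (\<integral>x. indicator A x * R h x + indicator A x * B \<partial>M)"
    by (intro integral_cong_AE borel_measurable_integrable Bochner_Integration.integrable_add iA R_int hB h) auto
  also have "\<dots> = (\<integral>x. indicator A x * R h x \<partial>M) + (\<integral>x. indicator A x * B \<partial>M)"
    by (intro Bochner_Integration.integral_add iA R_int h) auto
  finally have "(\<integral>x. indicator A x * R h x \<partial>M) + (\<integral>x. indicator A x * B \<partial>M)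
      = (\<integral>x. indicator A x * h x + indicator A x * B \<partial>M)"
    using eq by (simp add: distrib_left)
  also have "\<dots> = (\<integral>x. indicator A x * h x \<partial>M) + (\<integral>x. indicator A x * B \<partial>M)"
    by (intro Bochner_Integration.integral_add iA h) auto
  finally show ?thesis by simp
qed

end

section \<open>Extreme invariant measures are ergodic\<close>

context invariant_markov_operator
begin

definition S_L1_real :: "('a \<Rightarrow> real) \<Rightarrow> 'a \<Rightarrow> real" where
  "S_L1_real f x = Re (S_L1 (\<lambda>y. complex_of_real (f y)) x)"

lemma S_L1_real_int: "integrable M f \<Longrightarrow> integrable M (S_L1_real f)"
  unfolding S_L1_real_def[abs_def] by (intro integrable_Re S_L1_int integrable_of_real)

text \<open>The positive and the negative part of f both have nonnegative images almost everywhere,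
  so the imaginary part of the image of f vanishes.\<close>

lemma S_L1_of_real:
  fixes f :: "'a \<Rightarrow> real"
  assumes f: "integrable M f"
  shows "AE x in M. S_L1 (\<lambda>y. complex_of_real (f y)) x = complex_of_real (S_L1_real f x)"
proof -
  define p where "p x = max (f x) 0" for x
  define q where "q x = max (- f x) 0" for x
  have pi: "integrable M p" and qi: "integrable M q"
    using f unfolding p_def[abs_def] q_def[abs_def] by auto
  have cp: "integrable M (\<lambda>x. complex_of_real (p x))" and cq: "integrable M (\<lambda>x. complex_of_real (q x))"
    using pi qi by auto
  have cq': "integrable M (\<lambda>x. (- 1) * complex_of_real (q x))" using cq by simp
  have 1: "AE x in M. S_L1 (\<lambda>y. complex_of_real (p y)) x = complex_of_real (cmod (S_L1 (\<lambda>y. complex_of_real (p y)) x))"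
    by (rule S_L1_nonneg[OF pi]) (simp add: p_def)
  have 2: "AE x in M. S_L1 (\<lambda>y. complex_of_real (q y)) x = complex_of_real (cmod (S_L1 (\<lambda>y. complex_of_real (q y)) x))"
    by (rule S_L1_nonneg[OF qi]) (simp add: q_def)
  have eq: "(\<lambda>y. complex_of_real (p y) + (- 1) * complex_of_real (q y)) = (\<lambda>y. complex_of_real (f y))"
    by (auto simp: fun_eq_iff p_def q_def max_def)
  have 3: "AE x in M. S_L1 (\<lambda>y. complex_of_real (f y)) x
      = S_L1 (\<lambda>y. complex_of_real (p y)) x + S_L1 (\<lambda>y. (- 1) * complex_of_real (q y)) x"
    using S_L1_add[OF cp cq'] unfolding eq .
  have 4: "AE x in M. S_L1 (\<lambda>y. (- 1) * complex_of_real (q y)) x = (- 1) * S_L1 (\<lambda>y. complex_of_real (q y)) x"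
    by (rule S_L1_scale[OF cq])
  have "AE x in M. Im (S_L1 (\<lambda>y. complex_of_real (f y)) x) = 0"
    using 1 2 3 4
  proof eventually_elim
    case (elim x)
    have "Im (S_L1 (\<lambda>y. complex_of_real (p y)) x) = 0" "Im (S_L1 (\<lambda>y. complex_of_real (q y)) x) = 0"
      by (metis elim(1) Im_complex_of_real, metis elim(2) Im_complex_of_real)
    then show ?case using elim(3,4) by simp
  qed
  then show ?thesis
    by eventually_elim (simp add: S_L1_real_def complex_eq_iff)
qed

lemma markov_L1_S_L1_real: "markov_L1 M S_L1_real"
proof (unfold_locales)
  fix f g :: "'a \<Rightarrow> real" and c :: real
  assume f: "integrable M f"
  have cf: "integrable M (\<lambda>x. complex_of_real (f x))" using f by simp
  show "integrable M (S_L1_real f)" by (rule S_L1_real_int[OF f])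
  show "AE x in M. S_L1_real (\<lambda>y. c * f y) x = c * S_L1_real f x"
    using S_L1_scale[OF cf, of "complex_of_real c"] by eventually_elim (simp add: S_L1_real_def)
  show "AE x in M. 0 \<le> S_L1_real f x" if "\<And>x. 0 \<le> f x"
    using S_L1_nonneg[OF f that] by eventually_elim (metis S_L1_real_def Re_complex_of_real norm_ge_zero)
  have "complex_of_real (\<integral>x. S_L1_real f x \<partial>M) = (\<integral>x. complex_of_real (S_L1_real f x) \<partial>M)" by simp
  also have "\<dots> = (\<integral>x. S_L1 (\<lambda>y. complex_of_real (f y)) x \<partial>M)"
  proof (rule integral_cong_AE)
    show "(\<lambda>x. complex_of_real (S_L1_real f x)) \<in> borel_measurable M"
      using S_L1_real_int[OF f] by simp
    show "S_L1 (\<lambda>y. complex_of_real (f y)) \<in> borel_measurable M"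
      using S_L1_int[OF cf] by simp
    show "AE x in M. complex_of_real (S_L1_real f x) = S_L1 (\<lambda>y. complex_of_real (f y)) x"
      using S_L1_of_real[OF f] by eventually_elim simp
  qed
  also have "\<dots> = complex_of_real (\<integral>x. f x \<partial>M)" using S_L1_integral[OF cf] by simp
  finally show "(\<integral>x. S_L1_real f x \<partial>M) = (\<integral>x. f x \<partial>M)" by simp
  assume g: "integrable M g"
  have cg: "integrable M (\<lambda>x. complex_of_real (g x))" using g by simp
  show "AE x in M. S_L1_real (\<lambda>y. f y + g y) x = S_L1_real f x + S_L1_real g x"
    using S_L1_add[OF cf cg] by eventually_elim (simp add: S_L1_real_def)
  assume "AE x in M. f x = g x"
  then have "AE x in M. complex_of_real (f x) = complex_of_real (g x)" by eventually_elim simp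
  from S_L1_cong[OF cf cg this] show "AE x in M. S_L1_real f x = S_L1_real g x"
    by eventually_elim (simp add: S_L1_real_def)
next
  have "AE x in M. S_L1 (apply_bcontfun (emb (\<lambda>_. 1))) x = S (emb (\<lambda>_. 1)) x" by (rule S_L1_CK)
  moreover have "apply_bcontfun (emb (\<lambda>_ :: 'a. 1)) = (\<lambda>_. complex_of_real 1)"
    by (rule ext) (simp add: emb_app)
  moreover have "S (emb (\<lambda>_. 1)) x = 1" for x
    by (simp add: S_emb real_op_one)
  ultimately have "AE x in M. S_L1 (\<lambda>_. complex_of_real 1) x = 1" by simp
  then show "AE x in M. S_L1_real (\<lambda>_. 1) x = 1" by eventually_elim (simp add: S_L1_real_def)
qed

sublocale L1: markov_L1 M S_L1_real by (rule markov_L1_S_L1_real)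

lemma S_L1_real_continuous:
  assumes f: "continuous_on UNIV f"
  shows "AE x in M. S_L1_real f x = real_op S f x"
proof -
  have "AE x in M. S_L1 (apply_bcontfun (emb f)) x = S (emb f) x" by (rule S_L1_CK)
  moreover have "apply_bcontfun (emb f) = (\<lambda>x. complex_of_real (f x))"
    by (rule ext) (rule emb_app[OF f])
  ultimately have "AE x in M. S_L1 (\<lambda>x. complex_of_real (f x)) x = complex_of_real (real_op S f x)"
    by (simp add: S_emb[OF f])
  then show ?thesis by eventually_elim (simp add: S_L1_real_def)
qed

text \<open>Real functions have real images almost everywhere, so the equation S f = f splits into
  its real and its imaginary part.\<close>

lemma S_L1_fixed_parts:
  assumes f: "integrable M f" and fx: "AE x in M. S_L1 f x = f x"
  shows "L1.fixed (\<lambda>x. Re (f x))" "L1.fixed (\<lambda>x. Im (f x))"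
proof -
  have r: "integrable M (\<lambda>x. Re (f x))" and i: "integrable M (\<lambda>x. Im (f x))" using f by auto
  have cr: "integrable M (\<lambda>x. complex_of_real (Re (f x)))" and ci: "integrable M (\<lambda>x. complex_of_real (Im (f x)))"
    using r i by auto
  have ci': "integrable M (\<lambda>x. \<i> * complex_of_real (Im (f x)))" using ci by simp
  have eq: "(\<lambda>x. complex_of_real (Re (f x)) + \<i> * complex_of_real (Im (f x))) = f"
    by (simp add: fun_eq_iff flip: complex_eq)
  have 1: "AE x in M. S_L1 f x = S_L1 (\<lambda>x. complex_of_real (Re (f x))) x + S_L1 (\<lambda>x. \<i> * complex_of_real (Im (f x))) x"
    using S_L1_add[OF cr ci'] unfolding eq .
  have "AE x in M. S_L1_real (\<lambda>x. Re (f x)) x = Re (f x) \<and> S_L1_real (\<lambda>x. Im (f x)) x = Im (f x)"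
    using fx 1 S_L1_scale[OF ci, of \<i>] S_L1_of_real[OF r] S_L1_of_real[OF i]
    by eventually_elim (simp add: complex_eq_iff)
  then show "L1.fixed (\<lambda>x. Re (f x))" "L1.fixed (\<lambda>x. Im (f x))"
    using r i unfolding L1.fixed_def by (simp_all add: AE_conj_iff)
qed

text \<open>The way back from L1 to \<open>C(K)\<close>: a superlevel set of a fixed function yields
  an invariant functional on continuous functions, the form in which extremality can be
  applied.\<close>

lemma fixed_superlevel_invariant:
  assumes g: "L1.fixed g" and f: "continuous_on UNIV f" and A: "A = {x \<in> space M. c < g x}"
  shows "(\<integral>x. indicator A x * real_op S f x \<partial>M) = (\<integral>x. indicator A x * f x \<partial>M)"
proof -
  have As: "A \<in> sets M" and fA: "L1.fixed (\<lambda>x. indicator A x)"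
    using L1.fixed_superlevel[OF g A] by auto
  obtain B where B: "\<And>x. \<bar>f x\<bar> \<le> B"
    using compact_imp_bounded[OF compact_continuous_image[OF f compact_UNIV]]
    by (auto simp: bounded_iff)
  have fi: "integrable M f" by (rule cont_integrable[OF f])
  have iA: "integrable M (\<lambda>x. indicator A x * h x)" if "integrable M h" for h :: "'a \<Rightarrow> real"
    using integrable_real_mult_indicator[OF As that] by (simp add: mult.commute)
  have "AE x in M. indicator A x * real_op S f x = indicator A x * S_L1_real f x"
    using S_L1_real_continuous[OF f] by eventually_elim simp
  then have "(\<integral>x. indicator A x * real_op S f x \<partial>M) = (\<integral>x. indicator A x * S_L1_real f x \<partial>M)"
    by (intro integral_cong_AE borel_measurable_integrable iA cont_integrable continuous_on_real_op
        S_L1_real_int fi)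
  also have "\<dots> = (\<integral>x. indicator A x * f x \<partial>M)"
    by (rule L1.integral_fixed_indicator[OF As fA fi B])
  finally show ?thesis .
qed

end

text \<open>The criterion tests invariance of a set against continuous functions and not through the
  operators on L1, so that it can be verified by splitting a state.\<close>

lemma ergodic_of_trivial:
  fixes \<S> :: "('a::t2_space) CK_op set"
  assumes K: "compact (UNIV :: 'a set)" and mk: "\<forall>S\<in>\<S>. markov_op S" and M: "M \<in> inv_prob \<S>"
    and triv: "\<And>A. A \<in> sets M \<Longrightarrow>
      (\<And>S f. S \<in> \<S> \<Longrightarrow> continuous_on UNIV f \<Longrightarrow>
        (\<integral>x. indicator A x * real_op S f x \<partial>M) = (\<integral>x. indicator A x * f x \<partial>M)) \<Longrightarrow>
      measure M A \<in> {0, 1}"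
  shows "ergodic_measure \<S> M"
proof -
  have reg: "regular_prob M" and inv: "\<And>S f. S \<in> \<S> \<Longrightarrow> pairing (S f) M = pairing f M"
    using M by (auto simp: inv_prob_def)
  interpret P: prob_space M using reg by (simp add: regular_prob_def)
  have loc: "invariant_markov_operator S M" if "S \<in> \<S>" for S
    using K mk reg inv[OF that] that by unfold_locales auto
  \<comment> \<open>The constant 1 is going to span the common fixed space.\<close>
  have one: "(\<lambda>_. 1) \<in> L1_fix \<S> M"
  proof -
    have "AE x in M. L1_op M S (\<lambda>_. 1) x = 1" if "S \<in> \<S>" for S
    proof -
      interpret invariant_markov_operator S M by (rule loc[OF that])
      have "AE x in M. S_L1 (apply_bcontfun (const_bcontfun 1)) x = S (const_bcontfun 1) x" by (rule S_L1_CK)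
      moreover have "S (const_bcontfun 1) = const_bcontfun 1" using markov by (simp add: markov_op_def)
      ultimately show ?thesis by (simp add: const_bcontfun.rep_eq)
    qed
    then show ?thesis by (simp add: L1_fix_def)
  qed
  have const: "AE x in M. g x = (\<integral>x. g x \<partial>M)"
    if g: "integrable M g" and fx: "\<And>S. S \<in> \<S> \<Longrightarrow> markov_L1.fixed M (invariant_markov_operator.S_L1_real S M) g"
    for g :: "'a \<Rightarrow> real"
  proof (rule P.AE_const_of_trivial[OF g])
    have [measurable]: "g \<in> borel_measurable M" using g by simp
    let ?A = "{x \<in> space M. (\<integral>x. g x \<partial>M) < g x}"
    show "measure M ?A \<in> {0, 1}"
    proof (rule triv)
      show "?A \<in> sets M" by measurable
      fix S and f :: "'a \<Rightarrow> real" assume S: "S \<in> \<S>" and f: "continuous_on UNIV f"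
      interpret invariant_markov_operator S M by (rule loc[OF S])
      show "(\<integral>x. indicator ?A x * real_op S f x \<partial>M) = (\<integral>x. indicator ?A x * f x \<partial>M)"
        by (rule fixed_superlevel_invariant[OF fx[OF S] f refl])
    qed
  qed
  have "\<exists>c. AE x in M. f x = c * 1" if f: "f \<in> L1_fix \<S> M" for f
  proof -
    have fi: "integrable M f" using f by (simp add: L1_fix_def)
    have parts: "markov_L1.fixed M (invariant_markov_operator.S_L1_real S M) (\<lambda>x. Re (f x))"
      "markov_L1.fixed M (invariant_markov_operator.S_L1_real S M) (\<lambda>x. Im (f x))" if S: "S \<in> \<S>" for S
    proof -
      interpret invariant_markov_operator S M by (rule loc[OF S])
      have "AE x in M. S_L1 f x = f x" using f S by (simp add: L1_fix_def)
      from S_L1_fixed_parts[OF fi this]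
      show "markov_L1.fixed M (invariant_markov_operator.S_L1_real S M) (\<lambda>x. Re (f x))"
        "markov_L1.fixed M (invariant_markov_operator.S_L1_real S M) (\<lambda>x. Im (f x))" .
    qed
    have "AE x in M. Re (f x) = (\<integral>x. Re (f x) \<partial>M)" "AE x in M. Im (f x) = (\<integral>x. Im (f x) \<partial>M)"
      by (intro const integrable_Re integrable_Im fi parts; assumption)+
    then have "AE x in M. f x = Complex (\<integral>x. Re (f x) \<partial>M) (\<integral>x. Im (f x) \<partial>M) * 1"
      by eventually_elim (simp add: complex_eq_iff)
    then show ?thesis by blast
  qed
  then show ?thesis
    unfolding ergodic_measure_def by (intro bexI[OF _ one]) auto
qed

section \<open>Invariant measures and invariant states\<close>

lemma inv_probI:
  fixes \<S> :: "('a::t2_space) CK_op set"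
  assumes K: "compact (UNIV :: 'a set)" and mk: "\<forall>S\<in>\<S>. markov_op S" and M: "regular_prob M"
    and inv: "\<And>S f. S \<in> \<S> \<Longrightarrow> continuous_on UNIV f \<Longrightarrow> (\<integral>x. real_op S f x \<partial>M) = (\<integral>x. f x \<partial>M)"
  shows "M \<in> inv_prob \<S>"
proof -
  have int: "integrable M h" if "continuous_on UNIV h" for h :: "'a \<Rightarrow> real"
    by (rule regular_prob_integrable[OF K M that])
  have "pairing (S f) M = pairing f M" if S: "S \<in> \<S>" for S and f :: "'a CK"
  proof -
    interpret markov_operator S using K mk S by unfold_locales auto
    have c: "continuous_on UNIV (\<lambda>x. Re (f x))" "continuous_on UNIV (\<lambda>x. Im (f x))"
      by (intro continuous_intros continuous_on_apply_bcontfun)+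
    have "pairing (S f) M = (\<integral>x. complex_of_real (real_op S (\<lambda>x. Re (f x)) x)
        + \<i> * complex_of_real (real_op S (\<lambda>x. Im (f x)) x) \<partial>M)"
    proof -
      have "apply_bcontfun (S f) = (\<lambda>x. complex_of_real (real_op S (\<lambda>x. Re (f x)) x)
        + \<i> * complex_of_real (real_op S (\<lambda>x. Im (f x)) x))"
        by (rule ext) (rule S_decomp)
      then show ?thesis unfolding pairing_def by simp
    qed
    also have "\<dots> = complex_of_real (\<integral>x. real_op S (\<lambda>x. Re (f x)) x \<partial>M)
        + \<i> * complex_of_real (\<integral>x. real_op S (\<lambda>x. Im (f x)) x \<partial>M)"
      using int[OF continuous_on_real_op] by simp
    also have "\<dots> = complex_of_real (\<integral>x. Re (f x) \<partial>M) + \<i> * complex_of_real (\<integral>x. Im (f x) \<partial>M)"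
      using inv[OF S] c by simp
    also have "\<dots> = (\<integral>x. complex_of_real (Re (f x)) + \<i> * complex_of_real (Im (f x)) \<partial>M)"
      using int[OF c(1)] int[OF c(2)] by simp
    also have "\<dots> = pairing f M"
      unfolding pairing_def by (simp flip: complex_eq)
    finally show ?thesis .
  qed
  then show ?thesis using M by (simp add: inv_prob_def)
qed

lemma inv_prob_real_op:
  fixes \<S> :: "('a::t2_space) CK_op set"
  assumes K: "compact (UNIV :: 'a set)" and mk: "\<forall>S\<in>\<S>. markov_op S" and M: "M \<in> inv_prob \<S>"
    and S: "S \<in> \<S>" and f: "continuous_on UNIV f"
  shows "(\<integral>x. real_op S f x \<partial>M) = (\<integral>x. f x \<partial>M)"
proof -
  interpret invariant_markov_operator S M
    using K mk M S by unfold_locales (auto simp: inv_prob_def)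
  show ?thesis by (rule integral_real_op[OF f])
qed

text \<open>Integration against the measure with density \<open>w\<close>; the default 0 at
  discontinuous functions is the one required by \<open>states\<close>.\<close>

definition functional_of :: "('a::t2_space) measure \<Rightarrow> ('a \<Rightarrow> real) \<Rightarrow> ('a \<Rightarrow> real) \<Rightarrow> real" where
  "functional_of M w f = (if continuous_on UNIV f then \<integral>x. w x * f x \<partial>M else 0)"

lemma functional_of_states:
  fixes M :: "'a::t2_space measure"
  assumes K: "compact (UNIV :: 'a set)" and M: "regular_prob M"
    and w: "integrable M w" "\<And>x. 0 \<le> w x" "(\<integral>x. w x \<partial>M) = 1"
  shows "functional_of M w \<in> states"
proof -
  have int: "integrable M (\<lambda>x. w x * f x)" if f: "continuous_on UNIV f" for f :: "'a \<Rightarrow> real"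
  proof -
    obtain B where B: "\<And>x. \<bar>f x\<bar> \<le> B"
      using compact_imp_bounded[OF compact_continuous_image[OF f K]] by (auto simp: bounded_iff)
    have "integrable M (\<lambda>x. B * w x)" using w(1) by simp
    moreover have "(\<lambda>x. w x * f x) \<in> borel_measurable M"
      using w(1) regular_prob_measurable[OF M f] by simp
    moreover have "AE x in M. norm (w x * f x) \<le> norm (B * w x)"
    proof (rule AE_I2)
      fix x
      have "0 \<le> B" using B[of x] abs_ge_zero order_trans by blast
      then show "norm (w x * f x) \<le> norm (B * w x)"
        using mult_left_mono[OF B[of x] w(2)[of x]] w(2)[of x] by (simp add: abs_mult mult.commute)
    qed
    ultimately show ?thesis by (rule Bochner_Integration.integrable_bound)
  qed
  show ?thesis
    unfolding states_def mem_Collect_eq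
  proof (intro conjI allI impI)
    fix f g :: "'a \<Rightarrow> real" and c :: real
    assume f: "continuous_on UNIV f"
    show "functional_of M w (\<lambda>x. c * f x) = c * functional_of M w f"
      using f by (simp add: functional_of_def continuous_on_mult_left mult.left_commute)
    show "0 \<le> functional_of M w f" if "\<forall>x. 0 \<le> f x"
      using f that w(2) by (simp add: functional_of_def)
    assume g: "continuous_on UNIV g"
    show "functional_of M w (\<lambda>x. f x + g x) = functional_of M w f + functional_of M w g"
      using int[OF f] int[OF g] f g by (simp add: functional_of_def continuous_on_add distrib_left)
  next
    show "functional_of M w (\<lambda>_. 1) = 1" using w(3) by (simp add: functional_of_def)
  next
    fix f :: "'a \<Rightarrow> real" assume "\<not> continuous_on UNIV f"
    then show "functional_of M w f = 0" by (simp add: functional_of_def)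
  qed
qed

text \<open>The last clause expresses that \<open>L\<close> vanishes on the absolute kernel of
  \<open>M\<close>, in terms of the nonnegative real functions |f| that decide membership.\<close>

definition inv_states :: "('a::t2_space) CK_op set \<Rightarrow> 'a measure \<Rightarrow> (('a \<Rightarrow> real) \<Rightarrow> real) set" where
  "inv_states \<S> M = states \<inter>
     {L. (\<forall>S\<in>\<S>. \<forall>f. continuous_on UNIV f \<longrightarrow> L (real_op S f) = L f) \<and>
         (\<forall>g. continuous_on UNIV g \<and> (\<forall>x. 0 \<le> g x) \<and> (\<integral>x. g x \<partial>M) = 0 \<longrightarrow> L g = 0)}"

lemma closed_inv_states: "closed (inv_states \<S> M)"
proof -
  have "inv_states \<S> M = states \<inter>
      (\<Inter>S\<in>\<S>. \<Inter>f\<in>{f. continuous_on UNIV f}. {L. L (real_op S f) = L f}) \<inter>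
      (\<Inter>g\<in>{g. continuous_on UNIV g \<and> (\<forall>x. 0 \<le> g x) \<and> (\<integral>x. g x \<partial>M) = 0}. {L. L g = 0})"
    unfolding inv_states_def by auto
  also have "closed \<dots>"
    by (intro closed_Int closed_states closed_INT ballI closed_Collect_eq continuous_on_const
        continuous_on_eval)
  finally show ?thesis .
qed

text \<open>The extreme point of \<open>inv_states \<S> M\<close> that maximizes \<open>f0\<close> is represented by an ergodic
  measure: an invariant set \<open>A\<close> of measure \<open>p\<close> strictly between 0 and 1 would split it into the
  normalized restrictions to \<open>A\<close> and to its complement.\<close>

theorem exists_ergodic:
  fixes \<S> :: "('a::t2_space) CK_op set" and f0 :: "'a \<Rightarrow> real"
  assumes K: "compact (UNIV :: 'a set)" and mk: "\<forall>S\<in>\<S>. markov_op S" and M: "M \<in> inv_prob \<S>"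
    and f0: "continuous_on UNIV f0" "\<And>x. 0 \<le> f0 x" "(\<integral>x. f0 x \<partial>M) \<noteq> 0"
  shows "\<exists>N\<in>inv_prob \<S>. ergodic_measure \<S> N \<and> (\<integral>x. f0 x \<partial>N) \<noteq> 0 \<and>
    (\<forall>g :: 'a \<Rightarrow> real. continuous_on UNIV g \<and> (\<forall>x. 0 \<le> g x) \<and> (\<integral>x. g x \<partial>M) = 0 \<longrightarrow> (\<integral>x. g x \<partial>N) = 0)"
proof -
  have regM: "regular_prob M" using M by (simp add: inv_prob_def)
  interpret M: prob_space M using regM by (simp add: regular_prob_def)
  \<comment> \<open>\<open>M\<close> itself supplies a competitor: it shows that
    \<open>inv_states\<close> is nonempty and later that the maximum at \<open>f0\<close> is
    positive.\<close>
  define L0 where "L0 = functional_of M (\<lambda>_. 1)"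
  have "L0 \<in> states"
    unfolding L0_def by (rule functional_of_states[OF K regM]) (simp_all add: M.prob_space)
  moreover have L0: "L0 f = (\<integral>x. f x \<partial>M)" if "continuous_on UNIV f" for f
    using that by (simp add: L0_def functional_of_def)
  ultimately have L0X: "L0 \<in> inv_states \<S> M"
    using inv_prob_real_op[OF K mk M] by (simp add: inv_states_def continuous_on_real_op)
  have cpt: "compact (inv_states \<S> M)"
    using compact_Int_closed[OF compact_states[OF K] closed_inv_states[of \<S> M]]
    by (simp add: inv_states_def Int_absorb1)
  have ne: "inv_states \<S> M \<noteq> {}" using L0X by blast
  obtain L where L: "L \<in> inv_states \<S> M"
    and max: "\<And>y. y \<in> inv_states \<S> M \<Longrightarrow> y f0 \<le> L f0"
    and ext: "\<And>y z t. \<lbrakk>y \<in> inv_states \<S> M; z \<in> inv_states \<S> M; 0 < t; t < 1;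
      L = (\<lambda>j. (1 - t) * y j + t * z j)\<rbrakk> \<Longrightarrow> y = L \<and> z = L"
    by (rule extreme_maximizer_exists[OF cpt closed_inv_states ne, where i = f0]) (rule that)
  have Lst: "L \<in> states"
    and Linv: "\<And>S f. S \<in> \<S> \<Longrightarrow> continuous_on UNIV f \<Longrightarrow> L (real_op S f) = L f"
    and Lvan: "\<And>g. continuous_on UNIV g \<Longrightarrow> (\<And>x. 0 \<le> g x) \<Longrightarrow> (\<integral>x. g x \<partial>M) = 0 \<Longrightarrow> L g = 0"
    using L unfolding inv_states_def by blast+
  interpret L: compact_state L by (rule compact_state_of_states[OF K Lst])
  define N where "N = L.riesz_measure"
  have regN: "regular_prob N" unfolding N_def by (rule L.regular_prob_riesz)
  interpret N: prob_space N using regN by (simp add: regular_prob_def)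
  have LN: "L f = (\<integral>x. f x \<partial>N)" if "continuous_on UNIV f" for f
    unfolding N_def by (rule L.riesz_representation[OF that])
  have Ninv: "N \<in> inv_prob \<S>"
    by (rule inv_probI[OF K mk regN]) (metis LN Linv continuous_on_real_op)
  have intN: "integrable N f" if "continuous_on UNIV f" for f :: "'a \<Rightarrow> real"
    by (rule regular_prob_integrable[OF K regN that])
  \<comment> \<open>A normalized restriction has a density with respect to \<open>N\<close>, so a
    nonnegative \<open>g\<close> that is null for \<open>M\<close>, and hence for \<open>N\<close>,
    is null for the restriction too.\<close>
  have restrict: "functional_of N (\<lambda>x. indicator B x / measure N B) \<in> inv_states \<S> M"
    if B: "B \<in> sets N" and pos: "measure N B > 0"
      and inv: "\<And>S f. S \<in> \<S> \<Longrightarrow> continuous_on UNIV f \<Longrightarrow>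
        (\<integral>x. indicator B x * real_op S f x \<partial>N) = (\<integral>x. indicator B x * f x \<partial>N)" for B
  proof -
    let ?F = "functional_of N (\<lambda>x. indicator B x / measure N B)"
    have iB: "integrable N (indicator B :: 'a \<Rightarrow> real)" using B by (simp add: N.emeasure_eq_measure)
    have "?F \<in> states"
    proof (rule functional_of_states[OF K regN])
      show "integrable N (\<lambda>x. indicator B x / measure N B)" using iB by simp
      show "0 \<le> indicator B x / measure N B" for x by simp
      show "(\<integral>x. indicator B x / measure N B \<partial>N) = 1"
        using pos B sets.sets_into_space[OF B] by (simp add: Int_absorb2)
    qed
    moreover have F: "?F f = (\<integral>x. indicator B x * f x \<partial>N) / measure N B" if "continuous_on UNIV f" for f
      using that by (simp add: functional_of_def)
    have "?F (real_op S f) = ?F f" if "S \<in> \<S>" "continuous_on UNIV f" for S f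
      using inv[OF that] F[OF that(2)] F[OF continuous_on_real_op] by simp
    moreover have "?F g = 0"
      if g: "continuous_on UNIV g" and g0: "\<And>x. 0 \<le> g x" and gM: "(\<integral>x. g x \<partial>M) = 0" for g
    proof -
      have "(\<integral>x. g x \<partial>N) = 0" using Lvan[OF g g0 gM] LN[OF g] by simp
      then have "AE x in N. g x = 0"
        using integral_nonneg_eq_0_iff_AE[OF intN[OF g]] g0 by simp
      then have "AE x in N. indicator B x * g x = 0" by eventually_elim simp
      then have "(\<integral>x. indicator B x * g x \<partial>N) = 0" by (rule integral_eq_zero_AE)
      then show ?thesis using F[OF g] by simp
    qed
    ultimately show ?thesis by (simp add: inv_states_def)
  qed
  have "ergodic_measure \<S> N"
  proof (rule ergodic_of_trivial[OF K mk Ninv])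
    fix A assume A: "A \<in> sets N"
      and inv: "\<And>S f. S \<in> \<S> \<Longrightarrow> continuous_on UNIV f \<Longrightarrow>
        (\<integral>x. indicator A x * real_op S f x \<partial>N) = (\<integral>x. indicator A x * f x \<partial>N)"
    show "measure N A \<in> {0, 1}"
    proof (rule ccontr)
      define p where "p = measure N A"
      assume "measure N A \<notin> {0, 1}"
      then have p: "0 < p" "p < 1"
        using N.prob_le_1[of A] measure_nonneg[of N A] by (auto simp: p_def less_le)
      have spN: "space N = UNIV" using regN sets_eq_imp_space_eq[of N borel] by (simp add: regular_prob_def)
      have cA: "- A \<in> sets N" using sets.compl_sets[OF A] spN by (simp add: Compl_eq_Diff_UNIV)
      have pc: "measure N (- A) = 1 - p"
        using N.prob_compl[OF A] spN by (simp add: p_def Compl_eq_Diff_UNIV)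
      have iA: "integrable N (\<lambda>x. indicator A x * f x)" if "continuous_on UNIV f" for f :: "'a \<Rightarrow> real"
        using integrable_real_mult_indicator[OF A intN[OF that]] by (simp add: mult.commute)
      have split: "(\<integral>x. indicator (- A) x * f x \<partial>N) = (\<integral>x. f x \<partial>N) - (\<integral>x. indicator A x * f x \<partial>N)"
        if f: "continuous_on UNIV f" for f :: "'a \<Rightarrow> real"
      proof -
        have "(\<lambda>x. indicator (- A) x * f x) = (\<lambda>x. f x - indicator A x * f x)"
          by (auto simp: fun_eq_iff split: split_indicator)
        then show ?thesis using intN[OF f] iA[OF f] by simp
      qed
      define y where "y = functional_of N (\<lambda>x. indicator (- A) x / measure N (- A))"
      define z where "z = functional_of N (\<lambda>x. indicator A x / measure N A)"
      have zX: "z \<in> inv_states \<S> M"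
        unfolding z_def by (rule restrict[OF A _ inv]) (use p in \<open>auto simp: p_def\<close>)
      have yX: "y \<in> inv_states \<S> M"
        unfolding y_def
      proof (rule restrict[OF cA])
        show "0 < measure N (- A)" using p pc by simp
        fix S f assume S: "S \<in> \<S>" and f: "continuous_on UNIV (f :: 'a \<Rightarrow> real)"
        show "(\<integral>x. indicator (- A) x * real_op S f x \<partial>N) = (\<integral>x. indicator (- A) x * f x \<partial>N)"
          using split[OF continuous_on_real_op] split[OF f] inv[OF S f]
            inv_prob_real_op[OF K mk Ninv S f] by simp
      qed
      have zf: "z f = (\<integral>x. indicator A x * f x \<partial>N) / p" if "continuous_on UNIV f" for f
        using that by (simp add: z_def functional_of_def p_def)
      have yf: "y f = (\<integral>x. indicator (- A) x * f x \<partial>N) / (1 - p)" if "continuous_on UNIV f" for f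
        using that by (simp add: y_def functional_of_def pc)
      \<comment> \<open>On discontinuous functions all three functionals are 0, so the identity
        holds on the whole function type, as \<open>ext\<close> demands.\<close>
      have "L = (\<lambda>f. (1 - p) * y f + p * z f)"
      proof
        fix f :: "'a \<Rightarrow> real"
        show "L f = (1 - p) * y f + p * z f"
        proof (cases "continuous_on UNIV f")
          case True
          then show ?thesis using LN zf yf split p by simp
        next
          case False
          then have "L f = 0" using Lst unfolding states_def mem_Collect_eq by (elim conjE) metis
          moreover have "y f = 0" "z f = 0" using False by (simp_all add: y_def z_def functional_of_def)
          ultimately show ?thesis by simp
        qed
      qed
      from ext[OF yX zX p this] have "z = L" by simp
      then have key: "(\<integral>x. indicator A x * f x \<partial>N) = p * (\<integral>x. f x \<partial>N)" if "continuous_on UNIV f" for f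
        using zf[OF that] LN[OF that] p by (simp add: field_simps)
      \<comment> \<open>With the indicator of \<open>A\<close> in place of f, \<open>key\<close>
        would read \<open>p = p * p\<close>. The indicator need not be continuous, so a continuous
        \<open>u\<close> close to it in L1 replaces it.\<close>
      have "\<bar>p - p * p\<bar> \<le> 0"
      proof (rule field_le_epsilon)
        fix e :: real assume e: "e > 0"
        obtain u :: "'a \<Rightarrow> real" where u: "continuous_on UNIV u"
          "(\<integral>x. \<bar>indicator A x - u x\<bar> \<partial>N) < e / 2"
          using L1_approx_indicator[OF K regN A, of "e / 2"] e by auto
        have iiA: "integrable N (indicator A :: 'a \<Rightarrow> real)" using A by (simp add: N.emeasure_eq_measure)
        have int: "integrable N (\<lambda>x. indicator A x - u x)" using iiA intN[OF u(1)] by simp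
        have iAA: "(\<integral>x. indicator A x \<partial>N) = p"
          using A sets.sets_into_space[OF A] by (simp add: p_def Int_absorb2)
        have 1: "\<bar>p - (\<integral>x. u x \<partial>N)\<bar> \<le> e / 2"
        proof -
          have "p - (\<integral>x. u x \<partial>N) = (\<integral>x. indicator A x - u x \<partial>N)"
            using iAA iiA intN[OF u(1)] by simp
          moreover have "\<bar>\<integral>x. indicator A x - u x \<partial>N\<bar> \<le> (\<integral>x. \<bar>indicator A x - u x\<bar> \<partial>N)"
            by (rule integral_abs_bound)
          ultimately show ?thesis using u(2) by linarith
        qed
        have 2: "\<bar>p - (\<integral>x. indicator A x * u x \<partial>N)\<bar> \<le> e / 2"
        proof -
          have "(\<integral>x. indicator A x - indicator A x * u x \<partial>N) = (\<integral>x. indicator A x \<partial>N) - (\<integral>x. indicator A x * u x \<partial>N)"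
            using iiA iA[OF u(1)] by (rule Bochner_Integration.integral_diff)
          then have "p - (\<integral>x. indicator A x * u x \<partial>N) = (\<integral>x. indicator A x - indicator A x * u x \<partial>N)"
            using iAA by simp
          also have "\<bar>\<dots>\<bar> \<le> (\<integral>x. \<bar>indicator A x - indicator A x * u x\<bar> \<partial>N)"
            by (rule integral_abs_bound)
          also have "\<dots> \<le> (\<integral>x. \<bar>indicator A x - u x\<bar> \<partial>N)"
          proof (rule integral_mono)
            show "integrable N (\<lambda>x. \<bar>indicator A x - indicator A x * u x\<bar>)"
              using iiA iA[OF u(1)] by (intro integrable_abs Bochner_Integration.integrable_diff)
            show "integrable N (\<lambda>x. \<bar>indicator A x - u x\<bar>)" using int by (rule integrable_abs)
            show "\<bar>indicator A x - indicator A x * u x\<bar> \<le> \<bar>indicator A x - u x\<bar>" for x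
              by (simp add: indicator_def)
          qed
          finally show ?thesis using u(2) by simp
        qed
        have "\<bar>p * p - p * (\<integral>x. u x \<partial>N)\<bar> = p * \<bar>p - (\<integral>x. u x \<partial>N)\<bar>"
          using p by (simp add: abs_mult flip: right_diff_distrib)
        also have "\<dots> \<le> 1 * \<bar>p - (\<integral>x. u x \<partial>N)\<bar>" using p by (intro mult_right_mono) auto
        finally have 3: "\<bar>p * p - p * (\<integral>x. u x \<partial>N)\<bar> \<le> e / 2" using 1 by simp
        have "p - p * p = (p - p * (\<integral>x. u x \<partial>N)) - (p * p - p * (\<integral>x. u x \<partial>N))" by simp
        also have "\<bar>\<dots>\<bar> \<le> e / 2 + e / 2"
          using 2[unfolded key[OF u(1)]] 3 by (rule order_trans[OF abs_triangle_ineq4 add_mono])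
        finally show "\<bar>p - p * p\<bar> \<le> 0 + e" by simp
      qed
      then have "p * (1 - p) = 0" by (simp add: algebra_simps)
      then show False using p by simp
    qed
  qed
  moreover have "(\<integral>x. f0 x \<partial>N) \<noteq> 0"
  proof -
    \<comment> \<open>Since \<open>L\<close> maximizes the value at \<open>f0\<close>,
      \<open>L f0 >= L0 f0 > 0\<close>.\<close>
    have "0 \<le> (\<integral>x. f0 x \<partial>M)" using f0(2) by simp
    then have "0 < L0 f0" using f0(3) L0[OF f0(1)] by linarith
    then show ?thesis using max[OF L0X] LN[OF f0(1)] by simp
  qed
  moreover have "(\<integral>x. g x \<partial>N) = 0"
    if "continuous_on UNIV g" "\<forall>x. 0 \<le> g x" "(\<integral>x. g x \<partial>M) = 0" for g :: "'a \<Rightarrow> real"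
    using Lvan[of g] LN[of g] that by simp
  ultimately show ?thesis using Ninv by blast
qed

section \<open>Absolute kernels and the main theorem\<close>

lemma abs_kernel_iff: "f \<in> abs_kernel M \<longleftrightarrow> (\<integral>x. cmod (f x) \<partial>M) = 0"
  by (simp add: abs_kernel_def)

lemma continuous_on_cmod_CK: "continuous_on UNIV (\<lambda>x. cmod (apply_bcontfun f x))"
  by (intro continuous_intros continuous_on_apply_bcontfun)

lemma S_ideal_abs_kernel:
  fixes \<S> :: "('a::t2_space) CK_op set"
  assumes K: "compact (UNIV :: 'a set)" and mk: "\<forall>S\<in>\<S>. markov_op S" and M: "M \<in> inv_prob \<S>"
  shows "S_ideal \<S> (abs_kernel M)"
proof -
  have regM: "regular_prob M" using M by (simp add: inv_prob_def)
  interpret prob_space M using regM by (simp add: regular_prob_def)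
  have int: "integrable M (\<lambda>x. cmod (f x))" for f :: "'a CK"
    by (rule regular_prob_integrable[OF K regM continuous_on_cmod_CK])
  have zero: "f \<in> abs_kernel M" if "(\<integral>x. cmod (f x) \<partial>M) \<le> 0" for f :: "'a CK"
    unfolding abs_kernel_iff using that by (intro antisym) simp_all
  have ideal: "lattice_ideal (abs_kernel M)"
    unfolding lattice_ideal_def
  proof (intro conjI ballI allI impI)
    show "0 \<in> abs_kernel M" by (simp add: abs_kernel_iff)
    fix f :: "'a CK" and c assume f: "f \<in> abs_kernel M"
    then show "cscale c f \<in> abs_kernel M" by (simp add: abs_kernel_iff norm_mult)
    fix g :: "'a CK" assume g: "g \<in> abs_kernel M"
    have "(\<integral>x. cmod ((f + g) x) \<partial>M) \<le> (\<integral>x. cmod (f x) + cmod (g x) \<partial>M)"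
      by (intro integral_mono int Bochner_Integration.integrable_add) (simp add: norm_triangle_ineq)
    then show "f + g \<in> abs_kernel M"
      using f g int by (intro zero) (simp add: abs_kernel_iff)
  next
    fix f g :: "'a CK" assume g: "g \<in> abs_kernel M" and le: "\<forall>x. cmod (f x) \<le> cmod (g x)"
    have "(\<integral>x. cmod (f x) \<partial>M) \<le> (\<integral>x. cmod (g x) \<partial>M)"
      by (intro integral_mono int) (use le in simp)
    then show "f \<in> abs_kernel M" using g by (intro zero) (simp add: abs_kernel_iff)
  qed
  have "closure (abs_kernel M) \<subseteq> abs_kernel M"
  proof
    fix f :: "'a CK" assume f: "f \<in> closure (abs_kernel M)"
    show "f \<in> abs_kernel M"
    proof (rule zero, rule field_le_epsilon)
      fix e :: real assume "e > 0"
      then obtain g where g: "g \<in> abs_kernel M" "dist g f < e"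
        using f by (auto simp: closure_approachable)
      have "cmod (f x) \<le> cmod (g x) + e" for x
      proof -
        have "dist (g x) (f x) \<le> e" using dist_bounded[of g x f] g(2) by simp
        then show ?thesis using norm_triangle_ineq2[of "f x" "g x"] by (simp add: dist_norm norm_minus_commute)
      qed
      then have "(\<integral>x. cmod (f x) \<partial>M) \<le> (\<integral>x. cmod (g x) + e \<partial>M)"
        by (intro integral_mono int Bochner_Integration.integrable_add) auto
      also have "\<dots> = e" using g(1) int prob_space by (simp add: abs_kernel_iff)
      finally show "(\<integral>x. cmod (f x) \<partial>M) \<le> 0 + e" by simp
    qed
  qed
  then have "closed (abs_kernel M)" by (metis closure_subset_eq)
  moreover have "const_bcontfun 1 \<notin> abs_kernel M"
    by (simp add: abs_kernel_iff const_bcontfun.rep_eq prob_space)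
  then have "abs_kernel M \<noteq> UNIV" by blast
  moreover have "S f \<in> abs_kernel M" if S: "S \<in> \<S>" and f: "f \<in> abs_kernel M" for S f
  proof -
    interpret invariant_markov_operator S M
      using K mk M S by unfold_locales (auto simp: inv_prob_def)
    show ?thesis using integral_cmod_S[of f] f by (intro zero) (simp add: abs_kernel_iff)
  qed
  ultimately show ?thesis using ideal unfolding S_ideal_def by blast
qed

lemma abs_kernel_radical:
  fixes \<S> :: "('a::t2_space) CK_op set"
  assumes K: "compact (UNIV :: 'a set)" and mk: "\<forall>S\<in>\<S>. markov_op S" and M: "M \<in> inv_prob \<S>"
  shows "radical_ideal \<S> (abs_kernel M)"
proof -
  have "f \<in> abs_kernel M" if f: "f \<in> S_radical \<S> (abs_kernel M)" for f
  proof (rule ccontr)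
    assume "f \<notin> abs_kernel M"
    then have "(\<integral>x. cmod (f x) \<partial>M) \<noteq> 0" by (simp add: abs_kernel_iff)
    from exists_ergodic[OF K mk M continuous_on_cmod_CK _ this]
    obtain N where N: "N \<in> inv_prob \<S>" "ergodic_measure \<S> N" "(\<integral>x. cmod (f x) \<partial>N) \<noteq> 0"
      and van: "\<And>g :: 'a \<Rightarrow> real. continuous_on UNIV g \<Longrightarrow> (\<And>x. 0 \<le> g x) \<Longrightarrow>
        (\<integral>x. g x \<partial>M) = 0 \<Longrightarrow> (\<integral>x. g x \<partial>N) = 0"
      by auto
    have "abs_kernel M \<subseteq> abs_kernel N"
      using van[OF continuous_on_cmod_CK] by (auto simp: abs_kernel_iff)
    moreover have "abs_kernel N \<in> Prim \<S>" using N(1,2) by (auto simp: Prim_def)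
    ultimately have "f \<in> abs_kernel N" using f by (auto simp: S_radical_def)
    then show False using N(3) by (simp add: abs_kernel_iff)
  qed
  moreover have "abs_kernel M \<subseteq> S_radical \<S> (abs_kernel M)"
    by (auto simp: S_radical_def)
  ultimately show ?thesis
    using S_ideal_abs_kernel[OF assms] unfolding radical_ideal_def by blast
qed

section \<open>The metrizable case\<close>

lemma compact_metrizable_countable_basis:
  assumes K: "compact (UNIV :: ('a::topological_space) set)"
    and m: "metrizable_space (euclidean :: ('a::topological_space) topology)"
  obtains \<B> :: "('a::topological_space) set set" where "countable \<B>" "\<B> \<noteq> {}" "\<And>B. B \<in> \<B> \<Longrightarrow> open B"
    "\<And>U x. open U \<Longrightarrow> x \<in> U \<Longrightarrow> \<exists>B\<in>\<B>. x \<in> B \<and> B \<subseteq> U"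
proof -
  obtain C d where md: "Metric_space C d" and top: "(euclidean :: 'a topology) = Metric_space.mtopology C d"
    using m unfolding metrizable_space_def by blast
  interpret Metric_space C d by (rule md)
  have C: "C = UNIV" using arg_cong[OF top, of topspace] by simp
  have UC: "x \<in> C" for x by (simp add: C)
  have "compactin mtopology UNIV" using K by (simp flip: top)
  then have "mtotally_bounded UNIV" by (rule compactin_imp_mtotally_bounded)
  then have "\<forall>n::nat. \<exists>F. finite F \<and> UNIV \<subseteq> (\<Union>x\<in>F. mball x (1 / real (Suc n)))"
    unfolding mtotally_bounded_def by (metis of_nat_0_less_iff zero_less_Suc zero_less_divide_1_iff)
  then obtain F where F: "\<And>n. finite (F n)" "\<And>n. UNIV \<subseteq> (\<Union>x\<in>F n. mball x (1 / real (Suc n)))"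
    by metis
  \<comment> \<open>Total boundedness provides, for every n, a finite cover by balls of radius
    \<open>1 / (n + 1)\<close>; the basis collects all of these balls.\<close>
  define \<B> where "\<B> = (\<Union>n. (\<lambda>x. mball x (1 / real (Suc n))) ` F n)"
  have "countable \<B>"
    unfolding \<B>_def using F(1) by (intro countable_UN countable_image) (auto intro: countable_finite)
  moreover have "F 0 \<noteq> {}" using F(2)[of 0] by auto
  then have "\<B> \<noteq> {}" by (auto simp: \<B>_def)
  moreover have "open B" if "B \<in> \<B>" for B
    using that openin_mball by (auto simp: \<B>_def open_openin top)
  moreover have "\<exists>B\<in>\<B>. x \<in> B \<and> B \<subseteq> U" if U: "open U" "x \<in> U" for U x
  proof -
    have "openin mtopology U" using U(1) by (simp add: open_openin top)
    then obtain r where r: "r > 0" "mball x r \<subseteq> U" using U(2) unfolding openin_mtopology by blast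
    \<comment> \<open>Half of \<open>r\<close>, because a ball of radius \<open>1 / (n + 1)\<close>
      that contains \<open>x\<close> need not be centred there: its points have distance below
      \<open>2 / (n + 1)\<close> from \<open>x\<close>.\<close>
    obtain n where n: "1 / real (Suc n) < r / 2" using nat_approx_posE[of "r / 2"] r(1) by auto
    obtain y where y: "y \<in> F n" "x \<in> mball y (1 / real (Suc n))" using F(2)[of n] by blast
    have "mball y (1 / real (Suc n)) \<subseteq> mball x r"
    proof
      fix z assume z: "z \<in> mball y (1 / real (Suc n))"
      have "d x z \<le> d x y + d y z" by (intro triangle UC)
      also have "\<dots> < r" using y(2) z n by (auto simp: commute)
      finally show "z \<in> mball x r" by (simp add: UC)
    qed
    then show ?thesis using y r(2) by (intro bexI[of _ "mball y (1 / real (Suc n))"]) (auto simp: \<B>_def)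
  qed
  ultimately show thesis by (rule that)
qed

text \<open>The mixture is formed for the functionals, since the Riesz representation then makes it regular.\<close>

lemma countable_mixture:
  fixes \<S> :: "('a::t2_space) CK_op set" and N :: "nat \<Rightarrow> 'a measure"
  assumes K: "compact (UNIV :: 'a set)" and mk: "\<forall>S\<in>\<S>. markov_op S" and N: "\<And>n. N n \<in> inv_prob \<S>"
  shows "\<exists>M\<in>inv_prob \<S>. \<forall>f :: 'a \<Rightarrow> real. continuous_on UNIV f \<longrightarrow> (\<forall>x. 0 \<le> f x) \<longrightarrow>
    (\<integral>x. f x \<partial>M) = 0 \<longleftrightarrow> (\<forall>n. (\<integral>x. f x \<partial>N n) = 0)"
proof -
  have reg: "regular_prob (N n)" for n using N by (simp add: inv_prob_def)
  have pr: "prob_space (N n)" for n using reg by (simp add: regular_prob_def)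
  have int: "integrable (N n) f" if "continuous_on UNIV f" for f :: "'a \<Rightarrow> real" and n
    by (rule regular_prob_integrable[OF K reg that])
  \<comment> \<open>The weights sum to 1, so \<open>L\<close> is a state. They are all positive, so
    on nonnegative functions \<open>L\<close> vanishes only if every term does.\<close>
  define L where "L f = (\<Sum>n. (1/2) ^ Suc n * (\<integral>x. f x \<partial>N n))" for f :: "'a \<Rightarrow> real"
  have summ: "summable (\<lambda>n. (1/2) ^ Suc n * (\<integral>x. f x \<partial>N n))" if f: "continuous_on UNIV f" for f :: "'a \<Rightarrow> real"
  proof -
    obtain B where B: "\<And>x. \<bar>f x\<bar> \<le> B"
      using compact_imp_bounded[OF compact_continuous_image[OF f K]] by (auto simp: bounded_iff)
    have le: "\<bar>\<integral>x. f x \<partial>N n\<bar> \<le> B" for n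
    proof -
      interpret prob_space "N n" by (rule pr)
      have "\<bar>\<integral>x. f x \<partial>N n\<bar> \<le> (\<integral>x. \<bar>f x\<bar> \<partial>N n)" by (rule integral_abs_bound)
      also have "\<dots> \<le> (\<integral>x. B \<partial>N n)"
        by (intro integral_mono integrable_abs int f B) simp
      finally show ?thesis by (simp add: prob_space)
    qed
    have s: "summable (\<lambda>n. (1/2 :: real) ^ Suc n * B)"
      by (intro summable_mult2 sums_summable[OF power_half_series])
    show ?thesis
    proof (rule summable_comparison_test'[OF s])
      fix n
      show "norm ((1/2) ^ Suc n * (\<integral>x. f x \<partial>N n)) \<le> (1/2) ^ Suc n * B"
        using mult_left_mono[OF le[of n], of "(1/2) ^ Suc n"] by (simp add: abs_mult)
    qed
  qed
  interpret compact_state L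
  proof
    show "compact (UNIV :: 'a set)" by (rule K)
    fix f g :: "'a \<Rightarrow> real" and c :: real assume f: "continuous_on UNIV f"
    show "L (\<lambda>x. c * f x) = c * L f"
      unfolding L_def using suminf_mult[OF summ[OF f], of c] by (simp add: mult.left_commute)
    show "0 \<le> L f" if "\<And>x. 0 \<le> f x"
      unfolding L_def using that by (intro suminf_nonneg summ[OF f]) simp
    assume g: "continuous_on UNIV g"
    show "L (\<lambda>x. f x + g x) = L f + L g"
      unfolding L_def using suminf_add[OF summ[OF f] summ[OF g]] int[OF f] int[OF g]
      by (simp add: distrib_left)
  next
    have "(\<integral>x. 1 \<partial>N n) = (1::real)" for n
      using pr[of n] by (simp add: prob_space.prob_space)
    then show "L (\<lambda>_. 1) = 1" unfolding L_def using sums_unique[OF power_half_series] by simp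
  qed
  have "riesz_measure \<in> inv_prob \<S>"
  proof (rule inv_probI[OF K mk regular_prob_riesz])
    fix S and f :: "'a \<Rightarrow> real" assume S: "S \<in> \<S>" and f: "continuous_on UNIV f"
    have "L (real_op S f) = L f"
      unfolding L_def using inv_prob_real_op[OF K mk N S f] by simp
    then show "(\<integral>x. real_op S f x \<partial>riesz_measure) = (\<integral>x. f x \<partial>riesz_measure)"
      using riesz_representation[OF f] riesz_representation[OF continuous_on_real_op] by simp
  qed
  moreover have "(\<integral>x. f x \<partial>riesz_measure) = 0 \<longleftrightarrow> (\<forall>n. (\<integral>x. f x \<partial>N n) = 0)"
    if f: "continuous_on UNIV f" and pos: "\<forall>x. 0 \<le> f x" for f :: "'a \<Rightarrow> real"
  proof -
    have "L f = 0 \<longleftrightarrow> (\<forall>n. (1/2) ^ Suc n * (\<integral>x. f x \<partial>N n) = 0)"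
      unfolding L_def using pos by (intro suminf_eq_zero_iff summ[OF f]) simp
    then show ?thesis using riesz_representation[OF f] by simp
  qed
  ultimately show ?thesis by blast
qed

text \<open>Radicality makes \<open>I\<close> the intersection of the kernels of all measures in
  \<open>\<F>\<close>, while the kernel of a mixture is the intersection of countably many. The
  selected measures must therefore detect every f that some measure in \<open>\<F>\<close>
  detects.\<close>

lemma radical_imp_abs_kernel:
  fixes \<S> :: "('a::t2_space) CK_op set"
  assumes K: "compact (UNIV :: 'a set)" and mk: "\<forall>S\<in>\<S>. markov_op S"
    and m: "metrizable_space (euclidean :: 'a topology)" and I: "radical_ideal \<S> I"
  shows "\<exists>M\<in>inv_prob \<S>. I = abs_kernel M"
proof -
  define \<F> where "\<F> = {N \<in> inv_prob \<S>. ergodic_measure \<S> N \<and> I \<subseteq> abs_kernel N}"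
  have I_eq: "I = S_radical \<S> I" and ne: "I \<noteq> UNIV"
    using I by (simp_all add: radical_ideal_def S_ideal_def)
  have notin: "\<exists>N\<in>\<F>. f \<notin> abs_kernel N" if "f \<notin> I" for f
  proof -
    have "f \<notin> S_radical \<S> I" using that I_eq by simp
    then show ?thesis unfolding S_radical_def Prim_def \<F>_def by blast
  qed
  then obtain N0 where N0: "N0 \<in> \<F>" using ne by blast
  obtain \<B> :: "'a set set" where \<B>: "countable \<B>" "\<B> \<noteq> {}" "\<And>B. B \<in> \<B> \<Longrightarrow> open B"
    and basis: "\<And>U x. open U \<Longrightarrow> x \<in> U \<Longrightarrow> \<exists>B\<in>\<B>. x \<in> B \<and> B \<subseteq> U"
    by (rule compact_metrizable_countable_basis[OF K m]) (rule that)
  define b where "b = from_nat_into \<B>"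
  have b: "range b = \<B>" unfolding b_def using \<B>(1,2) by simp
  \<comment> \<open>If no measure in \<open>\<F>\<close> charges \<open>b n\<close>, any choice will
    do, and \<open>N0\<close> shows that one exists.\<close>
  have "\<forall>n. \<exists>N\<in>\<F>. (\<exists>N'\<in>\<F>. emeasure N' (b n) \<noteq> 0) \<longrightarrow> emeasure N (b n) \<noteq> 0"
    using N0 by blast
  then obtain N where N: "\<And>n. N n \<in> \<F>"
    and Nb: "\<And>n N'. N' \<in> \<F> \<Longrightarrow> emeasure N' (b n) \<noteq> 0 \<Longrightarrow> emeasure (N n) (b n) \<noteq> 0"
    by metis
  have Ninv: "N n \<in> inv_prob \<S>" for n using N[of n] by (simp add: \<F>_def)
  from countable_mixture[where N = N, OF K mk Ninv]
  obtain M where M: "M \<in> inv_prob \<S>"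
    and MN: "\<And>f :: 'a \<Rightarrow> real. continuous_on UNIV f \<Longrightarrow> (\<And>x. 0 \<le> f x) \<Longrightarrow>
      (\<integral>x. f x \<partial>M) = 0 \<longleftrightarrow> (\<forall>n. (\<integral>x. f x \<partial>N n) = 0)"
    by auto
  have ker: "f \<in> abs_kernel M \<longleftrightarrow> (\<forall>n. f \<in> abs_kernel (N n))" for f
    using MN[OF continuous_on_cmod_CK] by (simp add: abs_kernel_iff)
  have ker_null: "f \<in> abs_kernel P \<longleftrightarrow> emeasure P {x. f x \<noteq> 0} = 0" if P: "P \<in> \<F>" for f P
  proof -
    have reg: "regular_prob P" using P by (simp add: \<F>_def inv_prob_def)
    have sp: "space P = UNIV" and [measurable_cong]: "sets P = sets borel"
      using reg sets_eq_imp_space_eq[of P borel] by (simp_all add: regular_prob_def)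
    have int: "integrable P (\<lambda>x. cmod (f x))"
      by (rule regular_prob_integrable[OF K reg continuous_on_cmod_CK])
    have "open {x. f x \<noteq> 0}"
      by (intro open_Collect_neq continuous_intros continuous_on_apply_bcontfun)
    then have meas: "{x. f x \<noteq> 0} \<in> sets P" using reg by (simp add: regular_prob_def)
    have "f \<in> abs_kernel P \<longleftrightarrow> (AE x in P. f x = 0)"
      unfolding abs_kernel_iff using integral_nonneg_eq_0_iff_AE[OF int] by simp
    also have "\<dots> \<longleftrightarrow> emeasure P {x. f x \<noteq> 0} = 0"
      using meas sp by (subst AE_iff_measurable[OF _ refl]) auto
    finally show ?thesis .
  qed
  have "f \<in> I" if f: "f \<in> abs_kernel M" for f
  proof (rule ccontr)
    assume "f \<notin> I"
    then obtain P where P: "P \<in> \<F>" "f \<notin> abs_kernel P" using notin by blast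
    let ?U = "{x. f x \<noteq> 0}"
    have U: "open ?U"
      by (intro open_Collect_neq continuous_intros continuous_on_apply_bcontfun)
    have setsP: "sets P = sets borel" if "P \<in> \<F>" for P :: "'a measure"
      using that by (simp add: \<F>_def inv_prob_def regular_prob_def)
    \<comment> \<open>Otherwise \<open>?U\<close>, the union of the basic sets inside it, would be a
      countable union of null sets of \<open>P\<close>.\<close>
    have "\<exists>n. b n \<subseteq> ?U \<and> emeasure P (b n) \<noteq> 0"
    proof (rule ccontr)
      assume neg: "\<not> ?thesis"
      have "(\<Union>n\<in>{n. b n \<subseteq> ?U}. b n) \<in> null_sets P"
      proof (rule null_sets_UN')
        show "countable {n. b n \<subseteq> ?U}" by simp
        fix n assume "n \<in> {n. b n \<subseteq> ?U}"
        then have "emeasure P (b n) = 0" using neg by blast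
        moreover have "open (b n)" using \<B>(3) b by blast
        then have "b n \<in> sets P" using setsP[OF P(1)] by simp
        ultimately show "b n \<in> null_sets P" by (simp add: null_sets_def)
      qed
      moreover have "?U \<subseteq> (\<Union>n\<in>{n. b n \<subseteq> ?U}. b n)"
      proof
        fix x assume "x \<in> ?U"
        then obtain B where "B \<in> \<B>" "x \<in> B" "B \<subseteq> ?U" using basis[OF U] by blast
        then show "x \<in> (\<Union>n\<in>{n. b n \<subseteq> ?U}. b n)" using b by blast
      qed
      ultimately have "?U \<in> null_sets P"
        using U setsP[OF P(1)] by (intro null_sets_subset[of _ P ?U]) auto
      then show False using P ker_null[OF P(1)] by (simp add: null_sets_def)
    qed
    then obtain n where n: "b n \<subseteq> ?U" "emeasure P (b n) \<noteq> 0" by blast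
    have "emeasure (N n) (b n) \<le> emeasure (N n) ?U"
      using n(1) U setsP[OF N] by (intro emeasure_mono) auto
    then have "emeasure (N n) ?U \<noteq> 0" using Nb[OF P(1) n(2)] by auto
    then show False using f ker ker_null[OF N] by blast
  qed
  moreover have "f \<in> abs_kernel M" if "f \<in> I" for f
    using that N unfolding ker \<F>_def by blast
  ultimately show ?thesis using M by blast
qed

theorem proposition3p7:
  fixes \<S> :: "('a::t2_space) CK_op set"
  assumes "compact (UNIV :: 'a set)"
    and "op_semigroup \<S>"
    and "right_amenable \<S>"
    and "\<forall>S\<in>\<S>. markov_op S"
  shows "(\<forall>M\<in>inv_prob \<S>. radical_ideal \<S> (abs_kernel M)) \<and>
         (metrizable_space (euclidean :: 'a topology) \<longrightarrow>
            (\<forall>I. radical_ideal \<S> I \<longrightarrow> (\<exists>M\<in>inv_prob \<S>. I = abs_kernel M)))"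
  using abs_kernel_radical[OF assms(1,4)] radical_imp_abs_kernel[OF assms(1,4)] by blast

end
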